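(* Put $\delta_0=\mathrm{ganit}_{\mathrm{pic}}\circ Q\circ\mathrm{ganit}_{\mathrm{poc}}$. For every $A\in\mathrm{BARI}^{\mathrm{pol}}$, one has $$\delta_0(A)=\delta_{\mathrm{BvI}}(A)-\mathrm{preuri}(A,E),\qquad\check\delta(A)=\delta_{\mathrm{BvI}}(A)-\mathrm{preuri}(E,A).$$
   Context: **Bimoulds.** A bimould is a family $A=(A_r)_{r\ge0}$ with $A_r=A_r(X_1,\dots,X_r\mid Y_1,\dots,Y_r)\in\mathbb Q[[X_1,Y_1,\dots,X_r,Y_r]]$ (component of depth $r$); we also allow components in $\mathcal L_r=\mathbb Q[[X_1,Y_1,\dots,X_r,Y_r]]\left[\tfrac1{X_i},\tfrac1{X_i-X_j}\mid 1\le i\ne j\le r\right]$. $\mathrm{BARI}^{\mathrm{loc}}$ is the space of families with $A_0=0$, $A_r\in\mathcal L_r$. $\mathrm{BARI}^{\mathrm{pol}}$ is its subspace of families with polynomial components, only finitely many of them nonzero. A bimould is normalized if $A_0=1$. Write $Y_{a:b}=Y_a+\dots+Y_b$. **Flexion operations.** $\mathrm{mu}(A,B)_r=\sum_{i=0}^rA_i(X_1,\dots,X_i\mid Y_1,\dots,Y_i)\,B_{r-i}(X_{i+1},\dots,X_r\mid Y_{i+1},\dots,Y_r)$. For $B$ with $B_0=0$, $$\mathrm{amit}(B)(A)_r=\sum_{1\le a<b\le r}A_{r-b+a}(X_1,\dots,X_{a-1},X_b,X_{b+1},\dots,X_r\mid Y_1,\dots,Y_{a-1},Y_{a:b},Y_{b+1},\dots,Y_r)\,B_{b-a}(X_a-X_b,\dots,X_{b-1}-X_b\mid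 Y_a,\dots,Y_{b-1}),$$ $$\mathrm{anit}(B)(A)_r=\sum_{1\le a<b\le r}A_{r-b+a}(X_1,\dots,X_{a-1},X_a,X_{b+1},\dots,X_r\mid Y_1,\dots,Y_{a-1},Y_{a:b},Y_{b+1},\dots,Y_r)\,B_{b-a}(X_{a+1}-X_a,\dots,X_b-X_a\mid Y_{a+1},\dots,Y_b),$$ $\mathrm{arit}(B)=\mathrm{amit}(B)-\mathrm{anit}(B)$, $\mathrm{preari}(A,B)=\mathrm{arit}(B)(A)+\mathrm{mu}(A,B)$, $\mathrm{ari}(A,B)=\mathrm{preari}(A,B)-\mathrm{preari}(B,A)$. For normalized $C$, $\mathrm{ganit}_C(A)_0=A_0$ and for $r\ge1$ $$\mathrm{ganit}_C(A)_r=\sum_{s\ge1}\ \sum_{0=q_0<q_1<\dots<q_s=r}A_s(X_{q_0+1},\dots,X_{q_{s-1}+1}\mid Y_{q_0+1:q_1},\dots,Y_{q_{s-1}+1:q_s})\prod_{i=1}^sC_{q_i-q_{i-1}-1}(X_{q_{i-1}+2}-X_{q_{i-1}+1},\dots,X_{q_i}-X_{q_{i-1}+1}\mid Y_{q_{i-1}+2},\dots,Y_{q_i}).$$ Let $\mathrm{pic},\mathrm{poc}$ be the normalized bimoulds with $\mathrm{pic}_r=\frac1{X_1\cdots X_r}$, $\mathrm{poc}_r=-\frac1{X_1(X_1-X_2)\cdots(X_{r-1}-X_r)}$ for $r\ge1$. The operators $\mathrm{ganit}_{\mathrm{pic}}$ and $\mathrm{ganit}_{\mathrm{poc}}$ are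 mutually inverse, and $\mathrm{uri}(A,B)=\mathrm{ganit}_{\mathrm{pic}}\bigl(\mathrm{ari}(\mathrm{ganit}_{\mathrm{poc}}A,\mathrm{ganit}_{\mathrm{poc}}B)\bigr)$. **The product preuri.** Let $\mathcal D_r(F\mid z_0,\dots,z_r)=\sum_{s=0}^r\frac{F(z_s)}{\prod_{k\ne s}(z_k-z_s)}$. For $B\in\mathrm{BARI}^{\mathrm{pol}}$ define the bimould $C(B)$ by $C(B)_0=C(B)_1=0$ and, for $m\ge2$, $C(B)_m=\sum_{r=1}^{m-1}\bigl(L_{m,r}(B)-R_{m,r}(B)\bigr)$, where $$L_{m,r}(B)=\mathcal D_r\bigl(t\mapsto B_{m-r}(X_r-t,\dots,X_{m-1}-t\mid Y_r,\dots,Y_{m-1})\ \big|\ 0,X_1,\dots,X_{r-1},X_m\bigr),$$ $$R_{m,r}(B)=\mathcal D_r\bigl(t\mapsto B_{m-r}(X_{r+1}-t,\dots,X_m-t\mid Y_{r+1},\dots,Y_m)\ \big|\ 0,X_1,\dots,X_r\bigr).$$ Put $\mathrm{urit}(B)=\mathrm{arit}(B)+\mathrm{anit}(C(B))$ and $\mathrm{preuri}(A,B)=\mathrm{urit}(B)(A)+\mathrm{mu}(A,B)$. **The operators.** $E$ is the bimould with $E_1=-\frac{X_1+Y_1}2$, $E_2=\frac14$ and all other components zero; $(QA)_r=\bigl(\sum_{i=1}^rX_iY_i\bigr)A_r$; $\check\delta(A)=\mathrm{ganit}_{\mathrm{pic}}\bigl(Q(\mathrm{ganit}_{\mathrm{poc}}(A))\bigr)+\mathrm{uri}(A,E)$.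 **The operator $\delta_{\mathrm{BvI}}$.** Let $p_i(X)$ be the tuple $(X_1,\dots,X_r)$ with $X_i$ deleted. Let $c_{i,i+1}(Y)=(Y_1,\dots,Y_{i-1},Y_i+Y_{i+1},Y_{i+2},\dots,Y_r)$ for $1\le i<r$ and $c_{r,r+1}(Y)=(Y_1,\dots,Y_{r-1})$. Define $(\varphi_i^+A)_r(X\mid Y)=A_{r-1}(p_i(X)\mid c_{i,i+1}(Y))$ for $1\le i\le r$ and $(\varphi_i^-A)_r(X\mid Y)=A_{r-1}(p_i(X)\mid c_{i-1,i}(Y))$ for $2\le i\le r$, and zero outside these ranges; squares denote iterates. Set $(\delta_{\mathrm{BvI}}A)_0=0$ and, for $r\ge1$, with the convention $X_{r+1}=0$, $$(\delta_{\mathrm{BvI}}A)_r=(QA)_r-\frac12\sum_{i=1}^r(X_i-X_{i+1}+Y_i)(\varphi_i^+A)_r-\frac12\sum_{i=2}^r(X_{i-1}-X_i+Y_i)(\varphi_i^-A)_r+\frac14\sum_{i=1}^{r-1}((\varphi_i^+)^2A)_r-\frac14\sum_{i=2}^{r-1}((\varphi_i^-)^2A)_r.$$ *)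

theory Defs
  imports
    Complex_Main
    "HOL-Library.Poly_Mapping"
    "HOL-Library.Function_Algebras"
    "HOL-Computational_Algebra.Fraction_Field"
begin

section \<open>Rational functions in the variables X and Y\<close>

text \<open>
  Polynomials over the rationals in countably many variables are finitely supported functions on
  monomials. All bimoulds below have their components in the field of fractions of this ring.
  Every bimould obtained from polynomial ones and from pic, poc by the operations below has its
  depth r component in the localisation of the polynomial ring in X_1, Y_1, ..., X_r, Y_r at the
  elements X_i and X_i - X_j; this is a common subring of the field of fractions and of the
  localised power series ring, so no power series are needed.
\<close>

type_synonym qpoly = "(nat \<Rightarrow>\<^sub>0 nat) \<Rightarrow>\<^sub>0 rat"
type_synonym ratfun = "qpoly fract"

text \<open>The variable X_i has index 2 i and Y_i has index 2 i + 1, where i starts from 1.\<close>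

definition var :: "nat \<Rightarrow> ratfun" where
  "var n = Fract (Poly_Mapping.single (Poly_Mapping.single n 1) 1) 1"

definition vX :: "nat \<Rightarrow> ratfun" where "vX i = var (2 * i)"
definition vY :: "nat \<Rightarrow> ratfun" where "vY i = var (2 * i + 1)"

definition const :: "rat \<Rightarrow> ratfun" where
  "const c = Fract (Poly_Mapping.single 0 c) 1"

definition monom_subst :: "(nat \<Rightarrow> ratfun) \<Rightarrow> (nat \<Rightarrow>\<^sub>0 nat) \<Rightarrow> ratfun" where
  "monom_subst \<sigma> m = (\<Prod>v\<in>Poly_Mapping.keys m. \<sigma> v ^ Poly_Mapping.lookup m v)"

definition poly_subst :: "(nat \<Rightarrow> ratfun) \<Rightarrow> qpoly \<Rightarrow> ratfun" where
  "poly_subst \<sigma> p =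
     (\<Sum>m\<in>Poly_Mapping.keys p. const (Poly_Mapping.lookup p m) * monom_subst \<sigma> m)"

text \<open>
  Substitution into a rational function is meaningful only if some denominator of it survives the
  substitution. The value does not depend on the representation, see \<open>rat_subst_Fract\<close>.
\<close>

definition rat_subst :: "(nat \<Rightarrow> ratfun) \<Rightarrow> ratfun \<Rightarrow> ratfun" where
  "rat_subst \<sigma> f = (THE g. \<exists>p q. poly_subst \<sigma> q \<noteq> 0 \<and> f = Fract p q \<and>
                            g = poly_subst \<sigma> p / poly_subst \<sigma> q)"

lemma monom_subst_superset:
  assumes "finite S" "Poly_Mapping.keys m \<subseteq> S"
  shows "monom_subst \<sigma> m = (\<Prod>v\<in>S. \<sigma> v ^ Poly_Mapping.lookup m v)"
  unfolding monom_subst_def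
  by (rule prod.mono_neutral_left) (use assms in \<open>auto simp: in_keys_iff\<close>)

lemma monom_subst_add: "monom_subst \<sigma> (m + n) = monom_subst \<sigma> m * monom_subst \<sigma> n"
proof -
  let ?S = "Poly_Mapping.keys m \<union> Poly_Mapping.keys n"
  have "monom_subst \<sigma> (m + n) = (\<Prod>v\<in>?S. \<sigma> v ^ Poly_Mapping.lookup (m + n) v)"
    by (rule monom_subst_superset) (use Poly_Mapping.keys_add[of m n] in auto)
  moreover have "monom_subst \<sigma> m = (\<Prod>v\<in>?S. \<sigma> v ^ Poly_Mapping.lookup m v)"
    by (rule monom_subst_superset) auto
  moreover have "monom_subst \<sigma> n = (\<Prod>v\<in>?S. \<sigma> v ^ Poly_Mapping.lookup n v)"
    by (rule monom_subst_superset) auto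
  ultimately show ?thesis by (simp add: lookup_add power_add prod.distrib)
qed

lemma const_0: "const 0 = 0"
  by (simp add: const_def Zero_fract_def)

lemma const_add: "const (a + b) = const a + const b"
  by (simp add: const_def single_add)

lemma const_mult: "const (a * b) = const a * const b"
  by (simp add: const_def mult_single)

lemma poly_subst_add: "poly_subst \<sigma> (p + q) = poly_subst \<sigma> p + poly_subst \<sigma> q"
  unfolding poly_subst_def
  by (rule setsum_keys_plus_distrib) (simp_all add: const_0 const_add algebra_simps)

lemma poly_subst_0: "poly_subst \<sigma> 0 = 0"
  by (simp add: poly_subst_def)

lemma poly_subst_single: "poly_subst \<sigma> (Poly_Mapping.single m c) = const c * monom_subst \<sigma> m"
  by (simp add: poly_subst_def const_0)

lemma qpoly_induct [case_names zero single_add]: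
  fixes p :: qpoly
  assumes "P 0" "\<And>m c p. P p \<Longrightarrow> P (Poly_Mapping.single m c + p)"
  shows "P p"
proof (induction p rule: update_induct)
  case const
  then show ?case using assms by simp
next
  case (update f a b)
  have "Poly_Mapping.update a b f = Poly_Mapping.single a b + f"
    using update by (intro poly_mapping_eqI)
      (auto simp: lookup_update lookup_add lookup_single in_keys_iff when_def)
  then show ?case using assms update by simp
qed

lemma poly_subst_mult: "poly_subst \<sigma> (p * q) = poly_subst \<sigma> p * poly_subst \<sigma> q"
proof (induction p rule: qpoly_induct)
  case zero
  then show ?case by (simp add: poly_subst_0)
next
  case (single_add m c p)
  have "poly_subst \<sigma> (Poly_Mapping.single m c * q)
      = poly_subst \<sigma> (Poly_Mapping.single m c) * poly_subst \<sigma> q"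
    by (induction q rule: qpoly_induct)
      (simp_all add: poly_subst_0 poly_subst_add poly_subst_single distrib_left mult_single
        const_mult monom_subst_add algebra_simps)
  with single_add show ?case by (simp add: distrib_right poly_subst_add)
qed

lemma rat_subst_Fract:
  assumes "poly_subst \<sigma> q \<noteq> 0"
  shows "rat_subst \<sigma> (Fract p q) = poly_subst \<sigma> p / poly_subst \<sigma> q"
  unfolding rat_subst_def
proof (rule the_equality)
  fix g
  assume "\<exists>p' q'. poly_subst \<sigma> q' \<noteq> 0 \<and> Fract p q = Fract p' q' \<and>
                  g = poly_subst \<sigma> p' / poly_subst \<sigma> q'"
  then obtain p' q' where *: "poly_subst \<sigma> q' \<noteq> 0" "Fract p q = Fract p' q'"
      "g = poly_subst \<sigma> p' / poly_subst \<sigma> q'" by blast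
  have "q \<noteq> 0" "q' \<noteq> 0" using assms * poly_subst_0 by auto
  with * have "p * q' = p' * q" by (simp add: eq_fract)
  then have "poly_subst \<sigma> p * poly_subst \<sigma> q' = poly_subst \<sigma> p' * poly_subst \<sigma> q"
    by (metis poly_subst_mult)
  then show "g = poly_subst \<sigma> p / poly_subst \<sigma> q"
    using * assms by (simp add: frac_eq_eq)
qed (use assms in blast)

text \<open>
  \<open>f \<langle>xs | ys\<rangle>\<close> is f(x_1, ..., x_r | y_1, ..., y_r). Variables beyond the lengths of the lists are
  sent to 0; they do not occur when f is a component of depth r.
\<close>

definition args :: "ratfun list \<Rightarrow> ratfun list \<Rightarrow> nat \<Rightarrow> ratfun" where
  "args xs ys n =
     (let zs = (if even n then xs else ys); i = n div 2
      in if 1 \<le> i \<and> i \<le> length zs then zs ! (i - 1) else 0)"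

definition subst :: "ratfun \<Rightarrow> ratfun list \<Rightarrow> ratfun list \<Rightarrow> ratfun"
    (\<open>_ \<langle>_ | _\<rangle>\<close> [1000, 0, 0] 999) where
  "f \<langle>xs | ys\<rangle> = rat_subst (args xs ys) f"

text \<open>The tuples (X_a, ..., X_b) and (Y_a, ..., Y_b), empty if a > b, and Y_a + ... + Y_b.\<close>

definition Xs :: "nat \<Rightarrow> nat \<Rightarrow> ratfun list" where "Xs a b = map vX [a..<Suc b]"
definition Ys :: "nat \<Rightarrow> nat \<Rightarrow> ratfun list" where "Ys a b = map vY [a..<Suc b]"
definition Ysum :: "nat \<Rightarrow> nat \<Rightarrow> ratfun" where "Ysum a b = (\<Sum>i=a..b. vY i)"

section \<open>Bimoulds\<close>

type_synonym bimould = "nat \<Rightarrow> ratfun"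

definition polynomials_of_depth :: "nat \<Rightarrow> ratfun set" where
  "polynomials_of_depth r =
     {Fract p 1 | p. \<forall>m\<in>Poly_Mapping.keys p.
        Poly_Mapping.keys m \<subseteq> (\<Union>i\<in>{1..r}. {2 * i, 2 * i + 1})}"

definition BARI_pol :: "bimould set" where
  "BARI_pol = {A. A 0 = 0 \<and> (\<forall>r. A r \<in> polynomials_of_depth r) \<and> finite {r. A r \<noteq> 0}}"

definition mu :: "bimould \<Rightarrow> bimould \<Rightarrow> bimould" where
  "mu A B r = (\<Sum>i=0..r. (A i) \<langle>Xs 1 i | Ys 1 i\<rangle> * (B (r - i)) \<langle>Xs (i + 1) r | Ys (i + 1) r\<rangle>)"

definition amit :: "bimould \<Rightarrow> bimould \<Rightarrow> bimould" where
  "amit B A r = (\<Sum>(a, b)\<in>{(a, b). 1 \<le> a \<and> a < b \<and> b \<le> r}.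
     (A (r - (b - a))) \<langle>Xs 1 (a - 1) @ Xs b r | Ys 1 (a - 1) @ Ysum a b # Ys (b + 1) r\<rangle> *
     (B (b - a)) \<langle>map (\<lambda>j. vX j - vX b) [a..<b] | Ys a (b - 1)\<rangle>)"

definition anit :: "bimould \<Rightarrow> bimould \<Rightarrow> bimould" where
  "anit B A r = (\<Sum>(a, b)\<in>{(a, b). 1 \<le> a \<and> a < b \<and> b \<le> r}.
     (A (r - (b - a))) \<langle>Xs 1 a @ Xs (b + 1) r | Ys 1 (a - 1) @ Ysum a b # Ys (b + 1) r\<rangle> *
     (B (b - a)) \<langle>map (\<lambda>j. vX j - vX a) [a + 1..<b + 1] | Ys (a + 1) b\<rangle>)"

definition arit :: "bimould \<Rightarrow> bimould \<Rightarrow> bimould" where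
  "arit B A = amit B A - anit B A"

definition preari :: "bimould \<Rightarrow> bimould \<Rightarrow> bimould" where
  "preari A B = arit B A + mu A B"

definition ari :: "bimould \<Rightarrow> bimould \<Rightarrow> bimould" where
  "ari A B = preari A B - preari B A"

text \<open>The sequences 0 = q_0 < ... < q_s = r, as lists of length s + 1; s \<ge> 1 if r \<ge> 1.\<close>

definition subdivisions :: "nat \<Rightarrow> nat list set" where
  "subdivisions r = {q. q \<noteq> [] \<and> hd q = 0 \<and> last q = r \<and> sorted_wrt (<) q}"

lemma finite_subdivisions: "finite (subdivisions r)"
proof (rule finite_subset)
  show "subdivisions r \<subseteq> {q. set q \<subseteq> {0..r} \<and> distinct q}"
  proof clarsimp
    fix q assume q: "q \<in> subdivisions r"
    then have srt: "sorted_wrt (<) q" and q': "q \<noteq> []" "last q = r"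
      by (auto simp: subdivisions_def)
    from q' have qq: "q = butlast q @ [r]" by (metis append_butlast_last_id)
    with srt have "sorted_wrt (<) (butlast q @ [r])" by metis
    then have "\<forall>x\<in>set (butlast q). x < r" by (simp add: sorted_wrt_append)
    with qq have "\<forall>x\<in>set q. x \<le> r"
      by (metis Un_iff empty_iff insert_iff list.set le_eq_less_or_eq set_append)
    then show "set q \<subseteq> {0..r} \<and> distinct q" using srt by (auto simp: strict_sorted_iff)
  qed
qed (rule finite_subset_distinct, simp)

definition ganit :: "bimould \<Rightarrow> bimould \<Rightarrow> bimould" where
  "ganit C A r =
     (if r = 0 then A 0 else
      (\<Sum>q\<in>subdivisions r. let s = length q - 1 in
         (A s) \<langle>map (\<lambda>i. vX (q ! (i - 1) + 1)) [1..<s + 1] |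
                map (\<lambda>i. Ysum (q ! (i - 1) + 1) (q ! i)) [1..<s + 1]\<rangle> *
         (\<Prod>i=1..s. (C (q ! i - q ! (i - 1) - 1))
            \<langle>map (\<lambda>j. vX j - vX (q ! (i - 1) + 1)) [q ! (i - 1) + 2..<q ! i + 1] |
             Ys (q ! (i - 1) + 2) (q ! i)\<rangle>)))"

definition pic :: bimould where
  "pic r = 1 / (\<Prod>i=1..r. vX i)"

definition poc :: bimould where
  "poc r = (if r = 0 then 1 else - 1 / (vX 1 * (\<Prod>i=1..<r. vX i - vX (i + 1))))"

definition uri :: "bimould \<Rightarrow> bimould \<Rightarrow> bimould" where
  "uri A B = ganit pic (ari (ganit poc A) (ganit poc B))"

section \<open>The product preuri\<close>

definition Ddiff :: "nat \<Rightarrow> (ratfun \<Rightarrow> ratfun) \<Rightarrow> ratfun list \<Rightarrow> ratfun" where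
  "Ddiff r F z = (\<Sum>s=0..r. F (z ! s) / (\<Prod>k\<in>{0..r} - {s}. z ! k - z ! s))"

definition Lterm :: "nat \<Rightarrow> nat \<Rightarrow> bimould \<Rightarrow> ratfun" where
  "Lterm m r B = Ddiff r
     (\<lambda>t. (B (m - r)) \<langle>map (\<lambda>j. vX j - t) [r..<m] | Ys r (m - 1)\<rangle>)
     (0 # Xs 1 (r - 1) @ [vX m])"

definition Rterm :: "nat \<Rightarrow> nat \<Rightarrow> bimould \<Rightarrow> ratfun" where
  "Rterm m r B = Ddiff r
     (\<lambda>t. (B (m - r)) \<langle>map (\<lambda>j. vX j - t) [r + 1..<m + 1] | Ys (r + 1) m\<rangle>)
     (0 # Xs 1 r)"

definition Cbim :: "bimould \<Rightarrow> bimould" where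
  "Cbim B m = (if m \<le> 1 then 0 else (\<Sum>r=1..m - 1. Lterm m r B - Rterm m r B))"

definition urit :: "bimould \<Rightarrow> bimould \<Rightarrow> bimould" where
  "urit B A = arit B A + anit (Cbim B) A"

definition preuri :: "bimould \<Rightarrow> bimould \<Rightarrow> bimould" where
  "preuri A B = urit B A + mu A B"

section \<open>The operators\<close>

definition Ebim :: bimould where
  "Ebim r = (if r = 1 then - (vX 1 + vY 1) / 2 else if r = 2 then 1 / 4 else 0)"

definition Qop :: "bimould \<Rightarrow> bimould" where
  "Qop A r = (\<Sum>i=1..r. vX i * vY i) * A r"

definition delta_check :: "bimould \<Rightarrow> bimould" where
  "delta_check A = ganit pic (Qop (ganit poc A)) + uri A Ebim"

definition pX :: "nat \<Rightarrow> nat \<Rightarrow> ratfun list" where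
  "pX i r = Xs 1 (i - 1) @ Xs (i + 1) r"

text \<open>\<open>cY i r\<close> is the tuple c_{i,i+1}(Y) of length r - 1.\<close>

definition cY :: "nat \<Rightarrow> nat \<Rightarrow> ratfun list" where
  "cY i r = (if i < r then Ys 1 (i - 1) @ (vY i + vY (i + 1)) # Ys (i + 2) r else Ys 1 (r - 1))"

definition phi_plus :: "nat \<Rightarrow> bimould \<Rightarrow> bimould" where
  "phi_plus i A r = (if 1 \<le> i \<and> i \<le> r then (A (r - 1)) \<langle>pX i r | cY i r\<rangle> else 0)"

definition phi_minus :: "nat \<Rightarrow> bimould \<Rightarrow> bimould" where
  "phi_minus i A r = (if 2 \<le> i \<and> i \<le> r then (A (r - 1)) \<langle>pX i r | cY (i - 1) r\<rangle> else 0)"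

definition delta_BvI :: "bimould \<Rightarrow> bimould" where
  "delta_BvI A r = (if r = 0 then 0 else
     (let X = (\<lambda>i. if i = r + 1 then 0 else vX i) in
        Qop A r
        - 1 / 2 * (\<Sum>i=1..r. (X i - X (i + 1) + vY i) * phi_plus i A r)
        - 1 / 2 * (\<Sum>i=2..r. (X (i - 1) - X i + vY i) * phi_minus i A r)
        + 1 / 4 * (\<Sum>i=1..r - 1. (phi_plus i ^^ 2) A r)
        - 1 / 4 * (\<Sum>i=2..r - 1. (phi_minus i ^^ 2) A r)))"

end

theory Submission
  imports Defs
begin

text \<open>
  Both identities come from conjugating Q and arit by ganit poc. Write \<open>G\<close> for ganit poc and \<open>P\<close> for ganit pic,
  and let \<open>Z\<close> be the bimould 1 / X_1 of depth 1. All operators in sight are tied to mu: \<open>G\<close> and \<open>P\<close>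
  are automorphisms, while amit, anit and Q are derivations. Polynomial bimoulds are sums of
  mu-products of bimoulds of depth 1, so identities between such operators need to be checked in
  depth 1 only (\<open>derivation_along_wganit\<close>). In depth 1, \<open>A = f(X_1 | Y_1)\<close>, every operator produces
  f evaluated at a single letter and at the sum of all Y, times a factor that does not depend
  on f; so each identity reduces to one that involves poc and pic but no longer f.

  These last identities are proved by induction on the depth, and the induction is driven by
  \<open>poc = G(1 - Z)\<close> (\<open>wpoc_eq\<close>): an identity for poc in depth r is the depth-1 case \<open>A = Z\<close> of the
  operator identity, which uses the identity for poc in depth less than r. In this way one gets
  \<open>P G = id\<close> (\<open>wganit_wpic_wpoc\<close>); the formula \<open>Q G = G (Q - anit(Y_1))\<close> (\<open>wQ_wganit_wpoc\<close>),
  where \<open>Y_1\<close> is in depth 1; and \<open>arit(G B) G = G urit(B)\<close> (\<open>wurit_wganit_wpoc_wC\<close>). For the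
  last one the induction needs exactly
  \<open>C = Z C - anit(C) Z - arit(B) Z - Z B + B Z\<close>, products being taken with mu. Written out, this is
  the recursion of divided differences in the first node \<open>X_1\<close> against the node 0, and therefore the
  explicit C(B) satisfies it (\<open>wC_rec\<close>).

  The formula for arit turns uri into the commutator of preuri (\<open>uri_eq\<close>), so the second identity
  follows from the first. For the first one, \<open>P Q G = Q - anit(Y_1)\<close>; moreover C(E) = 0, since E is
  of degree at most 1 and of depth at most 2 (\<open>wC_wE\<close>). What remains is to compare
  \<open>Q A - anit(Y_1) A + arit(E) A + mu(A, E)\<close> with the definition of delta BvI term by term
  (\<open>delta_BvI_eq\<close>).

  To keep substitutions of rational functions out of these arguments, the identities are proved
  for functions on lists of pairs (x, y) over an arbitrary field, at lists whose x are distinct and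
  nonzero. The second half of the text transfers them to bimoulds, for which substitution
  amounts to evaluation of such a function.
\<close>

section \<open>Words and their deconcatenations\<close>

text \<open>
  A letter carries an x and a y. The flexion operations only rearrange, shift and merge letters, so
  they make sense for functions of words over any field, in all depths at once.
\<close>

type_synonym 'k word = "('k \<times> 'k) list"
type_synonym 'k wmould = "'k word \<Rightarrow> 'k"

text \<open>
  The coproduct of words, paired with f. Every operation below is an iterated sum of this kind, and
  rearranging nested sums is then a matter of coassociativity (\<open>cuts_assoc\<close>) instead of index
  bookkeeping.
\<close>

definition cuts :: "('k word \<Rightarrow> 'k word \<Rightarrow> 'k) \<Rightarrow> 'k::field word \<Rightarrow> 'k" where
  "cuts f w = (\<Sum>i\<le>length w. f (take i w) (drop i w))"

lemma cuts_Nil [simp]: "cuts f [] = f [] []"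
  by (simp add: cuts_def)

lemma cuts_Cons: "cuts f (l # w) = f [] (l # w) + cuts (\<lambda>u v. f (l # u) v) w"
  unfolding cuts_def by (simp add: sum.atMost_Suc_shift del: sum.atMost_Suc)

lemma cuts_cong:
  assumes "\<And>u v. u @ v = w \<Longrightarrow> f u v = g u v"
  shows "cuts f w = cuts g w"
  unfolding cuts_def by (intro sum.cong refl assms) simp

lemma cuts_add: "cuts (\<lambda>u v. f u v + g u v) w = cuts f w + cuts g w"
  by (simp add: cuts_def sum.distrib)

lemma cuts_diff: "cuts (\<lambda>u v. f u v - g u v) w = cuts f w - cuts g w"
  by (simp add: cuts_def sum_subtractf)

lemma cuts_zero [simp]: "cuts (\<lambda>u v. 0) w = 0"
  by (simp add: cuts_def)

lemma cuts_mult_left: "cuts (\<lambda>u v. c * f u v) w = c * cuts f w"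
  by (simp add: cuts_def sum_distrib_left)

lemma cuts_mult_right: "cuts (\<lambda>u v. f u v * c) w = cuts f w * c"
  by (simp add: cuts_def sum_distrib_right)

lemma cuts_assoc:
  "cuts (\<lambda>u v. cuts (\<lambda>a b. f a b v) u) w = cuts (\<lambda>a z. cuts (\<lambda>b v. f a b v) z) w"
  by (induction w arbitrary: f) (simp_all add: cuts_Cons cuts_add add.assoc)

lemma cuts_snoc: "cuts f (w @ [l]) = cuts (\<lambda>u v. f u (v @ [l])) w + f (w @ [l]) []"
  by (induction w arbitrary: f) (simp_all add: cuts_Cons add.assoc)

lemma cuts_map: "cuts f (map h w) = cuts (\<lambda>u v. f (map h u) (map h v)) w"
  by (simp add: cuts_def take_map drop_map)

definition sh :: "'k::field \<Rightarrow> 'k word \<Rightarrow> 'k word" where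
  "sh t w = map (\<lambda>l. (fst l - t, snd l)) w"

definition ysum :: "'k::field word \<Rightarrow> 'k" where
  "ysum w = sum_list (map snd w)"

lemma sh_simps [simp]: "sh t [] = []" "sh t (l # w) = (fst l - t, snd l) # sh t w"
  "sh t (u @ v) = sh t u @ sh t v" "length (sh t w) = length w" "sh t w = [] \<longleftrightarrow> w = []"
  by (simp_all add: sh_def)

lemma sh_sh [simp]: "sh s (sh t w) = sh (s + t) w"
  by (simp add: sh_def o_def algebra_simps)

lemma ysum_simps [simp]: "ysum [] = 0" "ysum (l # w) = snd l + ysum w"
  "ysum (u @ v) = ysum u + ysum v" "ysum (sh t w) = ysum w"
  by (simp_all add: ysum_def sh_def o_def)

lemma cuts_sh: "cuts f (sh t w) = cuts (\<lambda>u v. f (sh t u) (sh t v)) w"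
  unfolding sh_def by (rule cuts_map)

lemma cuts_ysum:
  "cuts (\<lambda>u v. g (ysum u + ysum v) * f u v) w = g (ysum w) * cuts f w"
  unfolding cuts_mult_left [symmetric] by (rule cuts_cong) auto

text \<open>
  At these words all denominators of pic and poc, and of the divided differences of Cbim, are
  nonzero. The condition is inherited by factors, by words with merged letters, and by shifts along
  the x of a letter that has been removed.
\<close>

definition generic :: "'k::field word \<Rightarrow> bool" where
  "generic w \<longleftrightarrow> distinct (map fst w) \<and> 0 \<notin> fst ` set w"

lemma generic_append: "generic (u @ v) \<Longrightarrow> generic u" "generic (u @ v) \<Longrightarrow> generic v"
  by (auto simp: generic_def)

lemma generic_Cons: "generic (l # w) \<Longrightarrow> generic w"
  by (auto simp: generic_def)

lemma generic_sh: "generic (l # w) \<Longrightarrow> generic (sh (fst l) w)"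
  by (force simp: generic_def sh_def distinct_map inj_on_def o_def image_iff)

section \<open>Flexion operations on words\<close>

definition wmu :: "'k::field wmould \<Rightarrow> 'k wmould \<Rightarrow> 'k wmould" where
  "wmu M N w = cuts (\<lambda>u v. M u * N v) w"

text \<open>
  A case distinction as a constant, so that the simplifier rewrites below it.
\<close>

definition uncons :: "('k \<times> 'k \<Rightarrow> 'k word \<Rightarrow> 'k) \<Rightarrow> 'k::field word \<Rightarrow> 'k" where
  "uncons f z = (case z of [] \<Rightarrow> 0 | k # c \<Rightarrow> f k c)"

lemma uncons_simps [simp]: "uncons f [] = 0" "uncons f (k # c) = f k c"
  by (simp_all add: uncons_def)

lemma uncons_add: "uncons (\<lambda>k c. f k c + g k c) z = uncons f z + uncons g z"
  by (cases z) simp_all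

lemma uncons_mult_left: "uncons (\<lambda>k c. r * f k c) z = r * uncons f z"
  by (cases z) simp_all

lemma uncons_zero [simp]: "uncons (\<lambda>k c. 0) z = 0"
  by (cases z) simp_all

lemma uncons_sh: "uncons f (sh t z) = uncons (\<lambda>k c. f (fst k - t, snd k) (sh t c)) z"
  by (cases z) simp_all

text \<open>
  The word is cut into a, b and the rest, whose first letter absorbs b. In \<open>wamit\<close> and \<open>wanit\<close> the
  factor b may be empty; such terms vanish as soon as \<open>N [] = 0\<close>, which holds wherever these are
  compared with amit and anit.
\<close>

definition wamit :: "'k::field wmould \<Rightarrow> 'k wmould \<Rightarrow> 'k wmould" where
  "wamit N M w = cuts (\<lambda>a z. cuts (\<lambda>b. uncons (\<lambda>l c.
      M (a @ (fst l, ysum b + snd l) # c) * N (sh (fst l) b))) z) w"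

definition wanit :: "'k::field wmould \<Rightarrow> 'k wmould \<Rightarrow> 'k wmould" where
  "wanit N M w = cuts (\<lambda>a. uncons (\<lambda>l.
      cuts (\<lambda>b c. M (a @ (fst l, snd l + ysum b) # c) * N (sh (fst l) b)))) w"


text \<open>
  Recursion over the first block: u is the part of the block after its first letter l, and the
  merged letter is put in front of the argument of M.
\<close>

function wganit :: "'k::field wmould \<Rightarrow> 'k wmould \<Rightarrow> 'k wmould" where
  "wganit C M [] = M []"
| "wganit C M (l # w) = (\<Sum>i\<le>length w. C (sh (fst l) (take i w)) *
      wganit C (\<lambda>z. M ((fst l, snd l + ysum (take i w)) # z)) (drop i w))"
  by pat_completeness auto
termination by (relation "measure (\<lambda>(C, M, w). length w)") simp_all

declare wganit.simps [simp del]

lemma wganit_Nil [simp]: "wganit C M [] = M []"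
  by (rule wganit.simps)

lemma wganit_Cons: "wganit C M (l # w) = cuts (\<lambda>u v. C (sh (fst l) u) *
      wganit C (\<lambda>z. M ((fst l, snd l + ysum u) # z)) v) w"
  by (simp add: cuts_def wganit.simps)

lemma word_induct [case_names Nil Cons]:
  assumes "P []" "\<And>l w. (\<And>u v. u @ v = w \<Longrightarrow> P v) \<Longrightarrow> P (l # w)"
  shows "P w"
proof (induction w rule: length_induct)
  case (1 w)
  show ?case
  proof (cases w)
    case (Cons l w')
    have "P v" if "u @ v = w'" for u v using 1 that Cons by auto
    then show ?thesis using assms(2) Cons by blast
  qed (use assms in simp)
qed

lemma wganit_zero [simp]: "wganit C (\<lambda>w. 0) w = 0"
  by (induction w rule: word_induct) (simp_all add: wganit_Cons cong: cuts_cong)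

lemma wganit_add: "wganit C (\<lambda>w. M w + N w) w = wganit C M w + wganit C N w"
proof (induction w arbitrary: M N rule: word_induct)
  case (Cons l w)
  show ?case unfolding wganit_Cons cuts_add [symmetric]
    by (rule cuts_cong) (simp only: Cons distrib_left)
qed simp

lemma wganit_mult_left: "wganit C (\<lambda>w. c * M w) w = c * wganit C M w"
proof (induction w arbitrary: M rule: word_induct)
  case (Cons l w)
  show ?case unfolding wganit_Cons cuts_mult_left [symmetric]
    by (rule cuts_cong) (simp only: Cons mult.left_commute)
qed simp

lemma wganit_mult_right: "wganit C (\<lambda>w. M w * c) w = wganit C M w * c"
  using wganit_mult_left [of C c M w] by (simp add: mult.commute)

lemma wganit_uminus: "wganit C (\<lambda>w. - M w) w = - wganit C M w"
  using wganit_mult_left [of C "- 1" M w] by simp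

lemma wganit_diff: "wganit C (\<lambda>w. M w - N w) w = wganit C M w - wganit C N w"
  using wganit_add [of C M "\<lambda>w. - N w" w] by (simp add: wganit_uminus)

text \<open>
  The operators ganit are compatible with deconcatenation because the blocks are chosen
  independently on both sides of a cut. The form with a function F of two words covers, besides
  products, kernels in which the second factor depends on the first one.
\<close>

lemma wganit_cuts:
  "wganit C (\<lambda>z. cuts F z) w = cuts (\<lambda>u v. wganit C (\<lambda>a. wganit C (F a) v) u) w"
proof (induction w arbitrary: F rule: word_induct)
  case (Cons l w)
  let ?l = "\<lambda>u. (fst l, snd l + ysum u)"
  have "wganit C (\<lambda>z. cuts F z) (l # w) =
      cuts (\<lambda>u v. C (sh (fst l) u) * wganit C (\<lambda>z. F [] (?l u # z)) v) w +
      cuts (\<lambda>u v. C (sh (fst l) u) * wganit C (\<lambda>z. cuts (\<lambda>a. F (?l u # a)) z) v) w"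
    by (simp add: wganit_Cons cuts_Cons wganit_add distrib_left cuts_add)
  also have "cuts (\<lambda>u v. C (sh (fst l) u) * wganit C (\<lambda>z. cuts (\<lambda>a. F (?l u # a)) z) v) w =
      cuts (\<lambda>u v. cuts (\<lambda>a b. C (sh (fst l) u) *
        wganit C (\<lambda>a. wganit C (F (?l u # a)) b) a) v) w"
    by (rule cuts_cong) (simp only: Cons cuts_mult_left)
  finally show ?case
    by (simp add: cuts_assoc [symmetric] cuts_Cons wganit_Cons)
qed simp

lemma wganit_mu: "wganit C (wmu M N) w = wmu (wganit C M) (wganit C N) w"
  by (simp add: wmu_def [abs_def] wganit_cuts wganit_mult_left wganit_mult_right)

lemma wganit_ysum: "wganit C (\<lambda>z. g (ysum z) * N z) w = g (ysum w) * wganit C N w"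
proof (induction w arbitrary: g N rule: word_induct)
  case (Cons l w)
  have "wganit C (\<lambda>z. g (snd l + ysum u + ysum z) * N ((fst l, snd l + ysum u) # z)) v =
      g (snd l + ysum u + ysum v) * wganit C (\<lambda>z. N ((fst l, snd l + ysum u) # z)) v"
    if "u @ v = w" for u v
    using Cons [OF that, of "\<lambda>s. g (snd l + ysum u + s)"] .
  then show ?case unfolding wganit_Cons cuts_mult_left [symmetric]
    by (intro cuts_cong) (auto simp: add.assoc mult.left_commute)
qed simp

lemma wganit_sh: "wganit C (\<lambda>z. N (sh t z)) w = wganit C N (sh t w)"
proof (induction w arbitrary: N rule: word_induct)
  case (Cons l w)
  have "wganit C (\<lambda>z. N ((fst l - t, s) # sh t z)) v =
      wganit C (\<lambda>z. N ((fst l - t, s) # z)) (sh t v)" if "u @ v = w" for u v s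
    using Cons [OF that, of "\<lambda>z. N ((fst l - t, s) # z)"] .
  then show ?case
    by (simp add: wganit_Cons cuts_sh cong: cuts_cong)
qed simp

lemma wganit_cong:
  assumes "\<And>z. distinct (map fst z) \<Longrightarrow> set (map fst z) \<subseteq> set (map fst w) \<Longrightarrow> M z = N z"
    and "distinct (map fst w)"
  shows "wganit C M w = wganit C N w"
  using assms
proof (induction w arbitrary: M N rule: word_induct)
  case (Cons l w)
  have "wganit C (\<lambda>z. M ((fst l, s) # z)) v = wganit C (\<lambda>z. N ((fst l, s) # z)) v"
    if "u @ v = w" for u v s
    by (rule Cons.IH [OF that], rule Cons.prems)
      (use that Cons.prems in \<open>auto simp del: set_map\<close>)
  then show ?case by (simp add: wganit_Cons cong: cuts_cong)
qed simp

lemma wganit_cong_generic: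
  assumes "\<And>z. generic z \<Longrightarrow> M z = N z" "generic w"
  shows "wganit C M w = wganit C N w"
  by (rule wganit_cong) (use assms in \<open>auto simp: generic_def simp flip: set_map\<close>)

lemma cuts_right_Nil: "cuts (\<lambda>u v. if v = [] then f u else 0) w = f w"
  by (induction w arbitrary: f) (simp_all add: cuts_Cons)

text \<open>
  The recursion of \<open>wganit\<close> peels off the first block; for bimoulds that single out the last letter
  one has to peel off the last block.
\<close>

lemma wganit_last:
  "wganit C M w = (if w = [] then M [] else 0) +
     cuts (\<lambda>b. uncons (\<lambda>l c.
       C (sh (fst l) c) * wganit C (\<lambda>b. M (b @ [(fst l, snd l + ysum c)])) b)) w"
proof (induction w arbitrary: M rule: word_induct)
  case (Cons l w)
  let ?l = "\<lambda>u. (fst l, snd l + ysum u)"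
  let ?f = "\<lambda>u b z. C (sh (fst l) u) * uncons (\<lambda>k c.
       C (sh (fst k) c) * wganit C (\<lambda>b. M (?l u # b @ [(fst k, snd k + ysum c)])) b) z"
  have "wganit C M (l # w) = cuts (\<lambda>u v. C (sh (fst l) u) * ((if v = [] then M [?l u] else 0)
      + cuts (\<lambda>b. uncons (\<lambda>k c.
       C (sh (fst k) c) * wganit C (\<lambda>b. M (?l u # b @ [(fst k, snd k + ysum c)])) b)) v)) w"
    unfolding wganit_Cons by (rule cuts_cong) (simp only: Cons)
  also have "\<dots> = cuts (\<lambda>u v. if v = [] then C (sh (fst l) u) * M [?l u] else 0) w
      + cuts (\<lambda>u v. cuts (?f u) v) w"
    by (simp add: distrib_left cuts_mult_left if_distrib [of "(*) _"] flip: cuts_add cong: if_cong)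
  also have "\<dots> = C (sh (fst l) w) * M [?l w] + cuts (\<lambda>b z. cuts (\<lambda>u b. ?f u b z) b) w"
    by (simp only: cuts_right_Nil cuts_assoc)
  also have "cuts (\<lambda>b z. cuts (\<lambda>u b. ?f u b z) b) w = cuts (\<lambda>b. uncons (\<lambda>k c.
       C (sh (fst k) c) * wganit C (\<lambda>b. M (b @ [(fst k, snd k + ysum c)])) (l # b))) w"
  proof (rule cuts_cong)
    fix b z
    show "cuts (\<lambda>u b. ?f u b z) b = uncons (\<lambda>k c. C (sh (fst k) c) *
        wganit C (\<lambda>b. M (b @ [(fst k, snd k + ysum c)])) (l # b)) z"
      by (cases z) (simp_all add: wganit_Cons mult.left_commute flip: cuts_mult_left)
  qed
  finally show ?case by (simp add: cuts_Cons)
qed simp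

text \<open>
  The shape that depth 1 takes under anit and ganit: the first letter survives, collects all y, and
  serves as the origin for the remaining x. In particular \<open>headed f unit\<close> is the bimould f of depth 1
  (\<open>unit\<close> is the neutral element for mu).
\<close>

definition headed :: "('k::field \<Rightarrow> 'k \<Rightarrow> 'k) \<Rightarrow> 'k wmould \<Rightarrow> 'k wmould" where
  "headed f N w = (case w of [] \<Rightarrow> 0 | l # w \<Rightarrow> f (fst l) (snd l + ysum w) * N (sh (fst l) w))"

definition unit :: "'k::field wmould" where
  "unit w = (if w = [] then 1 else 0)"

lemma headed_simps [simp]: "headed f N [] = 0"
  "headed f N (l # w) = f (fst l) (snd l + ysum w) * N (sh (fst l) w)"
  by (simp_all add: headed_def)

text \<open>
  The block of the first letter contributes a factor C, the other blocks make up ganit of N, and f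
  sees the same arguments in all terms.
\<close>

lemma wganit_headed:
  "wganit C (headed f N) (l # w) =
     f (fst l) (snd l + ysum w) * wmu C (wganit C N) (sh (fst l) w)"
proof -
  have "wganit C (\<lambda>z. f (fst l) (snd l + ysum u + ysum z) * N (sh (fst l) z)) v =
      f (fst l) (snd l + (ysum u + ysum v)) * wganit C N (sh (fst l) v)" for u v
    using wganit_ysum [of C "\<lambda>s. f (fst l) (snd l + ysum u + s)"]
    by (simp add: wganit_sh add.assoc)
  then have "wganit C (headed f N) (l # w) =
      cuts (\<lambda>u v. f (fst l) (snd l + (ysum u + ysum v)) *
        (C (sh (fst l) u) * wganit C N (sh (fst l) v))) w"
    by (simp add: wganit_Cons mult.left_commute)
  then show ?thesis
    using cuts_ysum [where g = "\<lambda>s. f (fst l) (snd l + s)"] by (simp add: wmu_def cuts_sh)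
qed

lemma wmu_unit_right [simp]: "wmu M unit w = M w"
proof -
  have "wmu M unit w = cuts (\<lambda>u v. if v = [] then M u else 0) w"
    unfolding wmu_def by (rule cuts_cong) (auto simp: unit_def)
  then show ?thesis by (simp add: cuts_right_Nil)
qed

lemma wmu_unit_left [simp]: "wmu unit M w = M w"
  by (cases w) (simp_all add: wmu_def unit_def cuts_Cons)

lemma wganit_unit [simp]: "wganit C unit w = unit w"
  by (cases w) (simp_all add: wganit_Cons unit_def)

lemma wganit_letter:
  "wganit C (headed f unit) w = headed f C w"
proof (cases w)
  case (Cons l w')
  have "wmu C (wganit C unit) (sh (fst l) w') = wmu C unit (sh (fst l) w')"
    by (simp add: wmu_def)
  then show ?thesis by (simp add: Cons wganit_headed)
qed simp

section \<open>The derivations amit and anit\<close>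

lemma wamit_Nil [simp]: "wamit N M [] = 0"
  by (simp add: wamit_def)

lemma wamit_Cons:
  "wamit N M (l # w) = cuts (\<lambda>b. uncons (\<lambda>k c.
      M ((fst k, ysum b + snd k) # c) * N (sh (fst k) b))) (l # w)
    + wamit N (\<lambda>v. M (l # v)) w"
  by (simp add: wamit_def cuts_Cons)

lemma wanit_Nil [simp]: "wanit N M [] = 0"
  by (simp add: wanit_def)

lemma wanit_Cons:
  "wanit N M (l # w) = cuts (\<lambda>b c. M ((fst l, snd l + ysum b) # c) * N (sh (fst l) b)) w
    + wanit N (\<lambda>v. M (l # v)) w"
  by (simp add: wanit_def cuts_Cons)

lemma wamit_add: "wamit N (\<lambda>w. M w + M' w) w = wamit N M w + wamit N M' w"
  by (simp add: wamit_def distrib_right uncons_add [abs_def] cuts_add [abs_def])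

lemma wamit_mult_left: "wamit N (\<lambda>w. r * M w) w = r * wamit N M w"
  by (simp add: wamit_def mult.assoc uncons_mult_left [abs_def] cuts_mult_left [abs_def])

lemma wanit_add: "wanit N (\<lambda>w. M w + M' w) w = wanit N M w + wanit N M' w"
  by (simp add: wanit_def distrib_right uncons_add [abs_def] cuts_add [abs_def])

lemma wanit_mult_left: "wanit N (\<lambda>w. r * M w) w = r * wanit N M w"
  by (simp add: wanit_def mult.assoc uncons_mult_left [abs_def] cuts_mult_left [abs_def])

lemma wamit_uminus: "wamit N (\<lambda>w. - M w) w = - wamit N M w"
  using wamit_mult_left [of N "- 1" M w] by simp

lemma wanit_uminus: "wanit N (\<lambda>w. - M w) w = - wanit N M w"
  using wanit_mult_left [of N "- 1" M w] by simp

lemma wamit_diff: "wamit N (\<lambda>w. M w - M' w) w = wamit N M w - wamit N M' w"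
  using wamit_add [of N M "\<lambda>w. - M' w" w] by (simp add: wamit_uminus)

lemma wanit_diff: "wanit N (\<lambda>w. M w - M' w) w = wanit N M w - wanit N M' w"
  using wanit_add [of N M "\<lambda>w. - M' w" w] by (simp add: wanit_uminus)

lemma wamit_unit [simp]: "wamit N unit w = 0"
  by (simp add: wamit_def unit_def uncons_zero [abs_def] cuts_zero [abs_def])

lemma wanit_unit [simp]: "wanit N unit w = 0"
  by (simp add: wanit_def unit_def uncons_zero [abs_def] cuts_zero [abs_def])

lemma wmu_Cons: "wmu M M' (l # w) = M [] * M' (l # w) + wmu (\<lambda>v. M (l # v)) M' w"
  by (simp add: wmu_def cuts_Cons)

lemma uncons_mult_right: "uncons (\<lambda>k c. f k c * r) z = uncons f z * r"
  by (cases z) simp_all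

lemma wmu_Cons_times:
  "wmu M M' (l # w) * r = M [] * (M' (l # w) * r) + cuts (\<lambda>u v. M (l # u) * r * M' v) w"
  by (simp only: wmu_Cons distrib_right)
    (simp add: wmu_def mult_ac flip: cuts_mult_left cuts_mult_right)

lemma cuts_assoc_uncons:
  "cuts (\<lambda>b. uncons (\<lambda>k. cuts (F b k))) w =
   cuts (\<lambda>u v. cuts (\<lambda>b. uncons (\<lambda>k c. F b k c v)) u) w"
proof -
  have "uncons (\<lambda>k. cuts (F b k)) z = cuts (\<lambda>y v. uncons (\<lambda>k c. F b k c v) y) z" for b z
    by (cases z) (simp_all add: cuts_Cons)
  then show ?thesis unfolding cuts_assoc by (intro cuts_cong)
qed

text \<open>
  A cut of a flexed word either lies before the letter that absorbs b, or after it; it never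
  separates this letter from b. The two cases are the two terms of the Leibniz rule.
\<close>

lemma wamit_mu:
  "wamit N (wmu M M') w = wmu (wamit N M) M' w + wmu M (wamit N M') w"
proof (induction w arbitrary: M)
  case (Cons l w)
  let ?k = "\<lambda>b k. (fst k, ysum b + snd k)"
  have "wmu M M' (?k b k # c) * N (sh (fst k) b) = M [] * (M' (?k b k # c) * N (sh (fst k) b)) +
      cuts (\<lambda>c v. M (?k b k # c) * N (sh (fst k) b) * M' v) c" for b k c
    by (rule wmu_Cons_times)
  then have "cuts (\<lambda>b. uncons (\<lambda>k c. wmu M M' (?k b k # c) * N (sh (fst k) b))) (l # w)
    = M [] * cuts (\<lambda>b. uncons (\<lambda>k c. M' (?k b k # c) * N (sh (fst k) b))) (l # w)
    + cuts (\<lambda>b. uncons (\<lambda>k. cuts (\<lambda>c v. M (?k b k # c) * N (sh (fst k) b) * M' v))) (l # w)"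
    by (simp add: uncons_add [abs_def] cuts_add [abs_def] uncons_mult_left [abs_def]
        cuts_mult_left [abs_def])
  then have *: "cuts (\<lambda>b. uncons (\<lambda>k c. wmu M M' (?k b k # c) * N (sh (fst k) b))) (l # w)
    = M [] * cuts (\<lambda>b. uncons (\<lambda>k c. M' (?k b k # c) * N (sh (fst k) b))) (l # w)
    + cuts (\<lambda>u v. cuts (\<lambda>b. uncons (\<lambda>k c. M (?k b k # c) * N (sh (fst k) b) * M' v)) u) (l # w)"
    by (simp only: cuts_assoc_uncons)
  have "wamit N (wmu M M') (l # w) = M [] * wamit N M' (l # w)
    + cuts (\<lambda>u v. cuts (\<lambda>b. uncons (\<lambda>k c. M (?k b k # c) * N (sh (fst k) b))) u * M' v) (l # w)
    + wmu (wamit N (\<lambda>v. M (l # v))) M' w + wmu (\<lambda>v. M (l # v)) (wamit N M') w"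
    by (simp add: wamit_Cons [of _ "wmu M M'"] *, simp add: wamit_Cons [of _ M'] wmu_Cons
        wamit_add wamit_mult_left Cons cuts_mult_right [abs_def] uncons_mult_right [abs_def]
        distrib_left)
  then show ?case
    by (simp add: cuts_Cons [of _ l w] wmu_Cons wmu_def [of "\<lambda>v. wamit N M (l # v)"] wamit_Cons
        distrib_right cuts_add) (simp add: wmu_def distrib_right cuts_add)
qed (simp add: wmu_def)

text \<open>
  The Leibniz rule holds for the same reason as for \<open>wamit\<close>.
\<close>

lemma wanit_mu:
  "wanit N (wmu M M') w = wmu (wanit N M) M' w + wmu M (wanit N M') w"
proof (induction w arbitrary: M)
  case (Cons l w)
  let ?l = "\<lambda>b. (fst l, snd l + ysum b)"
  have "wmu M M' (?l b # c) * N (sh (fst l) b) = M [] * (M' (?l b # c) * N (sh (fst l) b)) +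
      cuts (\<lambda>c v. M (?l b # c) * N (sh (fst l) b) * M' v) c" for b c
    by (rule wmu_Cons_times)
  then have "cuts (\<lambda>b c. wmu M M' (?l b # c) * N (sh (fst l) b)) w =
      M [] * cuts (\<lambda>b c. M' (?l b # c) * N (sh (fst l) b)) w +
      cuts (\<lambda>u v. cuts (\<lambda>b c. M (?l b # c) * N (sh (fst l) b)) u * M' v) w"
    by (simp add: cuts_add cuts_mult_left cuts_assoc flip: cuts_mult_right)
  then show ?case
    by (simp add: wanit_Cons [of _ "wmu M M'"])
      (simp add: wmu_Cons wanit_Cons wanit_add wanit_mult_left Cons
        wmu_def [of "\<lambda>v. wanit N M (l # v)"] distrib_left distrib_right cuts_add,
       simp add: wmu_def distrib_right cuts_add)
qed (simp add: wmu_def)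

lemma wamit_sh: "wamit N (\<lambda>v. M (sh t v)) w = wamit N M (sh t w)"
  by (simp add: wamit_def cuts_sh uncons_sh)

lemma wanit_sh: "wanit N (\<lambda>v. M (sh t v)) w = wanit N M (sh t w)"
  by (simp add: wanit_def cuts_sh uncons_sh)

lemma uncons_cong: "(\<And>k c. z = k # c \<Longrightarrow> f k c = g k c) \<Longrightarrow> uncons f z = uncons g z"
  by (cases z) simp_all

lemma wamit_ysum: "wamit N (\<lambda>v. g (ysum v) * M v) w = g (ysum w) * wamit N M w"
  unfolding wamit_def cuts_mult_left [symmetric] uncons_mult_left [symmetric]
  by (intro cuts_cong uncons_cong) (auto simp: add_ac mult_ac)

lemma wanit_ysum: "wanit N (\<lambda>v. g (ysum v) * M v) w = g (ysum w) * wanit N M w"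
  unfolding wanit_def cuts_mult_left [symmetric] uncons_mult_left [symmetric]
  by (intro cuts_cong uncons_cong) (auto simp: add_ac mult_ac)

lemma wamit_headed_tail:
  "wamit N (\<lambda>v. f (s + ysum v) * M (sh t v)) w = f (s + ysum w) * wamit N M (sh t w)"
  by (simp add: wamit_ysum [where g = "\<lambda>y. f (s + y)"] wamit_sh)

lemma wanit_headed_tail:
  "wanit N (\<lambda>v. f (s + ysum v) * M (sh t v)) w = f (s + ysum w) * wanit N M (sh t w)"
  by (simp add: wanit_ysum [where g = "\<lambda>y. f (s + y)"] wanit_sh)

text \<open>
  The shape that depth 1 takes under amit, where the surviving letter is k and N is evaluated on
  what precedes it; M accounts for the letters to its right, which a later ganit may merge into k.
\<close>

definition tailed :: "('k::field \<Rightarrow> 'k \<Rightarrow> 'k) \<Rightarrow> 'k wmould \<Rightarrow> 'k wmould \<Rightarrow> 'k wmould" where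
  "tailed f N M w = cuts (\<lambda>b. uncons (\<lambda>k c.
     f (fst k) (ysum b + snd k + ysum c) * (N (sh (fst k) b) * M (sh (fst k) c)))) w"

lemma wamit_headed: "wamit N (headed f M) (l # w) =
    tailed f N M (l # w) + f (fst l) (snd l + ysum w) * wamit N M (sh (fst l) w)"
  by (simp add: wamit_Cons wamit_headed_tail tailed_def mult.assoc)
    (simp add: mult.commute)

lemma wanit_headed: "wanit N (headed f M) (l # w) =
    f (fst l) (snd l + ysum w) * (wmu N M (sh (fst l) w) + wanit N M (sh (fst l) w))"
proof -
  have "cuts (\<lambda>b c. headed f M ((fst l, snd l + ysum b) # c) * N (sh (fst l) b)) w =
      f (fst l) (snd l + ysum w) * wmu N M (sh (fst l) w)"
    unfolding wmu_def cuts_sh cuts_mult_left [symmetric] by (rule cuts_cong) (auto simp: add_ac)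
  then show ?thesis
    by (simp add: wanit_Cons wanit_headed_tail distrib_left)
qed

lemma wamit_letter: "wamit N (headed f unit) w = tailed f N unit w"
proof (cases w)
  case (Cons l w')
  then show ?thesis by (simp add: wamit_headed)
qed (simp add: tailed_def)

lemma wanit_letter: "wanit N (headed f unit) w = headed f N w"
proof (cases w)
  case (Cons l w')
  then show ?thesis by (simp add: wanit_headed)
qed simp

lemma tailed_unit: "tailed f N unit (w @ [k]) = f (fst k) (ysum w + snd k) * N (sh (fst k) w)"
proof -
  have "cuts (\<lambda>b c. uncons (\<lambda>k c. f (fst k) (ysum b + snd k + ysum c) *
         (N (sh (fst k) b) * unit (sh (fst k) c))) (c @ [k])) w =
      cuts (\<lambda>b c. if c = [] then f (fst k) (ysum b + snd k) * N (sh (fst k) b) else 0) w"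
  proof (rule cuts_cong)
    fix b c
    show "uncons (\<lambda>k c. f (fst k) (ysum b + snd k + ysum c) *
         (N (sh (fst k) b) * unit (sh (fst k) c))) (c @ [k]) =
      (if c = [] then f (fst k) (ysum b + snd k) * N (sh (fst k) b) else 0)"
      by (cases c) (simp_all add: unit_def)
  qed
  then show ?thesis by (simp add: tailed_def cuts_snoc cuts_right_Nil)
qed

text \<open>
  Peel off the last block: its first letter is the one that f sees, and it contributes the factor C.
\<close>

lemma wganit_tailed: "wganit C (tailed f N unit) w = tailed f (wganit C N) C w"
proof -
  have "wganit C (\<lambda>b. f (fst l) (ysum b + (snd l + s)) * N (sh (fst l) b)) b =
      f (fst l) (ysum b + (snd l + s)) * wganit C N (sh (fst l) b)" for l s b
    by (simp add: wganit_ysum [where g = "\<lambda>y. f (fst l) (y + (snd l + s))"] wganit_sh)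
  then show ?thesis
    by (subst wganit_last) (simp add: tailed_unit, simp add: tailed_def mult_ac add.assoc)
qed

lemma wmu_add_left: "wmu (\<lambda>w. M w + M' w) N w = wmu M N w + wmu M' N w"
  by (simp add: wmu_def distrib_right cuts_add)

lemma wmu_add_right: "wmu M (\<lambda>w. N w + N' w) w = wmu M N w + wmu M N' w"
  by (simp add: wmu_def distrib_left cuts_add)

lemma wmu_diff_left: "wmu (\<lambda>w. M w - M' w) N w = wmu M N w - wmu M' N w"
  by (simp add: wmu_def left_diff_distrib cuts_diff)

lemma wmu_diff_right: "wmu M (\<lambda>w. N w - N' w) w = wmu M N w - wmu M N' w"
  by (simp add: wmu_def right_diff_distrib cuts_diff)

lemma wmu_cong_generic:
  assumes "\<And>u. generic u \<Longrightarrow> length u \<le> length w \<Longrightarrow> M u = M' u"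
    "\<And>u. generic u \<Longrightarrow> length u \<le> length w \<Longrightarrow> N u = N' u" "generic w"
  shows "wmu M N w = wmu M' N' w"
  unfolding wmu_def
proof (rule cuts_cong)
  fix u v assume "u @ v = w"
  then show "M u * N v = M' u * N' v"
    using assms generic_append [of u v] by auto
qed

definition wpic :: "'k::field wmould" where
  "wpic w = 1 / prod_list (map fst w)"

fun gaps :: "'k::field word \<Rightarrow> 'k" where
  "gaps (k # l # w) = (fst k - fst l) * gaps (l # w)"
| "gaps _ = 1"

definition wpoc :: "'k::field wmould" where
  "wpoc w = (if w = [] then 1 else - 1 / (fst (hd w) * gaps w))"

abbreviation recip :: "'k::field \<Rightarrow> 'k \<Rightarrow> 'k" where
  "recip x y \<equiv> 1 / x"

abbreviation zmould :: "'k::field wmould" where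
  "zmould \<equiv> headed recip unit"

lemma gaps_sh: "gaps (sh t w) = gaps w"
  by (induction w rule: gaps.induct) simp_all

lemma wpoc_Nil [simp]: "wpoc [] = 1"
  by (simp add: wpoc_def)

text \<open>
  The factor after the first letter is poc again, since the gaps do not change under a shift.
\<close>

lemma wpoc_Cons: "wpoc (l # w) = - (1 / fst l * wpoc (sh (fst l) w))"
proof (cases w)
  case (Cons k v)
  have "gaps ((fst k - fst l, snd k) # sh (fst l) v) = gaps (k # v)"
    using gaps_sh [of "fst l" "k # v"] by simp
  moreover have "(fst l - fst k) * a = - ((fst k - fst l) * a)" for a
    by (simp add: algebra_simps)
  ultimately show ?thesis using Cons by (simp add: wpoc_def)
qed (simp add: wpoc_def)

text \<open>
  The key to all inductions: poc is the image under ganit poc of a bimould of depth at most 1, so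
  that facts about ganit poc in depth 1 give facts about poc itself.
\<close>

lemma wpoc_eq: "wpoc w = wganit wpoc (\<lambda>w. unit w - zmould w) w"
  by (cases w) (simp_all add: wganit_diff wganit_letter wpoc_Cons, simp_all add: unit_def)

lemma wmu_letter_left: "wmu (headed f unit) M (l # w) = f (fst l) (snd l) * M w"
  by (cases w) (simp_all add: wmu_Cons, simp_all add: wmu_def unit_def cuts_Cons)

lemma wmu_letter_right: "wmu M (headed f unit) (w @ [l]) = M w * f (fst l) (snd l)"
proof -
  have "cuts (\<lambda>u v. M u * headed f unit (v @ [l])) w =
      cuts (\<lambda>u v. if v = [] then M u * f (fst l) (snd l) else 0) w"
  proof (rule cuts_cong)
    fix u v
    show "M u * headed f unit (v @ [l]) = (if v = [] then M u * f (fst l) (snd l) else 0)"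
      by (cases v) (simp_all add: unit_def)
  qed
  then show ?thesis by (simp add: wmu_def cuts_snoc cuts_right_Nil)
qed

lemma generic_sh_prefix: "generic (l # z @ b) \<Longrightarrow> generic (sh (fst l) z)"
  using generic_sh [of l "z @ b"] generic_append(1) by simp

section \<open>Inverting ganit poc by ganit pic\<close>

text \<open>
  The composition law: the composite behaves on first blocks like ganit of the bimould
  mu(C, ganit C D), so ganit C inverts ganit D once this bimould is the unit.
\<close>

lemma wganit_wganit_Cons:
  "wganit C (wganit D M) (l # w) = cuts (\<lambda>z b. wmu C (wganit C D) (sh (fst l) z) *
     wganit C (wganit D (\<lambda>v. M ((fst l, snd l + ysum z) # v))) b) w"
proof -
  let ?K = "\<lambda>s. wganit D (\<lambda>v. M ((fst l, snd l + s) # v))"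
  have 1: "wganit D M ((fst l, snd l + s) # z) =
      cuts (\<lambda>a b. D (sh (fst l) a) * ?K (s + ysum a) b) z" for s z
    by (simp add: wganit_Cons add.assoc)
  have 2: "wganit C (\<lambda>a. wganit C (\<lambda>b. D (sh (fst l) a) * ?K (s + ysum a) b) b) a =
      wganit C D (sh (fst l) a) * wganit C (?K (s + ysum a)) b" for s a b
  proof -
    have "wganit C (\<lambda>a. wganit C (\<lambda>b. D (sh (fst l) a) * ?K (s + ysum a) b) b) a =
        wganit C (\<lambda>a. wganit C (?K (s + ysum a)) b * D (sh (fst l) a)) a"
      by (simp add: wganit_mult_left mult.commute)
    also have "\<dots> = wganit C (?K (s + ysum a)) b * wganit C D (sh (fst l) a)"
      by (subst wganit_ysum [where g = "\<lambda>y. wganit C (?K (s + y)) b"]) (simp add: wganit_sh)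
    finally show ?thesis by (simp add: mult.commute)
  qed
  have "wganit C (wganit D M) (l # w) = cuts (\<lambda>u v. cuts (\<lambda>a b. C (sh (fst l) u) *
      (wganit C D (sh (fst l) a) * wganit C (?K (ysum u + ysum a)) b)) v) w"
    by (subst wganit_Cons) (simp add: 1 wganit_cuts 2 cuts_mult_left [abs_def])
  also have "\<dots> = cuts (\<lambda>z b. cuts (\<lambda>u a. C (sh (fst l) u) *
      (wganit C D (sh (fst l) a) * wganit C (?K (ysum u + ysum a)) b)) z) w"
    by (simp add: cuts_assoc)
  also have "\<dots> = cuts (\<lambda>z b. wmu C (wganit C D) (sh (fst l) z) * wganit C (?K (ysum z)) b) w"
    unfolding wmu_def cuts_sh cuts_mult_right [symmetric]
    by (intro cuts_cong) (auto simp: mult.assoc)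
  finally show ?thesis .
qed

lemma cuts_unit_left: "cuts (\<lambda>z b. unit (sh t z) * F z b) w = F [] w"
  by (cases w) (simp_all add: cuts_Cons unit_def)

text \<open>
  In smaller depth the statement says that ganit pic inverts ganit poc, applied after the first
  letter. This determines ganit pic of \<open>poc = ganit poc (1 - Z)\<close> as 1 - Z in the present depth, and
  1 - Z is the mu-inverse of pic, a geometric series in Z.
\<close>

lemma wmu_wpic_wpoc:
  "generic w \<Longrightarrow> wmu wpic (wganit wpic wpoc) w = unit w"
proof (induction w rule: length_induct)
  case (1 w)
  \<comment> \<open>the length of v may be that of w: after the first letter of v only shorter words occur\<close>
  have poc: "wganit wpic wpoc v = unit v - zmould v" if "generic v" "length v \<le> length w" for v :: "'a word"
  proof (cases v)
    case (Cons l v')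
    have "wmu wpic (wganit wpic wpoc) (sh (fst l) z) = unit (sh (fst l) z)" if "z @ b = v'" for z b
    proof -
      have "length (sh (fst l) z) < length w" "generic (sh (fst l) z)"
        using \<open>generic v\<close> \<open>length v \<le> length w\<close> that Cons generic_sh_prefix [of l z b] by auto
      then show ?thesis using 1 by blast
    qed
    then have "wganit wpic (wganit wpoc zmould) v = wganit wpic (wganit wpoc (\<lambda>z. zmould (l # z))) v'"
      unfolding Cons wganit_wganit_Cons by (simp add: cuts_unit_left cong: cuts_cong)
    also have "(\<lambda>z. zmould (l # z)) = (\<lambda>z. 1 / fst l * unit z)"
      by (simp add: fun_eq_iff unit_def)
    also have "wganit wpic (wganit wpoc \<dots>) v' = 1 / fst l * unit v'"
      by (simp only: wganit_mult_left [abs_def] wganit_unit [abs_def])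
    also have "\<dots> = zmould v"
      by (simp add: Cons unit_def)
    finally have "wganit wpic (\<lambda>w. unit w - wganit wpoc zmould w) v = unit v - zmould v"
      by (simp add: wganit_diff)
    moreover have "wganit wpic wpoc v = wganit wpic (\<lambda>w. unit w - wganit wpoc zmould w) v"
      by (rule fun_cong [where f = "wganit wpic wpoc"], rule arg_cong [where f = "wganit wpic"],
          rule ext, subst wpoc_eq) (simp add: wganit_diff)
    ultimately show ?thesis by (simp only:)
  qed (simp add: unit_def)
  have "wmu wpic (wganit wpic wpoc) w = wmu wpic (\<lambda>v. unit v - zmould v) w"
    by (rule wmu_cong_generic) (use poc 1 in auto)
  also have "\<dots> = unit w"
  proof (cases w rule: rev_cases)
    case (snoc u l)
    then show ?thesis
      by (simp add: wmu_diff_right wmu_letter_right) (simp add: wpic_def unit_def)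
  qed (simp add: wmu_def wpic_def unit_def)
  finally show ?case .
qed

theorem wganit_wpic_wpoc:
  "generic w \<Longrightarrow> wganit wpic (wganit wpoc M) w = M w"
proof (induction w arbitrary: M)
  case (Cons l w)
  have "wmu wpic (wganit wpic wpoc) (sh (fst l) z) = unit (sh (fst l) z)" if "z @ b = w" for z b
    using Cons.prems that by (intro wmu_wpic_wpoc generic_sh_prefix [of l z b]) simp
  then show ?case
    unfolding wganit_wganit_Cons
    by (simp add: cuts_unit_left Cons generic_Cons [OF Cons.prems] cong: cuts_cong)
qed simp

section \<open>Conjugating derivations by ganit poc\<close>

text \<open>
  Functions of this kind are determined by their depth-1 factors, so mu-derivations agree on them if
  they agree on \<open>headed f unit\<close>. Polynomial bimoulds are of this kind (\<open>mu_generated_wpoly\<close>).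
\<close>

inductive mu_generated :: "'k::field wmould \<Rightarrow> bool" where
  letter: "mu_generated (headed f unit)"
| add: "mu_generated M \<Longrightarrow> mu_generated N \<Longrightarrow> mu_generated (\<lambda>w. M w + N w)"
| mu: "mu_generated M \<Longrightarrow> mu_generated N \<Longrightarrow> mu_generated (wmu M N)"

lemma derivation_along_wganit:
  assumes "mu_generated M"
    and D_add: "\<And>M N w. D (\<lambda>w. M w + N w) w = D M w + D N w"
    and D'_add: "\<And>M N w. D' (\<lambda>w. M w + N w) w = D' M w + D' N w"
    and D_mu: "\<And>M N w. D (wmu M N) w = wmu (D M) N w + wmu M (D N) w"
    and D'_mu: "\<And>M N w. D' (wmu M N) w = wmu (D' M) N w + wmu M (D' N) w"
    and letter: "\<And>f w. generic w \<Longrightarrow>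
      D (wganit C (headed f unit)) w = wganit C (D' (headed f unit)) w"
    and "generic w"
  shows "D (wganit C M) w = wganit C (D' M) w"
  using \<open>mu_generated M\<close> \<open>generic w\<close>
proof (induction arbitrary: w)
  case (letter f)
  then show ?case by (rule assms)
next
  case (add M N)
  then show ?case
    by (simp add: wganit_add [abs_def] D_add D'_add [abs_def])
next
  case (mu M N)
  have "D (wganit C (wmu M N)) w = D (wmu (wganit C M) (wganit C N)) w"
    by (simp add: wganit_mu [abs_def])
  also have "\<dots> = wmu (D (wganit C M)) (wganit C N) w + wmu (wganit C M) (D (wganit C N)) w"
    by (rule D_mu)
  also have "\<dots> = wmu (wganit C (D' M)) (wganit C N) w + wmu (wganit C M) (wganit C (D' N)) w"
    by (intro arg_cong2 [where f = "(+)"] wmu_cong_generic refl mu)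
  also have "\<dots> = wganit C (D' (wmu M N)) w"
    by (simp add: D'_mu [abs_def] wganit_add wganit_mu)
  finally show ?case .
qed

subsection \<open>The operator Q\<close>

definition xysum :: "'k::field word \<Rightarrow> 'k" where
  "xysum w = sum_list (map (\<lambda>l. fst l * snd l) w)"

definition wQ :: "'k::field wmould \<Rightarrow> 'k wmould" where
  "wQ M w = xysum w * M w"

abbreviation ymould :: "'k::field wmould" where
  "ymould \<equiv> headed (\<lambda>x y. y) unit"

lemma xysum_simps [simp]: "xysum [] = 0" "xysum (l # w) = fst l * snd l + xysum w"
  "xysum (u @ v) = xysum u + xysum v"
  by (simp_all add: xysum_def)

lemma xysum_sh: "xysum (sh t w) = xysum w - t * ysum w"
  by (induction w) (simp_all add: algebra_simps)

lemma wQ_add: "wQ (\<lambda>w. M w + N w) w = wQ M w + wQ N w"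
  by (simp add: wQ_def distrib_left)

lemma wQ_mu: "wQ (wmu M N) w = wmu (wQ M) N w + wmu M (wQ N) w"
  unfolding wQ_def wmu_def cuts_add [symmetric] cuts_mult_left [symmetric]
  by (rule cuts_cong) (auto simp: algebra_simps)

lemma wQ_headed: "wQ (headed f M) (l # w) =
    f (fst l) (snd l + ysum w) * (fst l * (snd l + ysum w) * M (sh (fst l) w) + wQ M (sh (fst l) w))"
  by (simp add: wQ_def xysum_sh algebra_simps)

text \<open>
  Write \<open>poc = 1 - G Z\<close> on the left and \<open>mu(poc, G Y) = G (Y - Z Y)\<close> on the right, with \<open>G\<close> for ganit poc.
  Separating the first letter, both sides reduce to the same statement in smaller depth, because
  \<open>Q Z = Y\<close> for the depth-1 bimoulds \<open>Z = 1 / X_1\<close> and \<open>Y = Y_1\<close>.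
\<close>

lemma wQ_wpoc: "generic w \<Longrightarrow> wQ wpoc w = - wmu wpoc (wganit wpoc ymould) w"
proof (induction w rule: length_induct)
  case (1 w)
  show ?case
  proof (cases w)
    case Nil
    then show ?thesis by (simp add: wQ_def wmu_def)
  next
    case (Cons l w')
    then have "fst l \<noteq> 0" using 1 by (auto simp: generic_def)
    have IH: "wQ wpoc (sh (fst l) w') = - wmu wpoc (wganit wpoc ymould) (sh (fst l) w')"
      using 1 Cons generic_sh [of l w'] by (simp del: split_paired_All)
    have "headed (\<lambda>x y. y) wpoc (sh t v) = headed (\<lambda>x y. y) wpoc v" for t :: 'a and v
      by (cases v) simp_all
    then have *: "wmu (headed recip wpoc) (headed (\<lambda>x y. y) wpoc) w =
        1 / fst l * wmu wpoc (headed (\<lambda>x y. y) wpoc) (sh (fst l) w')"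
      unfolding Cons wmu_def cuts_sh cuts_mult_left [symmetric]
      by (simp add: cuts_Cons)
    have "wmu wpoc (wganit wpoc ymould) w =
        wganit wpoc (wmu (\<lambda>w. unit w - zmould w) ymould) w"
      by (simp add: wganit_mu wpoc_eq [abs_def, symmetric])
    also have "\<dots> = wganit wpoc ymould w - wmu (wganit wpoc zmould) (wganit wpoc ymould) w"
      by (simp add: wmu_diff_left [abs_def] wganit_diff wganit_mu)
    finally have **: "wmu wpoc (wganit wpoc ymould) w = (snd l + ysum w') * wpoc (sh (fst l) w')
        - 1 / fst l * wmu wpoc (wganit wpoc ymould) (sh (fst l) w')"
      using * by (simp add: wganit_letter [abs_def]) (simp add: Cons)
    have "wQ wpoc w = - wQ (headed recip wpoc) w"
      by (simp add: wQ_def Cons wpoc_Cons)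
    also have "\<dots> = - ((snd l + ysum w') * wpoc (sh (fst l) w')
        - 1 / fst l * wmu wpoc (wganit wpoc ymould) (sh (fst l) w'))"
      using \<open>fst l \<noteq> 0\<close> unfolding Cons wQ_headed IH by (simp add: field_simps)
    finally show ?thesis using ** by simp
  qed
qed

text \<open>
  In depth 1 the discrepancy between the two sides is f times \<open>wQ_wpoc\<close>.
\<close>

theorem wQ_wganit_wpoc:
  assumes "mu_generated M" "generic w"
  shows "wQ (wganit wpoc M) w = wganit wpoc (\<lambda>z. wQ M z - wanit ymould M z) w"
proof (rule derivation_along_wganit [OF assms(1) _ _ _ _ _ assms(2), of wQ "\<lambda>M z. wQ M z - wanit ymould M z"])
  fix f :: "'a \<Rightarrow> 'a \<Rightarrow> 'a" and w :: "'a word"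
  assume "generic w"
  have *: "wQ (headed f unit) z = headed (\<lambda>x y. x * y * f x y) unit z" for z
    by (cases z) (auto simp: wQ_def unit_def)
  show "wQ (wganit wpoc (headed f unit)) w =
      wganit wpoc (\<lambda>z. wQ (headed f unit) z - wanit ymould (headed f unit) z) w"
  proof (cases w)
    case (Cons l w')
    then show ?thesis
      using \<open>generic w\<close> wQ_wpoc [OF generic_sh, of l w']
      by (simp add: * wganit_diff wganit_letter [abs_def] wanit_letter wganit_headed wQ_headed)
        (simp add: algebra_simps)
  qed (simp add: wQ_def)
qed (simp_all add: wQ_add wanit_add wQ_mu wanit_mu wmu_diff_left wmu_diff_right)

subsection \<open>The operator urit\<close>

text \<open>
  This is what the conjugation formula for arit demands in depth 1, after cancelling f. Expanding
  \<open>poc = G (1 - Z)\<close> on both sides turns it into the equation assumed for C plus the same statement,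
  shifted and in smaller depth, with the factor 1 / x of the first letter.
\<close>

lemma wmu_wpoc_wganit:
  assumes Nil: "B [] = 0" "C [] = 0"
    and rec: "\<And>w. generic w \<Longrightarrow> C w = wmu zmould C w - headed recip C w - tailed recip B unit w
      + headed recip B w - wmu zmould B w + wmu B zmould w"
    and "generic w"
  defines "b \<equiv> wganit wpoc B"
  shows "wmu wpoc (wganit wpoc C) w =
    wamit b wpoc w - wanit b wpoc w + wmu wpoc b w - wmu b wpoc w"
  using \<open>generic w\<close>
proof (induction w rule: length_induct)
  case (1 w)
  let ?z = "headed recip wpoc"
  have z: "wganit wpoc zmould = ?z"
    by (simp add: wganit_letter [abs_def])
  have poc: "wpoc = (\<lambda>w. unit w - ?z w)"
    by (rule ext, subst wpoc_eq) (simp add: wganit_diff z)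
  show ?case
  proof (cases w)
    case Nil
    then show ?thesis using assms by (simp add: wmu_def)
  next
    case (Cons l w')
    have IH: "wmu wpoc (wganit wpoc C) (sh (fst l) w') = wamit b wpoc (sh (fst l) w')
        - wanit b wpoc (sh (fst l) w') + wmu wpoc b (sh (fst l) w') - wmu b wpoc (sh (fst l) w')"
      using 1 Cons generic_sh [of l w'] by (simp del: split_paired_All)
    have "wmu wpoc (wganit wpoc C) w = wganit wpoc (wmu (\<lambda>w. unit w - zmould w) C) w"
      by (simp add: wganit_mu wpoc_eq [abs_def, symmetric])
    also have "\<dots> = wganit wpoc (\<lambda>w. - headed recip C w - tailed recip B unit w
        + headed recip B w - wmu zmould B w + wmu B zmould w) w"
      by (rule wganit_cong_generic) (use 1 rec in \<open>auto simp: wmu_diff_left\<close>)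
    also have "\<dots> = - (1 / fst l * wmu wpoc (wganit wpoc C) (sh (fst l) w')) - tailed recip b wpoc w
        + 1 / fst l * wmu wpoc b (sh (fst l) w') - wmu ?z b w + wmu b ?z w"
      unfolding b_def
      by (simp add: wganit_add wganit_diff wganit_uminus wganit_mu wganit_tailed z)
        (simp add: Cons wganit_headed)
    also have "\<dots> = (- wamit b ?z w) - (- wanit b ?z w) + wmu wpoc b w - wmu b wpoc w"
    proof -
      have "wmu wpoc b w - wmu b wpoc w = - wmu ?z b w + wmu b ?z w"
        by (subst (1 2) poc) (simp add: wmu_diff_left wmu_diff_right)
      then show ?thesis
        unfolding IH Cons wamit_headed wanit_headed by (simp add: algebra_simps)
    qed
    also have "- wamit b ?z w = wamit b wpoc w"
      by (subst (2) poc) (simp add: wamit_diff)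
    also have "- wanit b ?z w = wanit b wpoc w"
      by (subst (2) poc) (simp add: wanit_diff)
    finally show ?thesis .
  qed
qed

text \<open>
  On the left, amit produces terms in which f sees a later letter; ganit poc of amit(B) produces
  the same ones (\<open>wganit_tailed\<close>). The terms in which f sees the first letter are \<open>wmu_wpoc_wganit\<close>.
\<close>

theorem wurit_wganit_wpoc:
  assumes Nil: "B [] = 0" "C [] = 0"
    and rec: "\<And>w. generic w \<Longrightarrow> C w = wmu zmould C w - headed recip C w - tailed recip B unit w
      + headed recip B w - wmu zmould B w + wmu B zmould w"
    and "mu_generated M" "generic w"
  defines "b \<equiv> wganit wpoc B"
  shows "wamit b (wganit wpoc M) w - wanit b (wganit wpoc M) w =
    wganit wpoc (\<lambda>z. wamit B M z - wanit B M z + wanit C M z) w"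
proof (rule derivation_along_wganit [OF assms(4) _ _ _ _ _ assms(5),
      of "\<lambda>M w. wamit b M w - wanit b M w" "\<lambda>M z. wamit B M z - wanit B M z + wanit C M z"])
  fix f :: "'a \<Rightarrow> 'a \<Rightarrow> 'a" and w :: "'a word"
  assume "generic w"
  show "wamit b (wganit wpoc (headed f unit)) w - wanit b (wganit wpoc (headed f unit)) w =
    wganit wpoc (\<lambda>z. wamit B (headed f unit) z - wanit B (headed f unit) z
      + wanit C (headed f unit) z) w"
  proof (cases w)
    case (Cons l w')
    have "wmu wpoc (wganit wpoc C) (sh (fst l) w') = wamit b wpoc (sh (fst l) w')
        - wanit b wpoc (sh (fst l) w') + wmu wpoc b (sh (fst l) w') - wmu b wpoc (sh (fst l) w')"
      unfolding b_def
      by (rule wmu_wpoc_wganit [OF Nil rec generic_sh]) (use \<open>generic w\<close> Cons in simp_all)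
    then show ?thesis
      unfolding Cons
      by (simp add: wganit_add wganit_diff wamit_letter wanit_letter wganit_tailed wganit_headed
          wganit_letter [abs_def] wamit_headed wanit_headed flip: b_def)
        (simp add: algebra_simps)
  qed simp
qed (simp_all add: wamit_add wanit_add wamit_mu wanit_mu wmu_diff_left wmu_diff_right
    wmu_add_left wmu_add_right)

section \<open>Divided differences\<close>

text \<open>
  With r + 1 nodes this is the classical divided difference times (-1)^r; as a function of the set
  of nodes it is visibly symmetric.
\<close>

definition divdiff :: "('k::field \<Rightarrow> 'k) \<Rightarrow> 'k set \<Rightarrow> 'k" where
  "divdiff F S = (\<Sum>z\<in>S. F z / (\<Prod>k\<in>S - {z}. k - z))"

text \<open>
  Termwise: 1 / ((p - z) (q - z)) times q - p is the difference of 1 / (p - z) and 1 / (q - z).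
\<close>

lemma divdiff_rec:
  assumes "finite S" "p \<notin> S" "q \<notin> S" "p \<noteq> q"
  shows "divdiff F (insert p (insert q S)) =
    (divdiff F (insert p S) - divdiff F (insert q S)) / (q - p)"
proof -
  let ?P = "\<lambda>z. \<Prod>k\<in>S - {z}. k - z"
  have ne: "?P z \<noteq> 0" "p - z \<noteq> 0" "q - z \<noteq> 0" if "z \<in> S" for z
    using assms that by auto
  have Sp: "(\<Prod>k\<in>insert p S - {z}. k - z) = (p - z) * ?P z"
    and Sq: "(\<Prod>k\<in>insert q S - {z}. k - z) = (q - z) * ?P z"
    and Spq: "(\<Prod>k\<in>insert p (insert q S) - {z}. k - z) = (p - z) * ((q - z) * ?P z)" if "z \<in> S" for z
    using assms that by (auto simp: insert_Diff_if)
  have "(\<Sum>z\<in>S. F z / ((p - z) * ((q - z) * ?P z))) * (q - p) =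
      (\<Sum>z\<in>S. F z / ((p - z) * ?P z) - F z / ((q - z) * ?P z))"
    unfolding sum_distrib_right
  proof (rule sum.cong)
    fix z assume "z \<in> S"
    have "F z / ((p - z) * ((q - z) * ?P z)) * (q - p) =
        F z / ?P z * ((q - z) - (p - z)) / ((p - z) * (q - z))"
      using ne [OF \<open>z \<in> S\<close>] by simp
    also have "\<dots> = F z / ((p - z) * ?P z) - F z / ((q - z) * ?P z)"
      using ne [OF \<open>z \<in> S\<close>] by (simp add: divide_simps) (simp add: algebra_simps)
    finally show "F z / ((p - z) * ((q - z) * ?P z)) * (q - p) =
        F z / ((p - z) * ?P z) - F z / ((q - z) * ?P z)" .
  qed simp
  then have sum: "(\<Sum>z\<in>S. F z / (\<Prod>k\<in>insert p (insert q S) - {z}. k - z)) * (q - p) =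
      (\<Sum>z\<in>S. F z / (\<Prod>k\<in>insert p S - {z}. k - z)) -
      (\<Sum>z\<in>S. F z / (\<Prod>k\<in>insert q S - {z}. k - z))"
    by (simp add: Sp Sq Spq sum_subtractf cong: sum.cong)
  have "insert p (insert q S) - {p} = insert q S" "insert p (insert q S) - {q} = insert p S"
    "insert p S - {p} = S" "insert q S - {q} = S"
    using assms by auto
  then have "divdiff F (insert p (insert q S)) * (q - p) =
      divdiff F (insert p S) - divdiff F (insert q S)"
    using assms sum by (simp add: divdiff_def distrib_right) (simp add: divide_simps, simp add: algebra_simps)
  then show ?thesis using assms by (simp add: eq_divide_eq)
qed

lemma divdiff_pair: "p \<noteq> q \<Longrightarrow> divdiff F {p, q} = (F p - F q) / (q - p)"
  using divdiff_rec [of "{}" p q F] by (simp add: divdiff_def)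

lemma divdiff_translate: "divdiff F ((\<lambda>z. z + a) ` S) = divdiff (\<lambda>t. F (t + a)) S"
proof -
  have "(\<Prod>k\<in>(\<lambda>z. z + a) ` S - {z + a}. k - (z + a)) = (\<Prod>k\<in>S - {z}. k - z)" for z
  proof -
    have "(\<lambda>z. z + a) ` S - {z + a} = (\<lambda>z. z + a) ` (S - {z})" by auto
    then show ?thesis by (simp add: prod.reindex inj_on_def)
  qed
  then show ?thesis by (simp add: divdiff_def sum.reindex inj_on_def)
qed

lemma divdiff_zero [simp]: "divdiff (\<lambda>t. 0) S = 0"
  by (simp add: divdiff_def)

text \<open>
  The two halves of Cbim. A cut into u and v selects the block v on which B is evaluated; the nodes
  are 0, the x of u, and the x of the last letter or of the first letter, respectively. A cut with
  empty v contributes nothing, because \<open>B [] = 0\<close> in all uses.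
\<close>

definition wL :: "'k::field wmould \<Rightarrow> 'k wmould" where
  "wL B w = cuts (\<lambda>u v. divdiff (\<lambda>t. B (sh t v)) ({0, fst (last w)} \<union> fst ` set u)) (butlast w)"

definition wR :: "'k::field wmould \<Rightarrow> 'k wmould" where
  "wR B w = cuts (\<lambda>u v. divdiff (\<lambda>t. B (sh t v)) ({0, fst (hd w)} \<union> fst ` set u)) (tl w)"

definition wC :: "'k::field wmould \<Rightarrow> 'k wmould" where
  "wC B w = wL B w - wR B w"

text \<open>
  Without the node 0, the nodes are the translates by x of a set that contains 0 again; evaluating at
  translated nodes amounts to shifting the word by x.
\<close>

lemma divdiff_step:
  assumes "finite S" "0 \<notin> S" "x \<notin> S" "x \<noteq> 0"
  shows "divdiff (\<lambda>t. B (sh t v)) (insert 0 (insert x S)) =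
    (divdiff (\<lambda>t. B (sh t v)) (insert 0 S)
      - divdiff (\<lambda>t. B (sh t (sh x v))) (insert 0 ((\<lambda>z. z - x) ` S))) / x"
proof -
  have "insert x S = (\<lambda>z. z + x) ` insert 0 ((\<lambda>z. z - x) ` S)"
    by (auto simp: image_image)
  then have "divdiff (\<lambda>t. B (sh t v)) (insert x S) =
      divdiff (\<lambda>t. B (sh t (sh x v))) (insert 0 ((\<lambda>z. z - x) ` S))"
    by (simp only: divdiff_translate sh_sh)
  then show ?thesis using divdiff_rec [of S 0 x] assms by simp
qed

text \<open>
  The cut with empty u gives the terms in B; all other cuts have the x of the first two letters as
  nodes, and \<open>divdiff_step\<close> applies to the first one.
\<close>

lemma wR_Cons:
  assumes "generic (l # w)" "B [] = 0"
  shows "wR B (l # w) = (B w - B (sh (fst l) w) + wR B w - wR B (sh (fst l) w)) / fst l"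
proof -
  have l: "fst l \<noteq> 0" using assms by (auto simp: generic_def)
  show ?thesis
  proof (cases w)
    case Nil
    then show ?thesis using assms by (simp add: wR_def)
  next
    case (Cons k w')
    have step: "divdiff (\<lambda>t. B (sh t v)) ({0, fst l} \<union> fst ` set (k # u)) =
      (divdiff (\<lambda>t. B (sh t v)) ({0, fst k} \<union> fst ` set u) -
       divdiff (\<lambda>t. B (sh t (sh (fst l) v))) ({0, fst k - fst l} \<union> fst ` set (sh (fst l) u))) / fst l"
      if "u @ v = w'" for u v
    proof -
      have "divdiff (\<lambda>t. B (sh t v)) (insert 0 (insert (fst l) (fst ` set (k # u)))) =
        (divdiff (\<lambda>t. B (sh t v)) (insert 0 (fst ` set (k # u)))
         - divdiff (\<lambda>t. B (sh t (sh (fst l) v))) (insert 0 ((\<lambda>z. z - fst l) ` (fst ` set (k # u))))) / fst l"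
        by (rule divdiff_step) (use assms that Cons in \<open>auto simp: generic_def\<close>)
      moreover have "{0, fst l} \<union> fst ` set (k # u) = insert 0 (insert (fst l) (fst ` set (k # u)))"
        by auto
      moreover have "{0, fst k - fst l} \<union> fst ` set (sh (fst l) u) =
          insert 0 ((\<lambda>z. z - fst l) ` fst ` set (k # u))"
        by (simp add: sh_def image_image)
      ultimately show ?thesis by simp
    qed
    have "wR B (l # w) = divdiff (\<lambda>t. B (sh t w)) {0, fst l}
        + cuts (\<lambda>u v. divdiff (\<lambda>t. B (sh t v)) ({0, fst l} \<union> fst ` set (k # u))) w'"
      by (simp add: wR_def Cons cuts_Cons insert_commute)
    also have "divdiff (\<lambda>t. B (sh t w)) {0, fst l} = (B w - B (sh (fst l) w)) / fst l"
      using l by (simp add: divdiff_pair) (simp add: sh_def)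
    also have "cuts (\<lambda>u v. divdiff (\<lambda>t. B (sh t v)) ({0, fst l} \<union> fst ` set (k # u))) w' =
        cuts (\<lambda>u v. (divdiff (\<lambda>t. B (sh t v)) ({0, fst k} \<union> fst ` set u) -
       divdiff (\<lambda>t. B (sh t (sh (fst l) v))) ({0, fst k - fst l} \<union> fst ` set (sh (fst l) u))) * (1 / fst l)) w'"
      by (rule cuts_cong) (simp only: step, simp)
    also have "\<dots> = (wR B w - wR B (sh (fst l) w)) / fst l"
      by (simp only: cuts_mult_right cuts_diff) (simp add: wR_def Cons cuts_sh)
    finally show ?thesis by (simp add: add_divide_distrib diff_divide_distrib)
  qed
qed

lemma wL_Cons:
  assumes "generic (l # w)" "B [] = 0"
  defines "b \<equiv> butlast (l # w)" and "k \<equiv> last (l # w)"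
  shows "wL B (l # w) = (B b - B (sh (fst k) b)) / fst k + (wL B w - wL B (sh (fst l) w)) / fst l"
proof -
  have l: "fst l \<noteq> 0" using assms by (auto simp: generic_def)
  show ?thesis
  proof (cases w rule: rev_cases)
    case Nil
    then show ?thesis using assms by (simp add: wL_def)
  next
    case (snoc w' k')
    then have k: "k = k'" and b: "b = l # w'" by (simp_all add: k_def b_def butlast_append)
    then have "fst k \<noteq> 0" using assms(1) snoc by (auto simp: generic_def)
    have step: "divdiff (\<lambda>t. B (sh t v)) ({0, fst k} \<union> fst ` set (l # u)) =
      (divdiff (\<lambda>t. B (sh t v)) ({0, fst k} \<union> fst ` set u) -
       divdiff (\<lambda>t. B (sh t (sh (fst l) v))) ({0, fst k - fst l} \<union> fst ` set (sh (fst l) u))) / fst l"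
      if "u @ v = w'" for u v
    proof -
      have "divdiff (\<lambda>t. B (sh t v)) (insert 0 (insert (fst l) (insert (fst k) (fst ` set u)))) =
        (divdiff (\<lambda>t. B (sh t v)) (insert 0 (insert (fst k) (fst ` set u)))
         - divdiff (\<lambda>t. B (sh t (sh (fst l) v)))
             (insert 0 ((\<lambda>z. z - fst l) ` insert (fst k) (fst ` set u)))) / fst l"
        by (rule divdiff_step) (use assms(1) that snoc k in \<open>auto simp: generic_def\<close>)
      moreover have "{0, fst k} \<union> fst ` set (l # u) = insert 0 (insert (fst l) (insert (fst k) (fst ` set u)))"
        by auto
      moreover have "{0, fst k - fst l} \<union> fst ` set (sh (fst l) u) =
          insert 0 ((\<lambda>z. z - fst l) ` insert (fst k) (fst ` set u))"
        by (simp add: sh_def image_image)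
      ultimately show ?thesis by simp
    qed
    have last: "fst (last (sh t (w' @ [k']))) = fst k' - t" for t
      by simp
    have bl: "butlast (sh t (w' @ [k'])) = sh t w'" for t
      by (simp add: butlast_append)
    have "wL B (l # w) = divdiff (\<lambda>t. B (sh t b)) {0, fst k}
        + cuts (\<lambda>u v. divdiff (\<lambda>t. B (sh t v)) ({0, fst k} \<union> fst ` set (l # u))) w'"
      unfolding wL_def by (simp only: snoc butlast_append, simp add: k b cuts_Cons insert_commute)
    also have "divdiff (\<lambda>t. B (sh t b)) {0, fst k} = (B b - B (sh (fst k) b)) / fst k"
      using \<open>fst k \<noteq> 0\<close> by (simp add: divdiff_pair) (simp add: sh_def)
    also have "cuts (\<lambda>u v. divdiff (\<lambda>t. B (sh t v)) ({0, fst k} \<union> fst ` set (l # u))) w' =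
        cuts (\<lambda>u v. (divdiff (\<lambda>t. B (sh t v)) ({0, fst k} \<union> fst ` set u) -
       divdiff (\<lambda>t. B (sh t (sh (fst l) v))) ({0, fst k - fst l} \<union> fst ` set (sh (fst l) u))) * (1 / fst l)) w'"
      by (rule cuts_cong) (simp only: step, simp)
    also have "\<dots> = (wL B w - wL B (sh (fst l) w)) / fst l"
      by (simp only: cuts_mult_right cuts_diff wL_def snoc last bl cuts_sh) (simp add: k)
    finally show ?thesis by simp
  qed
qed

lemma wC_Nil [simp]: "B [] = 0 \<Longrightarrow> wC B [] = 0"
  by (simp add: wC_def wL_def wR_def)

lemma wC_Cons:
  assumes "generic (l # w)" "B [] = 0"
  defines "b \<equiv> butlast (l # w)" and "k \<equiv> last (l # w)"
  shows "wC B (l # w) = (wC B w - wC B (sh (fst l) w)) / fst l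
    + (B b - B (sh (fst k) b)) / fst k - (B w - B (sh (fst l) w)) / fst l"
  unfolding wC_def wL_Cons [of l w B, OF assms(1,2)] wR_Cons [of l w B, OF assms(1,2)] b_def k_def
  by (simp add: add_divide_distrib diff_divide_distrib)

text \<open>
  The recursion \<open>wC_Cons\<close>, expressed by operations on bimoulds.
\<close>

lemma wC_rec:
  assumes "generic w" "B [] = 0"
  shows "wC B w = wmu zmould (wC B) w - headed recip (wC B) w - tailed recip B unit w
      + headed recip B w - wmu zmould B w + wmu B zmould w"
proof (cases w)
  case (Cons l w')
  define b k where "b = butlast w" and "k = last w"
  then have w: "w = b @ [k]" using Cons by simp
  have "tailed recip B unit w = B (sh (fst k) b) / fst k"
    unfolding w by (subst tailed_unit) simp
  moreover have "wmu B zmould w = B b / fst k"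
    unfolding w by (subst wmu_letter_right) simp
  ultimately show ?thesis
    using assms wC_Cons [of l w' B] unfolding Cons
    by (simp add: wmu_letter_left b_def k_def Cons diff_divide_distrib)
qed (use assms in \<open>simp add: wmu_def tailed_def\<close>)

theorem wurit_wganit_wpoc_wC:
  assumes "B [] = 0" "mu_generated M" "generic w"
  shows "wamit (wganit wpoc B) (wganit wpoc M) w - wanit (wganit wpoc B) (wganit wpoc M) w =
    wganit wpoc (\<lambda>z. wamit B M z - wanit B M z + wanit (wC B) M z) w"
  by (rule wurit_wganit_wpoc) (use assms wC_rec in auto)

section \<open>The bimould E\<close>

definition wE :: "'k::field wmould" where
  "wE w = (if length w = 1 then - (fst (hd w) + snd (hd w)) / 2 else if length w = 2 then 1 / 4 else 0)"

lemma wE_simps [simp]: "wE [] = 0" "wE [l] = - (fst l + snd l) / 2" "wE [k, l] = 1 / 4"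
  "wE (j # k # l # w) = 0"
  by (simp_all add: wE_def)

text \<open>
  In the recursion \<open>wC_Cons\<close> the terms in \<open>wE\<close> are differences of a function of degree 1 with slope
  -1/2, for words with two letters, and of a constant, for words with three; the two contributions
  of -1/2 cancel.
\<close>

lemma wC_wE: "generic w \<Longrightarrow> wC wE w = 0"
proof (induction w rule: length_induct)
  case (1 w)
  show ?case
  proof (cases w)
    case (Cons l w')
    have l: "fst l \<noteq> 0" using 1 Cons by (auto simp: generic_def)
    have "wC wE w' = 0" "wC wE (sh (fst l) w') = 0"
      using 1 Cons generic_Cons [of l w'] generic_sh [of l w'] by (simp_all del: split_paired_All)
    then have *: "wC wE w = (wE (butlast w) - wE (sh (fst (last w)) (butlast w))) / fst (last w)
        - (wE w' - wE (sh (fst l) w')) / fst l"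
      using 1 Cons wC_Cons [of l w' wE] by simp
    consider "w' = []" | k where "w' = [k]" | j k where "w' = [j, k]"
      | i j k v where "w' = i # j # k # v"
      by (metis neq_Nil_conv)
    then show ?thesis
    proof cases
      case 1
      then show ?thesis unfolding * unfolding Cons by simp
    next
      case 2
      then have "fst k \<noteq> 0" using 1 Cons by (auto simp: generic_def)
      then show ?thesis using l unfolding * unfolding Cons 2
        by (simp flip: diff_divide_distrib)
    next
      case 3
      then show ?thesis unfolding * unfolding Cons by simp
    next
      case 4
      then show ?thesis unfolding * unfolding Cons 4 by (cases v) (simp_all add: wE_def)
    qed
  qed simp
qed

lemma mu_generated_wE: "mu_generated wE"
proof -
  have "wE w = headed (\<lambda>x y. - (x + y) / 2) unit w
      + wmu (headed (\<lambda>x y. 1 / 2) unit) (headed (\<lambda>x y. 1 / 2) unit) w" for w :: "'a word"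
  proof (cases w)
    case (Cons l v)
    then show ?thesis
      by (cases v) (auto simp: wmu_letter_left unit_def wE_def)
  qed (simp add: wmu_def)
  then have "wE = (\<lambda>w :: 'a word. headed (\<lambda>x y. - (x + y) / 2) unit w
      + wmu (headed (\<lambda>x y. 1 / 2) unit) (headed (\<lambda>x y. 1 / 2) unit) w)"
    by blast
  then show ?thesis
    by (rule ssubst) (intro mu_generated.intros)
qed

section \<open>Specialising rational functions\<close>

text \<open>
  The relation "a is defined at \<open>\<sigma>\<close> with value b". Unlike \<open>rat_subst\<close>, which is total and takes an
  arbitrary value at poles, it is compatible with all field operations as long as no value in a
  denominator vanishes.
\<close>

definition spec :: "(nat \<Rightarrow> ratfun) \<Rightarrow> ratfun \<Rightarrow> ratfun \<Rightarrow> bool" where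
  "spec \<sigma> a b \<longleftrightarrow> (\<exists>p q. poly_subst \<sigma> q \<noteq> 0 \<and> a = Fract p q \<and>
     b = poly_subst \<sigma> p / poly_subst \<sigma> q)"

lemma spec_rat_subst: "spec \<sigma> a b \<Longrightarrow> rat_subst \<sigma> a = b"
  by (auto simp: spec_def rat_subst_Fract)

lemma poly_subst_neq: "poly_subst \<sigma> q \<noteq> 0 \<Longrightarrow> q \<noteq> 0"
  by (auto simp: poly_subst_0)

lemma poly_subst_single_0: "poly_subst \<sigma> (Poly_Mapping.single 0 c) = const c"
  by (simp add: poly_subst_single monom_subst_def)

lemma const_1: "const 1 = 1"
  by (simp add: const_def One_fract_def)

lemma poly_subst_1: "poly_subst \<sigma> 1 = 1"
  using poly_subst_single_0 [of \<sigma> 1] by (simp add: const_1)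

lemma spec_poly: "spec \<sigma> (Fract p 1) (poly_subst \<sigma> p)"
  unfolding spec_def by (rule exI [of _ p], rule exI [of _ 1]) (simp add: poly_subst_1)

lemma spec_const: "spec \<sigma> (const c) (const c)"
  using spec_poly [of \<sigma> "Poly_Mapping.single 0 c"] by (simp add: const_def poly_subst_single_0)

lemma spec_0: "spec \<sigma> 0 0" and spec_1: "spec \<sigma> 1 1"
  using spec_const [of \<sigma> 0] spec_const [of \<sigma> 1] by (simp_all add: const_0 const_1)

lemma spec_var: "spec \<sigma> (var n) (\<sigma> n)"
  using spec_poly [of \<sigma> "Poly_Mapping.single (Poly_Mapping.single n 1) 1"]
  by (simp add: var_def poly_subst_single monom_subst_def const_1)

lemma spec_add: "spec \<sigma> a a' \<Longrightarrow> spec \<sigma> b b' \<Longrightarrow> spec \<sigma> (a + b) (a' + b')"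
proof -
  assume "spec \<sigma> a a'" "spec \<sigma> b b'"
  then obtain p q r s where *: "poly_subst \<sigma> q \<noteq> 0" "a = Fract p q"
    "a' = poly_subst \<sigma> p / poly_subst \<sigma> q" "poly_subst \<sigma> s \<noteq> 0" "b = Fract r s"
    "b' = poly_subst \<sigma> r / poly_subst \<sigma> s" unfolding spec_def by blast
  then have "a + b = Fract (p * s + r * q) (q * s)"
    by (simp add: poly_subst_neq)
  moreover have "a' + b' = poly_subst \<sigma> (p * s + r * q) / poly_subst \<sigma> (q * s)"
    using * by (simp add: poly_subst_add poly_subst_mult add_frac_eq)
  moreover have "poly_subst \<sigma> (q * s) \<noteq> 0" using * by (simp add: poly_subst_mult)
  ultimately show ?thesis unfolding spec_def by blast
qed

lemma spec_mult: "spec \<sigma> a a' \<Longrightarrow> spec \<sigma> b b' \<Longrightarrow> spec \<sigma> (a * b) (a' * b')"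
proof -
  assume "spec \<sigma> a a'" "spec \<sigma> b b'"
  then obtain p q r s where *: "poly_subst \<sigma> q \<noteq> 0" "a = Fract p q"
    "a' = poly_subst \<sigma> p / poly_subst \<sigma> q" "poly_subst \<sigma> s \<noteq> 0" "b = Fract r s"
    "b' = poly_subst \<sigma> r / poly_subst \<sigma> s" unfolding spec_def by blast
  then have "a * b = Fract (p * r) (q * s)" "a' * b' = poly_subst \<sigma> (p * r) / poly_subst \<sigma> (q * s)"
    "poly_subst \<sigma> (q * s) \<noteq> 0"
    by (simp_all add: poly_subst_mult)
  then show ?thesis unfolding spec_def by blast
qed

lemma spec_inverse: "spec \<sigma> a a' \<Longrightarrow> a' \<noteq> 0 \<Longrightarrow> spec \<sigma> (inverse a) (inverse a')"
  unfolding spec_def by (metis inverse_fract divide_eq_0_iff inverse_divide)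

lemma spec_divide: "spec \<sigma> a a' \<Longrightarrow> spec \<sigma> b b' \<Longrightarrow> b' \<noteq> 0 \<Longrightarrow> spec \<sigma> (a / b) (a' / b')"
  unfolding divide_inverse by (intro spec_mult spec_inverse)

lemma spec_uminus: "spec \<sigma> a a' \<Longrightarrow> spec \<sigma> (- a) (- a')"
proof -
  assume a: "spec \<sigma> a a'"
  have "const (- 1) + 1 = 0"
    using const_add [of "- 1" 1] by (simp add: const_0 const_1)
  then have "const (- 1) = - 1" by (simp only: eq_neg_iff_add_eq_0)
  then show ?thesis using spec_mult [OF spec_const [of \<sigma> "- 1"] a] by simp
qed

lemma spec_diff: "spec \<sigma> a a' \<Longrightarrow> spec \<sigma> b b' \<Longrightarrow> spec \<sigma> (a - b) (a' - b')"
  unfolding diff_conv_add_uminus by (intro spec_add spec_uminus)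

lemma spec_sum: "(\<And>i. i \<in> I \<Longrightarrow> spec \<sigma> (f i) (g i)) \<Longrightarrow> spec \<sigma> (sum f I) (sum g I)"
  by (induction I rule: infinite_finite_induct) (simp_all add: spec_0 spec_add)

lemma spec_prod: "(\<And>i. i \<in> I \<Longrightarrow> spec \<sigma> (f i) (g i)) \<Longrightarrow> spec \<sigma> (prod f I) (prod g I)"
  by (induction I rule: infinite_finite_induct) (simp_all add: spec_1 spec_mult)

lemma spec_power: "spec \<sigma> a a' \<Longrightarrow> spec \<sigma> (a ^ n) (a' ^ n)"
  by (induction n) (simp_all add: spec_1 spec_mult)

lemma spec_numeral: "spec \<sigma> (numeral n) (numeral n)"
  by (induction n) (simp_all only: numeral.simps spec_1 spec_add)

lemma spec_unique: "spec \<sigma> a a' \<Longrightarrow> spec \<sigma> a b' \<Longrightarrow> a' = b'"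
  by (metis spec_rat_subst)

lemma spec_poly_subst:
  assumes "\<And>n. spec \<sigma> (\<tau> n) (\<rho> n)"
  shows "spec \<sigma> (poly_subst \<tau> p) (poly_subst \<rho> p)"
  unfolding poly_subst_def monom_subst_def
  by (intro spec_sum spec_mult spec_const spec_prod spec_power assms)

definition wspec :: "(nat \<Rightarrow> ratfun) \<Rightarrow> ratfun word \<Rightarrow> ratfun word \<Rightarrow> bool" where
  "wspec \<sigma> = list_all2 (rel_prod (spec \<sigma>) (spec \<sigma>))"

lemma wspec_simps [simp]: "wspec \<sigma> [] w \<longleftrightarrow> w = []" "wspec \<sigma> w [] \<longleftrightarrow> w = []"
  "wspec \<sigma> (l # w) (l' # w') \<longleftrightarrow> spec \<sigma> (fst l) (fst l') \<and> spec \<sigma> (snd l) (snd l') \<and> wspec \<sigma> w w'"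
  by (auto simp: wspec_def rel_prod_sel)

lemma wspec_Cons: "wspec \<sigma> (l # w) v \<longleftrightarrow>
    (\<exists>l' w'. v = l' # w' \<and> spec \<sigma> (fst l) (fst l') \<and> spec \<sigma> (snd l) (snd l') \<and> wspec \<sigma> w w')"
  by (cases v) auto

lemma wspec_append: "wspec \<sigma> u u' \<Longrightarrow> wspec \<sigma> v v' \<Longrightarrow> wspec \<sigma> (u @ v) (u' @ v')"
  by (simp add: wspec_def list_all2_appendI)

lemma wspec_length: "wspec \<sigma> w w' \<Longrightarrow> length w = length w'"
  unfolding wspec_def by (rule list_all2_lengthD)

lemma wspec_sh: "wspec \<sigma> w w' \<Longrightarrow> spec \<sigma> t t' \<Longrightarrow> wspec \<sigma> (sh t w) (sh t' w')"
  by (induction w arbitrary: w') (auto simp: wspec_Cons spec_diff)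

lemma wspec_ysum: "wspec \<sigma> w w' \<Longrightarrow> spec \<sigma> (ysum w) (ysum w')"
  by (induction w arbitrary: w') (auto simp: wspec_Cons spec_add spec_0)

lemma wspec_fst: "wspec \<sigma> w w' \<Longrightarrow> l \<in> set w \<Longrightarrow> \<exists>l'\<in>set w'. spec \<sigma> (fst l) (fst l')"
  by (induction w arbitrary: w') (auto simp: wspec_Cons)

text \<open>
  Equal letters have equal values, so distinctness can only get lost under specialisation.
\<close>

lemma wspec_generic:
  assumes "wspec \<sigma> w w'" "generic w'"
  shows "generic w"
  using assms
proof (induction w arbitrary: w')
  case (Cons l w)
  then obtain l' v where v: "w' = l' # v" "spec \<sigma> (fst l) (fst l')" "wspec \<sigma> w v"
    by (auto simp: wspec_Cons)
  have "generic v" using Cons.prems(2) unfolding v by (rule generic_Cons)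
  then have "generic w" by (rule Cons.IH [OF v(3)])
  moreover have l': "fst l' \<noteq> 0" "fst l' \<notin> fst ` set v"
    using Cons.prems v by (auto simp: generic_def)
  then have "fst l \<noteq> 0" using v(2) spec_0 spec_unique by metis
  moreover have "fst l \<notin> fst ` set w"
  proof
    assume "fst l \<in> fst ` set w"
    then obtain k where k: "k \<in> set w" "fst l = fst k" by blast
    obtain k' where "k' \<in> set v" "spec \<sigma> (fst k) (fst k')" using wspec_fst [OF v(3) k(1)] by blast
    then show False using v(2) k l' spec_unique by (metis imageI)
  qed
  ultimately show ?case by (auto simp: generic_def)
qed simp

lemma spec_cuts:
  assumes "wspec \<sigma> w w'"
    and "\<And>u v u' v'. u @ v = w \<Longrightarrow> u' @ v' = w' \<Longrightarrow> wspec \<sigma> u u' \<Longrightarrow> wspec \<sigma> v v' \<Longrightarrow>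
      spec \<sigma> (f u v) (g u' v')"
  shows "spec \<sigma> (cuts f w) (cuts g w')"
  unfolding cuts_def wspec_length [OF assms(1)]
  by (intro spec_sum assms(2))
    (use assms(1) in \<open>auto simp: wspec_def intro: list_all2_takeI list_all2_dropI\<close>)

lemma spec_uncons:
  assumes "wspec \<sigma> z z'"
    and "\<And>k c k' c'. z = k # c \<Longrightarrow> z' = k' # c' \<Longrightarrow> spec \<sigma> (fst k) (fst k') \<Longrightarrow>
      spec \<sigma> (snd k) (snd k') \<Longrightarrow> wspec \<sigma> c c' \<Longrightarrow> spec \<sigma> (f k c) (g k' c')"
  shows "spec \<sigma> (uncons f z) (uncons g z')"
  using assms by (cases z; cases z') (auto simp: spec_0)

text \<open>
  A natural function of words commutes with every substitution after which the word is still
  generic. All flexion operations preserve this property.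
\<close>

definition natural :: "ratfun wmould \<Rightarrow> bool" where
  "natural M \<longleftrightarrow> (\<forall>\<sigma> w w'. wspec \<sigma> w w' \<longrightarrow> generic w' \<longrightarrow> spec \<sigma> (M w) (M w'))"

lemma naturalD: "natural M \<Longrightarrow> wspec \<sigma> w w' \<Longrightarrow> generic w' \<Longrightarrow> spec \<sigma> (M w) (M w')"
  by (auto simp: natural_def)

lemma generic_sh_before: "generic (b @ l # c) \<Longrightarrow> generic (sh (fst l) b)"
  by (force simp: generic_def sh_def distinct_map inj_on_def o_def image_iff)

lemma generic_flexion:
  "generic (a @ b @ l # c) \<Longrightarrow> generic (a @ (fst l, s) # c)"
  "generic (a @ l # b @ c) \<Longrightarrow> generic (a @ (fst l, s) # c)"
  by (auto simp: generic_def)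

lemma natural_wmu:
  assumes "natural M" "natural N"
  shows "natural (wmu M N)"
  unfolding natural_def wmu_def
  by (intro allI impI spec_cuts spec_mult naturalD [OF assms(1)] naturalD [OF assms(2)])
    (auto dest: generic_append)

lemma natural_wamit:
  assumes "natural M" "natural N"
  shows "natural (wamit N M)"
  unfolding natural_def wamit_def
proof (intro allI impI spec_cuts spec_uncons spec_mult naturalD [OF assms(1)] naturalD [OF assms(2)]
    wspec_append wspec_sh)
qed (auto intro: spec_add wspec_ysum generic_flexion(1) generic_sh_before dest: generic_append)

lemma natural_wanit:
  assumes "natural M" "natural N"
  shows "natural (wanit N M)"
  unfolding natural_def wanit_def
proof (intro allI impI spec_cuts spec_uncons spec_mult naturalD [OF assms(1)] naturalD [OF assms(2)]
    wspec_append wspec_sh)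
qed (auto intro: spec_add wspec_ysum generic_flexion(2) generic_sh_prefix dest: generic_append(2))

text \<open>
  The recursion replaces M by \<open>\<lambda>z. M (l # z)\<close>, which is not natural, because z must not contain the
  x of l. Hence the condition on M is restricted to words with x among those of \<open>w'\<close>.
\<close>

lemma spec_wganit:
  assumes "natural C"
    and "\<And>z z'. wspec \<sigma> z z' \<Longrightarrow> generic z' \<Longrightarrow> set (map fst z') \<subseteq> set (map fst w') \<Longrightarrow>
      spec \<sigma> (M z) (M' z')"
    and "wspec \<sigma> w w'" "generic w'"
  shows "spec \<sigma> (wganit C M w) (wganit C M' w')"
  using assms(2-)
proof (induction w arbitrary: w' M M' rule: word_induct)
  case (Cons l w)
  then obtain l' v where v: "w' = l' # v" "spec \<sigma> (fst l) (fst l')" "spec \<sigma> (snd l) (snd l')"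
      "wspec \<sigma> w v"
    by (auto simp: wspec_Cons)
  show ?case unfolding v(1) wganit_Cons
  proof (rule spec_cuts [OF v(4)])
    fix a b a' b'
    assume ab: "a @ b = w" "a' @ b' = v" "wspec \<sigma> a a'" "wspec \<sigma> b b'"
    have gen: "generic (l' # a' @ b')" using Cons.prems v ab by simp
    have "spec \<sigma> (wganit C (\<lambda>z. M ((fst l, snd l + ysum a) # z)) b)
      (wganit C (\<lambda>z. M' ((fst l', snd l' + ysum a') # z)) b')"
    proof (rule Cons.IH [OF ab(1) _ ab(4)])
      fix z z'
      assume z: "wspec \<sigma> z z'" "generic z'" "set (map fst z') \<subseteq> set (map fst b')"
      show "spec \<sigma> (M ((fst l, snd l + ysum a) # z)) (M' ((fst l', snd l' + ysum a') # z'))"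
      proof (rule Cons.prems(1))
        have "fst l' \<notin> set (map fst b')" "fst l' \<noteq> 0" using gen by (auto simp: generic_def)
        then show "generic ((fst l', snd l' + ysum a') # z')"
          using z by (auto simp: generic_def simp flip: set_map)
      qed (use z v ab in \<open>auto intro: spec_add wspec_ysum simp del: set_map\<close>)
    qed (use gen generic_append generic_Cons in blast)
    moreover have "spec \<sigma> (C (sh (fst l) a)) (C (sh (fst l') a'))"
      by (intro naturalD [OF assms(1)] wspec_sh ab v generic_sh_prefix [OF gen])
    ultimately show "spec \<sigma> (C (sh (fst l) a) * wganit C (\<lambda>z. M ((fst l, snd l + ysum a) # z)) b)
      (C (sh (fst l') a') * wganit C (\<lambda>z. M' ((fst l', snd l' + ysum a') # z)) b')"
      by (rule spec_mult [rotated])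
  qed
qed auto

lemma natural_wganit: "natural C \<Longrightarrow> natural M \<Longrightarrow> natural (wganit C M)"
  unfolding natural_def [of "wganit C M"] using spec_wganit naturalD by blast

lemma natural_wpic: "natural wpic"
  unfolding natural_def
proof (intro allI impI)
  fix \<sigma> w w'
  assume "wspec \<sigma> w w'" "generic w'"
  then have "spec \<sigma> (prod_list (map fst w)) (prod_list (map fst w')) \<and> prod_list (map fst w') \<noteq> 0"
    by (induction w arbitrary: w')
      (auto simp: wspec_Cons spec_1 generic_def intro!: spec_mult)
  then show "spec \<sigma> (wpic w) (wpic w')" by (simp add: wpic_def spec_divide spec_1)
qed

lemma natural_wpoc: "natural wpoc"
  unfolding natural_def
proof (intro allI impI)
  fix \<sigma> w w'
  assume "wspec \<sigma> w w'" "generic w'"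
  then show "spec \<sigma> (wpoc w) (wpoc w')"
  proof (induction "length w" arbitrary: w w')
    case (Suc n)
    then obtain l v where w: "w = l # v" by (cases w) auto
    then obtain l' v' where w': "w' = l' # v'" using Suc.prems by (auto simp: wspec_Cons)
    have "spec \<sigma> (wpoc (sh (fst l) v)) (wpoc (sh (fst l') v'))"
      using Suc w w' by (intro Suc.hyps(1) generic_sh wspec_sh) auto
    then show ?case using Suc.prems unfolding w w' wpoc_Cons
      by (intro spec_uminus spec_mult spec_divide spec_1) (auto simp: generic_def)
  qed (simp add: spec_1)
qed

lemma natural_wQ: "natural M \<Longrightarrow> natural (wQ M)"
  unfolding natural_def
proof (intro allI impI)
  fix \<sigma> w w'
  assume *: "\<forall>\<sigma> w w'. wspec \<sigma> w w' \<longrightarrow> generic w' \<longrightarrow> spec \<sigma> (M w) (M w')" "wspec \<sigma> w w'" "generic w'"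
  from *(2) have "spec \<sigma> (xysum w) (xysum w')"
    by (induction w arbitrary: w') (auto simp: wspec_Cons intro!: spec_0 spec_add spec_mult)
  then show "spec \<sigma> (wQ M w) (wQ M w')"
    unfolding wQ_def using * by (intro spec_mult) auto
qed

lemma natural_add: "natural M \<Longrightarrow> natural N \<Longrightarrow> natural (\<lambda>w. M w + N w)"
  unfolding natural_def by (blast intro: spec_add)

lemma natural_diff: "natural M \<Longrightarrow> natural N \<Longrightarrow> natural (\<lambda>w. M w - N w)"
  unfolding natural_def by (blast intro: spec_diff)

lemma wspec_butlast: "wspec \<sigma> w w' \<Longrightarrow> wspec \<sigma> (butlast w) (butlast w')"
  unfolding wspec_def by (simp add: butlast_conv_take list_all2_lengthD list_all2_takeI)

lemma wspec_last: "wspec \<sigma> w w' \<Longrightarrow> w \<noteq> [] \<Longrightarrow> spec \<sigma> (fst (last w)) (fst (last w'))"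
  by (induction w arbitrary: w') (auto simp: wspec_Cons)

text \<open>
  By the recursion \<open>wC_Cons\<close>, whose denominators are the x of single letters.
\<close>

lemma natural_wC:
  assumes "natural B" "B [] = 0"
  shows "natural (wC B)"
  unfolding natural_def
proof (intro allI impI)
  fix \<sigma> w w'
  assume "wspec \<sigma> w w'" "generic w'"
  then show "spec \<sigma> (wC B w) (wC B w')"
  proof (induction "length w" arbitrary: w w')
    case (Suc n)
    then obtain l v where w: "w = l # v" by (cases w) auto
    then obtain l' v' where w': "w' = l' # v'" and s: "spec \<sigma> (fst l) (fst l')" "wspec \<sigma> v v'"
      using Suc.prems by (auto simp: wspec_Cons)
    have gen: "generic (l' # v')" "generic (l # v)" using Suc.prems w w' wspec_generic by blast+
    have gb: "generic (butlast (l' # v') @ [last (l' # v')])"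
      by (subst append_butlast_last_id) (simp_all only: gen not_Cons_self2 list.discI, simp_all)
    have nz: "fst l' \<noteq> 0" "fst (last (l' # v')) \<noteq> 0"
      using gen gb by (auto simp: generic_def simp del: append_butlast_last_id butlast.simps last.simps)
    note last = wspec_last [OF Suc.prems(1)] and bl = wspec_butlast [OF Suc.prems(1)]
    show ?case unfolding w w' wC_Cons [where B = B, OF gen(1) assms(2)] wC_Cons [where B = B, OF gen(2) assms(2)]
      using last bl s nz gen Suc.hyps
      by (intro spec_add spec_diff spec_divide Suc.hyps(1) naturalD [OF assms(1)] wspec_sh)
        (auto simp: w w' intro: generic_sh generic_sh_before [OF gb] generic_append(1) [OF gb]
          generic_Cons simp del: butlast.simps last.simps)
  qed (simp add: assms spec_0)
qed

lemma const_eq_0_iff: "const c = 0 \<longleftrightarrow> c = 0"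
proof
  assume "const c = 0"
  then have "Poly_Mapping.single 0 c = (0 :: qpoly)"
    by (simp add: const_def eq_fract Zero_fract_def)
  then show "c = 0" by (metis lookup_single_eq lookup_zero)
qed (simp add: const_0)

lemma numeral_ratfun: "(numeral n :: ratfun) = const (numeral n)"
  by (induction n) (simp_all only: numeral.simps const_add const_1)

lemma numeral_ratfun_nonzero: "(numeral n :: ratfun) \<noteq> 0"
  by (simp add: numeral_ratfun const_eq_0_iff)

lemma natural_wE: "natural wE"
  unfolding natural_def wE_def
proof (intro allI impI)
  fix \<sigma> w w'
  assume "wspec \<sigma> w w'"
  moreover from this have "length w = length w'" by (rule wspec_length)
  ultimately show "spec \<sigma> (if length w = 1 then - (fst (hd w) + snd (hd w)) / 2
      else if length w = 2 then 1 / 4 else 0)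
    (if length w' = 1 then - (fst (hd w') + snd (hd w')) / 2
      else if length w' = 2 then 1 / 4 else 0)"
    by (cases w; cases w')
      (auto simp: numeral_ratfun_nonzero
        intro!: spec_uminus spec_divide spec_diff spec_1 spec_0 spec_numeral)
qed

section \<open>Bimoulds represented by functions on words\<close>

definition vars :: "nat \<Rightarrow> nat \<Rightarrow> ratfun word" where
  "vars a b = map (\<lambda>i. (vX i, vY i)) [a..<Suc b]"

lemma map_fst_vars: "map fst (vars a b) = Xs a b"
  and map_snd_vars: "map snd (vars a b) = Ys a b"
  and length_vars: "length (vars a b) = Suc b - a"
  and vars_empty: "b < a \<Longrightarrow> vars a b = []"
  by (simp_all add: vars_def Xs_def Ys_def del: upt_Suc)

lemma vars_Cons: "a \<le> b \<Longrightarrow> vars a b = (vX a, vY a) # vars (Suc a) b"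
  by (simp add: vars_def upt_conv_Cons del: upt_Suc)

lemma vars_append: "a \<le> b \<Longrightarrow> b \<le> Suc c \<Longrightarrow> vars a c = vars a (b - 1) @ vars b c" if "0 < b"
  using that upt_add_eq_append [of a b "Suc c - b"] by (simp add: vars_def del: upt_Suc)

lemma take_vars: "i \<le> Suc b - a \<Longrightarrow> 0 < a \<Longrightarrow> take i (vars a b) = vars a (a + i - 1)"
  by (cases "i = 0") (simp_all add: vars_def take_map take_upt del: upt_Suc)

lemma drop_vars: "drop i (vars a b) = vars (a + i) b"
  by (simp add: vars_def drop_map del: upt_Suc)

lemma ysum_vars: "ysum (vars a b) = Ysum a b"
  by (simp add: vars_def ysum_def Ysum_def o_def sum_set_upt_conv_sum_list_nat [symmetric]
      atLeastLessThanSuc_atLeastAtMost del: upt_Suc)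

lemma map_fst_sh_vars: "map fst (sh t (vars a b)) = map (\<lambda>j. vX j - t) [a..<b + 1]"
  and map_snd_sh: "map snd (sh t w) = map snd w"
  by (simp_all add: vars_def sh_def del: upt_Suc)

lemma var_eq_iff: "var i = var j \<longleftrightarrow> i = j"
proof
  assume "var i = var j"
  then have "Poly_Mapping.single (Poly_Mapping.single i 1) (1::rat)
      = Poly_Mapping.single (Poly_Mapping.single j (1::nat)) 1"
    by (simp add: var_def eq_fract)
  then have "Poly_Mapping.single i (1::nat) = Poly_Mapping.single j 1"
    by (metis lookup_single_eq lookup_single_not_eq zero_neq_one)
  then show "i = j" by (metis lookup_single_eq lookup_single_not_eq zero_neq_one)
qed simp

lemma var_nonzero: "var i \<noteq> 0"
proof
  assume "var i = 0"
  then have "Poly_Mapping.single (Poly_Mapping.single i (1::nat)) (1::rat) = 0"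
    by (simp add: var_def eq_fract Zero_fract_def)
  then show False by (metis lookup_single_eq lookup_zero zero_neq_one)
qed

lemma vX_eq_iff: "vX i = vX j \<longleftrightarrow> i = j" and vX_nonzero: "vX i \<noteq> 0"
  by (simp_all add: vX_def var_eq_iff var_nonzero)

lemma generic_vars: "generic (vars a b)"
  by (auto simp: generic_def vars_def o_def distinct_map inj_on_def vX_eq_iff vX_nonzero
      simp del: upt_Suc)

text \<open>
  The component of depth r is the value at the word of variables. Naturality then yields the value
  of any substitution into it (\<open>represents_subst\<close>), so that composites of operations on bimoulds
  never require substituting into a substituted expression.
\<close>

definition represents :: "bimould \<Rightarrow> ratfun wmould \<Rightarrow> bool" where
  "represents A M \<longleftrightarrow> natural M \<and> (\<forall>r. A r = M (vars 1 r))"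

lemma representsD: "represents A M \<Longrightarrow> natural M" "represents A M \<Longrightarrow> A r = M (vars 1 r)"
  by (simp_all add: represents_def)

lemma represents_subst:
  assumes "represents A M" "generic w" "length w = n" "map fst w = xs" "map snd w = ys"
  shows "(A n) \<langle>xs | ys\<rangle> = M w"
proof -
  have "wspec (args xs ys) (vars 1 n) w"
    unfolding wspec_def
  proof (rule list_all2_all_nthI)
    fix i assume "i < length (vars 1 n)"
    then have i: "i < n" by (simp add: length_vars)
    have "spec (args xs ys) (var (2 * Suc i)) (args xs ys (2 * Suc i))"
      "spec (args xs ys) (var (2 * Suc i + 1)) (args xs ys (2 * Suc i + 1))"
      by (rule spec_var)+
    moreover have "args xs ys (2 * Suc i) = fst (w ! i)" "args xs ys (2 * Suc i + 1) = snd (w ! i)"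
      using i assms(3) by (simp_all add: args_def flip: assms(4,5))
    ultimately show "rel_prod (spec (args xs ys)) (spec (args xs ys)) (vars 1 n ! i) (w ! i)"
      using i by (simp add: vars_def rel_prod_sel vX_def vY_def del: upt_Suc)
  qed (simp add: length_vars assms)
  then show ?thesis
    using assms spec_rat_subst naturalD by (simp add: representsD subst_def)
qed

lemma represents_add: "represents A M \<Longrightarrow> represents B N \<Longrightarrow> represents (A + B) (\<lambda>w. M w + N w)"
  by (simp add: represents_def natural_add)

lemma represents_diff: "represents A M \<Longrightarrow> represents B N \<Longrightarrow> represents (A - B) (\<lambda>w. M w - N w)"
  by (simp add: represents_def natural_diff)

lemma represents_mu:
  assumes "represents A M" "represents B N"
  shows "represents (mu A B) (wmu M N)"
  unfolding represents_def
proof (intro conjI allI natural_wmu representsD [OF assms(1)] representsD [OF assms(2)])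
  fix r
  have "(A i) \<langle>Xs 1 i | Ys 1 i\<rangle> * (B (r - i)) \<langle>Xs (i + 1) r | Ys (i + 1) r\<rangle> =
      M (take i (vars 1 r)) * N (drop i (vars 1 r))" if "i \<le> r" for i
  proof -
    have "(A i) \<langle>Xs 1 i | Ys 1 i\<rangle> = M (vars 1 i)"
      by (rule represents_subst [OF assms(1)]) (simp_all add: generic_vars length_vars map_fst_vars map_snd_vars)
    moreover have "(B (r - i)) \<langle>Xs (i + 1) r | Ys (i + 1) r\<rangle> = N (vars (i + 1) r)"
      by (rule represents_subst [OF assms(2)]) (simp_all add: generic_vars length_vars map_fst_vars map_snd_vars)
    ultimately show ?thesis using that by (simp add: take_vars drop_vars)
  qed
  then show "mu A B r = wmu M N (vars 1 r)"
    by (simp add: mu_def wmu_def cuts_def length_vars atLeast0AtMost)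
qed

text \<open>
  The pair (a, b) of indices corresponds to cutting off a - 1 letters and then b - a letters. The
  cuts that correspond to no pair have an empty second or third factor and contribute 0.
\<close>

lemma represents_amit:
  assumes "represents A M" "represents B N" "N [] = 0"
  shows "represents (amit B A) (wamit N M)"
  unfolding represents_def
proof (intro conjI allI natural_wamit representsD [OF assms(1)] representsD [OF assms(2)])
  fix r
  define g where "g = (\<lambda>(i, j). uncons (\<lambda>l c.
      M (take i (vars 1 r) @ (fst l, ysum (take j (drop i (vars 1 r))) + snd l) # c) *
      N (sh (fst l) (take j (drop i (vars 1 r))))) (drop j (drop i (vars 1 r))))"
  define f where "f = (\<lambda>(a, b).
     (A (r - (b - a))) \<langle>Xs 1 (a - 1) @ Xs b r | Ys 1 (a - 1) @ Ysum a b # Ys (b + 1) r\<rangle> *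
     (B (b - a)) \<langle>map (\<lambda>j. vX j - vX b) [a..<b] | Ys a (b - 1)\<rangle>)"
  define S where "S = {(a, b). 1 \<le> a \<and> a < b \<and> b \<le> r}"
  define T where "T = (SIGMA i:{..r}. {..r - i})"
  define T' where "T' = {(i, j) \<in> T. j = 0 \<or> i + j = r}"
  have fg: "f (a, b) = g (a - 1, b - a)" if ab: "1 \<le> a" "a < b" "b \<le> r" for a b
  proof -
    let ?w = "vars 1 (a - 1) @ (vX b, Ysum a b) # vars (b + 1) r"
    have split: "vars 1 r = vars 1 (a - 1) @ vars a (b - 1) @ (vX b, vY b) # vars (b + 1) r"
      using ab vars_append [of a 1 r] vars_append [of b a r] vars_Cons [of b r] by simp
    have gen: "generic (vars 1 (a - 1) @ vars a (b - 1) @ (vX b, vY b) # vars (b + 1) r)"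
      by (metis split generic_vars)
    have Xs: "Xs b r = vX b # Xs (b + 1) r"
      using ab vars_Cons [of b r] by (simp flip: map_fst_vars)
    have "(A (r - (b - a))) \<langle>Xs 1 (a - 1) @ Xs b r | Ys 1 (a - 1) @ Ysum a b # Ys (b + 1) r\<rangle> = M ?w"
      by (rule represents_subst [OF assms(1)])
        (use ab generic_flexion(1) [OF gen] in
          \<open>simp_all add: length_vars map_fst_vars map_snd_vars Xs\<close>)
    moreover have "(B (b - a)) \<langle>map (\<lambda>j. vX j - vX b) [a..<b] | Ys a (b - 1)\<rangle> =
        N (sh (vX b) (vars a (b - 1)))"
      using generic_sh_before [OF generic_append(2) [OF gen]]
      by (intro represents_subst [OF assms(2)])
        (use ab in \<open>simp_all add: length_vars map_fst_sh_vars map_snd_sh map_snd_vars\<close>)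
    moreover have "take (a - 1) (vars 1 r) = vars 1 (a - 1)" "drop (a - 1) (vars 1 r) = vars a r"
      "take (b - a) (vars a r) = vars a (b - 1)" "drop (b - a) (vars a r) = vars b r"
      using ab by (simp_all add: take_vars drop_vars)
    moreover have "Ysum a b = Ysum a (b - 1) + vY b"
      using ab by (cases b) (simp_all add: Ysum_def)
    ultimately show ?thesis
      using ab vars_Cons [of b r] by (simp add: f_def g_def ysum_vars drop_vars)
  qed
  have "sum f S = sum g T"
  proof (rule sum.reindex_bij_witness_not_neutral [where S' = "{}" and T' = T'
        and i = "\<lambda>(i, j). (i + 1, i + j + 1)" and j = "\<lambda>(a, b). (a - 1, b - a)"])
    show "finite T'" unfolding T'_def T_def by (rule finite_subset [of _ "SIGMA i:{..r}. {..r - i}"]) auto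
    fix p assume "p \<in> T'"
    then obtain i j where p: "p = (i, j)" "j = 0 \<or> i + j = r" "i \<le> r" by (auto simp: T'_def T_def)
    then show "g p = 0"
      by (cases "j = 0") (auto simp: g_def assms uncons_def drop_vars vars_empty split: list.split)
  qed (auto simp: S_def T_def T'_def fg)
  then show "amit B A r = wamit N M (vars 1 r)"
    by (simp add: amit_def S_def f_def T_def g_def wamit_def cuts_def length_vars sum.Sigma)
qed

lemma represents_anit:
  assumes "represents A M" "represents B N" "N [] = 0"
  shows "represents (anit B A) (wanit N M)"
  unfolding represents_def
proof (intro conjI allI natural_wanit representsD [OF assms(1)] representsD [OF assms(2)])
  fix r
  define g where "g = (\<lambda>(i, j).
      M (vars 1 i @ (vX (i + 1), vY (i + 1) + ysum (take j (vars (i + 2) r))) # drop j (vars (i + 2) r)) *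
      N (sh (vX (i + 1)) (take j (vars (i + 2) r))))"
  define f where "f = (\<lambda>(a, b).
     (A (r - (b - a))) \<langle>Xs 1 a @ Xs (b + 1) r | Ys 1 (a - 1) @ Ysum a b # Ys (b + 1) r\<rangle> *
     (B (b - a)) \<langle>map (\<lambda>j. vX j - vX a) [a + 1..<b + 1] | Ys (a + 1) b\<rangle>)"
  define S where "S = {(a, b). 1 \<le> a \<and> a < b \<and> b \<le> r}"
  define T where "T = (SIGMA i:{..<r}. {..r - i - 1})"
  define T' where "T' = {(i, j) \<in> T. j = 0}"
  have fg: "f (a, b) = g (a - 1, b - a)" if ab: "1 \<le> a" "a < b" "b \<le> r" for a b
  proof -
    let ?w = "vars 1 (a - 1) @ (vX a, Ysum a b) # vars (b + 1) r"
    have split: "vars 1 r = vars 1 (a - 1) @ (vX a, vY a) # vars (a + 1) b @ vars (b + 1) r"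
      using ab vars_append [of a 1 r] vars_append [of "b + 1" "a + 1" r] vars_Cons [of a r] by simp
    have gen: "generic (vars 1 (a - 1) @ (vX a, vY a) # vars (a + 1) b @ vars (b + 1) r)"
      by (metis split generic_vars)
    have Xs: "Xs 1 a = Xs 1 (a - 1) @ [vX a]"
      using ab by (cases a) (simp_all add: Xs_def)
    have "(A (r - (b - a))) \<langle>Xs 1 a @ Xs (b + 1) r | Ys 1 (a - 1) @ Ysum a b # Ys (b + 1) r\<rangle> = M ?w"
      by (rule represents_subst [OF assms(1)])
        (use ab generic_flexion(2) [OF gen] in
          \<open>simp_all add: length_vars map_fst_vars map_snd_vars Xs [unfolded One_nat_def]\<close>)
    moreover have "generic (sh (vX a) (vars (a + 1) b))"
      using generic_sh_prefix [OF generic_append(2) [OF gen]] by simp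
    then have "(B (b - a)) \<langle>map (\<lambda>j. vX j - vX a) [a + 1..<b + 1] | Ys (a + 1) b\<rangle> =
        N (sh (vX a) (vars (a + 1) b))"
      by (intro represents_subst [OF assms(2)])
        (use ab in \<open>simp_all add: length_vars map_fst_sh_vars map_snd_sh map_snd_vars\<close>)
    moreover have "take (b - a) (vars (a + 1) r) = vars (a + 1) b"
      "drop (b - a) (vars (a + 1) r) = vars (b + 1) r"
      using ab by (simp_all add: take_vars drop_vars)
    moreover have "Ysum a b = vY a + Ysum (a + 1) b"
      using ab by (simp add: Ysum_def sum.atLeast_Suc_atMost)
    ultimately show ?thesis
      using ab by (simp add: f_def g_def ysum_vars)
  qed
  have "sum f S = sum g T"
  proof (rule sum.reindex_bij_witness_not_neutral [where S' = "{}" and T' = T'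
        and i = "\<lambda>(i, j). (i + 1, i + j + 1)" and j = "\<lambda>(a, b). (a - 1, b - a)"])
    show "finite T'" unfolding T'_def T_def by (rule finite_subset [of _ "SIGMA i:{..<r}. {..r - i - 1}"]) auto
    fix p assume "p \<in> T'"
    then show "g p = 0" by (auto simp: T'_def g_def assms)
  qed (auto simp: S_def T_def T'_def fg)
  moreover have "wanit N M (vars 1 r) = sum g T"
  proof -
    have "wanit N M (vars 1 r) = (\<Sum>i<r. uncons (\<lambda>l.
      cuts (\<lambda>b c. M (take i (vars 1 r) @ (fst l, snd l + ysum b) # c) * N (sh (fst l) b)))
      (drop i (vars 1 r)))"
      unfolding wanit_def cuts_def [of _ "vars 1 r"]
      by (simp add: length_vars drop_vars vars_empty lessThan_Suc_atMost [symmetric])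
    also have "\<dots> = (\<Sum>i<r. \<Sum>j\<le>r - i - 1. g (i, j))"
    proof (rule sum.cong)
      fix i assume "i \<in> {..<r}"
      then have "i \<le> r" "drop i (vars 1 r) = (vX (i + 1), vY (i + 1)) # vars (i + 2) r"
        using vars_Cons [of "i + 1" r] by (simp_all add: drop_vars)
      then show "uncons (\<lambda>l. cuts (\<lambda>b c. M (take i (vars 1 r) @ (fst l, snd l + ysum b) # c) *
          N (sh (fst l) b))) (drop i (vars 1 r)) = (\<Sum>j\<le>r - i - 1. g (i, j))"
        by (simp add: take_vars cuts_def g_def length_vars)
    qed simp
    finally show ?thesis by (simp add: T_def sum.Sigma)
  qed
  ultimately show "anit B A r = wanit N M (vars 1 r)"
    by (simp add: anit_def S_def f_def)
qed

lemma represents_Qop: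
  assumes "represents A M"
  shows "represents (Qop A) (wQ M)"
  unfolding represents_def
proof (intro conjI allI natural_wQ representsD [OF assms])
  fix r
  have "xysum (vars 1 r) = (\<Sum>i=1..r. vX i * vY i)"
    by (simp add: xysum_def vars_def o_def sum_set_upt_conv_sum_list_nat [symmetric]
      atLeastLessThanSuc_atLeastAtMost del: upt_Suc)
  then show "Qop A r = wQ M (vars 1 r)" by (simp add: Qop_def wQ_def representsD(2) [OF assms])
qed

lemma represents_pic: "represents pic wpic"
  unfolding represents_def
proof (intro conjI allI natural_wpic)
  fix r
  show "pic r = wpic (vars 1 r)"
    by (simp add: pic_def wpic_def map_fst_vars Xs_def prod.distinct_set_conv_list [symmetric]
      atLeastLessThanSuc_atLeastAtMost del: upt_Suc)
qed

lemma gaps_vars: "gaps (vars a b) = (\<Prod>i=a..<b. vX i - vX (i + 1))"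
proof (induction "b - a" arbitrary: a)
  case (Suc n)
  then have "vars a b = (vX a, vY a) # (vX (Suc a), vY (Suc a)) # vars (Suc (Suc a)) b"
    by (simp add: vars_Cons)
  moreover have "gaps (vars (Suc a) b) = (\<Prod>i=Suc a..<b. vX i - vX (i + 1))"
    using Suc by simp
  moreover have "vars (Suc a) b = (vX (Suc a), vY (Suc a)) # vars (Suc (Suc a)) b"
    using Suc by (simp add: vars_Cons)
  ultimately show ?case
    using Suc by (simp add: prod.atLeast_Suc_lessThan)
next
  case 0
  then show ?case by (cases "a = b") (simp_all add: vars_Cons vars_empty)
qed

lemma represents_poc: "represents poc wpoc"
  unfolding represents_def
proof (intro conjI allI natural_wpoc)
  fix r
  show "poc r = wpoc (vars 1 r)"
  proof (cases "r = 0")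
    case False
    then have "vars 1 r = (vX 1, vY 1) # vars 2 r" using vars_Cons [of 1 r] by (simp add: numeral_2_eq_2)
    then show ?thesis using False gaps_vars [of 1 r] by (simp add: poc_def wpoc_def)
  qed (simp add: poc_def vars_empty)
qed

lemma represents_Ebim: "represents Ebim wE"
  unfolding represents_def
proof (intro conjI allI natural_wE)
  fix r
  show "Ebim r = wE (vars 1 r)"
    by (auto simp: Ebim_def wE_def length_vars vars_Cons)
qed

text \<open>
  Subdivisions of the interval from a to r, so that removing the first entry is an induction step.
\<close>

definition subdivs :: "nat \<Rightarrow> nat \<Rightarrow> nat list set" where
  "subdivs a r = {q. q \<noteq> [] \<and> hd q = a \<and> last q = r \<and> sorted_wrt (<) q}"

lemma subdivs_le: "q \<in> subdivs a r \<Longrightarrow> a \<le> r"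
  by (cases q) (auto simp: subdivs_def split: if_splits intro: less_imp_le)

lemma subdivs_self: "subdivs r r = {[r]}"
proof -
  have "q = [r]" if "q \<in> subdivs r r" for q
    using that by (cases q) (auto simp: subdivs_def split: if_splits)
  then show ?thesis by (auto simp: subdivs_def)
qed

lemma subdivs_rec: "a < r \<Longrightarrow> subdivs a r = (\<Union>b\<in>{a<..r}. (#) a ` subdivs b r)"
proof (intro equalityI subsetI)
  fix q assume "a < r" "q \<in> subdivs a r"
  then obtain b q' where q: "q = a # b # q'"
    by (cases q; cases "tl q") (auto simp: subdivs_def)
  then have "b # q' \<in> subdivs b r" "a < b" using \<open>q \<in> _\<close> by (auto simp: subdivs_def)
  then show "q \<in> (\<Union>b\<in>{a<..r}. (#) a ` subdivs b r)" using q subdivs_le by auto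
next
  fix q assume "a < r" "q \<in> (\<Union>b\<in>{a<..r}. (#) a ` subdivs b r)"
  then obtain b q' where q: "q = a # q'" "a < b" "q' \<in> subdivs b r" by auto
  then obtain q'' where "q' = b # q''" by (cases q') (auto simp: subdivs_def)
  then show "q \<in> subdivs a r" using q by (auto simp: subdivs_def)
qed

lemma finite_subdivs: "finite (subdivs a r)"
proof (induction "r - a" arbitrary: a rule: less_induct)
  case less
  consider "r < a" | "a = r" | "a < r" by linarith
  then show ?case
  proof cases
    case 1
    then have "subdivs a r = {}" using subdivs_le by fastforce
    then show ?thesis by simp
  next
    case 3
    then have "finite (subdivs b r)" if "b \<in> {a<..r}" for b using that by (intro less) auto
    then show ?thesis by (simp add: subdivs_rec [OF 3])
  qed (simp add: subdivs_self)
qed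

lemma sum_subdivs_rec:
  assumes "a < r"
  shows "sum f (subdivs a r) = (\<Sum>b\<in>{a<..r}. \<Sum>q\<in>subdivs b r. f (a # q))"
proof -
  have "sum f (subdivs a r) = (\<Sum>b\<in>{a<..r}. sum f ((#) a ` subdivs b r))"
    unfolding subdivs_rec [OF assms]
  proof (rule sum.UNION_disjoint)
    show "\<forall>b\<in>{a<..r}. finite ((#) a ` subdivs b r)" by (simp add: finite_subdivs)
  qed (auto simp: subdivs_def)
  then show ?thesis by (simp add: sum.reindex)
qed

definition block_term :: "ratfun wmould \<Rightarrow> ratfun wmould \<Rightarrow> nat list \<Rightarrow> ratfun" where
  "block_term N M q =
     M (map (\<lambda>(a, b). (vX (a + 1), Ysum (a + 1) b)) (zip q (tl q))) *
     prod_list (map (\<lambda>(a, b). N (sh (vX (a + 1)) (vars (a + 2) b))) (zip q (tl q)))"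

lemma sum_block_term: "a \<le> r \<Longrightarrow> sum (block_term N M) (subdivs a r) = wganit N M (vars (a + 1) r)"
proof (induction "r - a" arbitrary: a M rule: less_induct)
  case less
  show ?case
  proof (cases "a = r")
    case True
    then show ?thesis by (simp add: subdivs_self block_term_def vars_empty)
  next
    case False
    then have "a < r" using less.prems by simp
    let ?M = "\<lambda>b z. M ((vX (a + 1), Ysum (a + 1) b) # z)"
    have *: "block_term N M (a # q) = N (sh (vX (a + 1)) (vars (a + 2) b)) * block_term N (?M b) q"
      if "q \<in> subdivs b r" for q b
      using that by (cases q) (simp_all add: block_term_def subdivs_def)
    have Y: "Ysum (a + 1) b = vY (a + 1) + Ysum (a + 2) b" if "a < b" for b
      using that by (simp add: Ysum_def sum.atLeast_Suc_atMost)
    have "sum (block_term N M) (subdivs a r) =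
        (\<Sum>b\<in>{a<..r}. N (sh (vX (a + 1)) (vars (a + 2) b)) * wganit N (?M b) (vars (b + 1) r))"
      unfolding sum_subdivs_rec [OF \<open>a < r\<close>]
      by (rule sum.cong) (use less.hyps in \<open>auto simp: * simp flip: sum_distrib_left\<close>)
    also have "\<dots> = (\<Sum>i\<le>r - a - 1. N (sh (vX (a + 1)) (vars (a + 2) (a + 1 + i))) *
        wganit N (?M (a + 1 + i)) (vars (a + 2 + i) r))"
      by (rule sum.reindex_bij_witness [where i = "\<lambda>i. a + 1 + i" and j = "\<lambda>b. b - a - 1"])
        (use \<open>a < r\<close> in auto)
    also have "\<dots> = wganit N M (vars (a + 1) r)"
      using \<open>a < r\<close>
      by (simp add: vars_Cons [of "a + 1" r, simplified] wganit_Cons cuts_def length_vars take_vars drop_vars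
          ysum_vars Y [simplified])
    finally show ?thesis .
  qed
qed

lemma map_pairs: "map (\<lambda>i. F (q ! (i - 1)) (q ! i)) [1..<length q] = map (\<lambda>(a, b). F a b) (zip q (tl q))"
  by (rule nth_equalityI) (simp_all add: nth_tl)

lemma represents_ganit:
  assumes C: "represents C N" and A: "represents A M"
  shows "represents (ganit C A) (wganit N M)"
  unfolding represents_def
proof (intro conjI allI natural_wganit representsD [OF C] representsD [OF A])
  fix r
  show "ganit C A r = wganit N M (vars 1 r)"
  proof (cases "r = 0")
    case True
    then show ?thesis by (simp add: ganit_def representsD(2) [OF A] vars_empty)
  next
    case False
    have "ganit C A r = sum (block_term N M) (subdivs 0 r)"
      unfolding ganit_def using False
    proof (simp only: if_False, intro sum.cong)
      fix q assume "q \<in> subdivs 0 r"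
      then have q: "q \<noteq> []" "sorted_wrt (<) q" by (auto simp: subdivs_def)
      define s where "s = length q - 1"
      then have lq: "length q = s + 1" using q by (cases q) auto
      have lt: "q ! (i - 1) < q ! i" if "1 \<le> i" "i \<le> s" for i
        using sorted_wrt_nth_less [OF q(2), of "i - 1" i] that lq by simp
      let ?L = "\<lambda>i. (vX (q ! (i - 1) + 1), Ysum (q ! (i - 1) + 1) (q ! i))"
      have "i = j" if "i \<in> {1..<s + 1}" "j \<in> {1..<s + 1}" "q ! (i - 1) = q ! (j - 1)" for i j
      proof -
        have "i - 1 = j - 1"
          using that q(2) lq nth_eq_iff_index_eq [of q "i - 1" "j - 1"] by (auto simp: strict_sorted_iff)
        then show ?thesis using that by auto
      qed
      then have "distinct (map (\<lambda>i. vX (q ! (i - 1) + 1)) [1..<s + 1])"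
        unfolding distinct_map by (intro conjI distinct_upt inj_onI) (simp only: set_upt vX_eq_iff add_right_cancel)
      then have "generic (map ?L [1..<s + 1])"
        unfolding generic_def map_map o_def fst_conv set_map
        by (auto simp: vX_nonzero)
      then have 1: "(A s) \<langle>map (\<lambda>i. vX (q ! (i - 1) + 1)) [1..<s + 1] |
          map (\<lambda>i. Ysum (q ! (i - 1) + 1) (q ! i)) [1..<s + 1]\<rangle> = M (map ?L [1..<s + 1])"
        by (intro represents_subst [OF A]) (simp_all add: o_def del: upt_Suc)
      have 2: "(C (q ! i - q ! (i - 1) - 1))
          \<langle>map (\<lambda>j. vX j - vX (q ! (i - 1) + 1)) [q ! (i - 1) + 2..<q ! i + 1] |
             Ys (q ! (i - 1) + 2) (q ! i)\<rangle> =
          N (sh (vX (q ! (i - 1) + 1)) (vars (q ! (i - 1) + 2) (q ! i)))"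
        if "i \<in> {1..s}" for i
      proof (rule represents_subst [OF C])
        show "generic (sh (vX (q ! (i - 1) + 1)) (vars (q ! (i - 1) + 2) (q ! i)))"
          using generic_sh [of "(vX (q ! (i - 1) + 1), 0)"] generic_vars [of "q ! (i - 1) + 1" "q ! i"]
            lt [of i] that by (simp add: vars_Cons generic_def)
      qed (use lt [of i] that in \<open>simp_all add: length_vars map_fst_sh_vars map_snd_sh map_snd_vars\<close>)
      let ?F = "\<lambda>i. (C (q ! i - q ! (i - 1) - 1))
            \<langle>map (\<lambda>j. vX j - vX (q ! (i - 1) + 1)) [q ! (i - 1) + 2..<q ! i + 1] |
             Ys (q ! (i - 1) + 2) (q ! i)\<rangle>"
      let ?G = "\<lambda>i. N (sh (vX (q ! (i - 1) + 1)) (vars (q ! (i - 1) + 2) (q ! i)))"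
      have "prod ?F {1..s} = prod ?G {1..s}"
        by (rule prod.cong [OF refl 2])
      also have "\<dots> = prod_list (map ?G [1..<s + 1])"
        by (simp add: prod.distinct_set_conv_list [symmetric] atLeastLessThanSuc_atLeastAtMost del: upt_Suc)
      also have "map ?G [1..<s + 1] = map (\<lambda>(a, b). N (sh (vX (a + 1)) (vars (a + 2) b))) (zip q (tl q))"
        using map_pairs [of "\<lambda>a b. N (sh (vX (a + 1)) (vars (a + 2) b))" q] unfolding lq .
      finally have P: "prod ?F {1..s} =
        prod_list (map (\<lambda>(a, b). N (sh (vX (a + 1)) (vars (a + 2) b))) (zip q (tl q)))" .
      have "map ?L [1..<s + 1] = map (\<lambda>(a, b). (vX (a + 1), Ysum (a + 1) b)) (zip q (tl q))"
        using map_pairs [of "\<lambda>a b. (vX (a + 1), Ysum (a + 1) b)" q] unfolding lq .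
      then show "(let s = length q - 1 in
         (A s) \<langle>map (\<lambda>i. vX (q ! (i - 1) + 1)) [1..<s + 1] |
                map (\<lambda>i. Ysum (q ! (i - 1) + 1) (q ! i)) [1..<s + 1]\<rangle> * prod ?F {1..s}) = block_term N M q"
        unfolding s_def [symmetric] Let_def 1 P block_term_def by (rule arg_cong)
    qed (simp_all add: subdivisions_def subdivs_def)
    then show ?thesis by (simp add: sum_block_term)
  qed
qed

lemma Ddiff_eq_divdiff:
  assumes "distinct z" "length z = Suc r"
  shows "Ddiff r F z = divdiff F (set z)"
proof -
  have bij: "bij_betw ((!) z) {0..r} (set z)"
    using bij_betw_nth [OF assms(1), of "{0..r}" "set z"] assms
    by (auto simp: lessThan_Suc_atMost atLeast0AtMost)
  then have inj: "inj_on ((!) z) {0..r}" and im: "(!) z ` {0..r} = set z"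
    by (auto simp: bij_betw_def)
  have "bij_betw ((!) z) ({0..r} - {s}) (set z - {z ! s})" if "s \<in> {0..r}" for s
    using inj_on_image_set_diff [OF inj, of "{0..r}" "{s}"] that im
    by (auto simp: bij_betw_def intro: inj_on_subset [OF inj])
  then have "(\<Prod>k\<in>{0..r} - {s}. z ! k - z ! s) = (\<Prod>x\<in>set z - {z ! s}. x - z ! s)" if "s \<in> {0..r}" for s
    using prod.reindex_bij_betw [of "(!) z" "{0..r} - {s}" "set z - {z ! s}" "\<lambda>x. x - z ! s"] that by simp
  then have "Ddiff r F z = (\<Sum>s\<in>{0..r}. F (z ! s) / (\<Prod>x\<in>set z - {z ! s}. x - z ! s))"
    unfolding Ddiff_def by (intro sum.cong) auto
  also have "\<dots> = divdiff F (set z)"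
    unfolding divdiff_def
    by (rule sum.reindex_bij_betw [OF bij, of "\<lambda>y. F y / (\<Prod>x\<in>set z - {y}. x - y)"])
  finally show ?thesis .
qed

lemma generic_sh_vars:
  assumes "t = 0 \<or> (\<exists>i. t = vX i \<and> i \<notin> {a..b})"
  shows "generic (sh t (vars a b))"
proof -
  have "vX i \<noteq> t" if "i \<in> {a..b}" for i
    using assms that by (auto simp: vX_eq_iff vX_nonzero)
  then show ?thesis
    by (auto simp: generic_def sh_def vars_def o_def distinct_map inj_on_def vX_eq_iff simp del: upt_Suc)
qed

text \<open>
  The index r of \<open>Lterm\<close> and \<open>Rterm\<close> is one more than the length of the first factor of a cut, as
  the list of nodes contains the last or the first variable in addition.
\<close>

lemma represents_Cbim:
  assumes B: "represents B N" and N: "N [] = 0"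
  shows "represents (Cbim B) (wC N)"
  unfolding represents_def
proof (intro conjI allI natural_wC representsD [OF B] N)
  fix m
  have subst: "(B (m - r)) \<langle>map (\<lambda>j. vX j - t) [a..<b + 1] | Ys a b\<rangle> = N (sh t (vars a b))"
    if "m - r = Suc b - a" "t = 0 \<or> (\<exists>i. t = vX i \<and> i \<notin> {a..b})" for a b t r
    using that
    by (intro represents_subst [OF B] generic_sh_vars)
      (simp_all add: length_vars map_fst_sh_vars map_snd_sh map_snd_vars)
  have cong: "divdiff F S = divdiff G S" if "\<And>t. t \<in> S \<Longrightarrow> F t = G t" for F G and S :: "ratfun set"
    using that by (simp add: divdiff_def)
  have X: "set (Xs a b) = vX ` {a..b}" "distinct (Xs a b)" for a b
    by (auto simp: Xs_def distinct_map inj_on_def vX_eq_iff simp del: upt_Suc)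
  have length_Xs: "length (Xs a b) = Suc b - a" for a b
    by (simp add: Xs_def del: upt_Suc)
  have fv: "fst ` set (vars a b) = vX ` {a..b}" for a b
    by (simp only: set_map [symmetric] map_fst_vars X)
  have L: "Lterm m r B = divdiff (\<lambda>t. N (sh t (vars r (m - 1)))) ({0, vX m} \<union> fst ` set (vars 1 (r - 1)))"
    if r: "1 \<le> r" "r < m" for r
  proof -
    have "Lterm m r B = divdiff (\<lambda>t. (B (m - r)) \<langle>map (\<lambda>j. vX j - t) [r..<m] | Ys r (m - 1)\<rangle>)
        (set (0 # Xs 1 (r - 1) @ [vX m]))"
      unfolding Lterm_def
      by (rule Ddiff_eq_divdiff) (use r X in \<open>auto simp: vX_eq_iff vX_nonzero length_Xs\<close>)
    also have "\<dots> = divdiff (\<lambda>t. N (sh t (vars r (m - 1)))) (set (0 # Xs 1 (r - 1) @ [vX m]))"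
    proof (rule cong)
      fix t assume "t \<in> set (0 # Xs 1 (r - 1) @ [vX m])"
      then have "t = 0 \<or> (\<exists>i. t = vX i \<and> i \<notin> {r..m - 1})" using r X by fastforce
      then show "(B (m - r)) \<langle>map (\<lambda>j. vX j - t) [r..<m] | Ys r (m - 1)\<rangle> = N (sh t (vars r (m - 1)))"
        using subst [of r "m - 1" r t] r by simp
    qed
    also have "set (0 # Xs 1 (r - 1) @ [vX m]) = {0, vX m} \<union> fst ` set (vars 1 (r - 1))"
      by (auto simp: X fv)
    finally show ?thesis .
  qed
  have R: "Rterm m r B = divdiff (\<lambda>t. N (sh t (vars (r + 1) m))) ({0, vX 1} \<union> fst ` set (vars 2 r))"
    if r: "1 \<le> r" "r < m" for r
  proof -
    have "Rterm m r B = divdiff (\<lambda>t. (B (m - r)) \<langle>map (\<lambda>j. vX j - t) [r + 1..<m + 1] | Ys (r + 1) m\<rangle>)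
        (set (0 # Xs 1 r))"
      unfolding Rterm_def
      by (rule Ddiff_eq_divdiff) (use r X in \<open>auto simp: vX_eq_iff vX_nonzero length_Xs\<close>)
    also have "\<dots> = divdiff (\<lambda>t. N (sh t (vars (r + 1) m))) (set (0 # Xs 1 r))"
    proof (rule cong)
      fix t assume "t \<in> set (0 # Xs 1 r)"
      then have "t = 0 \<or> (\<exists>i. t = vX i \<and> i \<notin> {r + 1..m})" using r X by fastforce
      then show "(B (m - r)) \<langle>map (\<lambda>j. vX j - t) [r + 1..<m + 1] | Ys (r + 1) m\<rangle> = N (sh t (vars (r + 1) m))"
        using subst [of r m "r + 1" t] r by simp
    qed
    also have "{1..r} = insert 1 {2..r}" using r by auto
    then have "set (0 # Xs 1 r) = {0, vX 1} \<union> fst ` set (vars 2 r)"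
      by (auto simp: X fv)
    finally show ?thesis .
  qed
  show "Cbim B m = wC N (vars 1 m)"
  proof (cases "m \<le> 1")
    case True
    then have "vars 1 m = [] \<or> vars 1 m = [(vX 1, vY 1)]"
      by (cases "m = 0") (auto simp: vars_Cons vars_empty)
    then show ?thesis using True N by (auto simp: Cbim_def wC_def wL_def wR_def)
  next
    case False
    have b: "butlast (vars 1 m) = vars 1 (m - 1)" "last (vars 1 m) = (vX m, vY m)"
      using False by (cases m; simp add: vars_def butlast_append map_butlast [symmetric])+
    have h: "tl (vars 1 m) = vars 2 m" "hd (vars 1 m) = (vX 1, vY 1)"
      using False vars_Cons [of 1 m] by (simp_all add: numeral_2_eq_2)
    have "wL N (vars 1 m) = (\<Sum>i\<le>m - 1. divdiff (\<lambda>t. N (sh t (vars (i + 1) (m - 1))))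
        ({0, vX m} \<union> fst ` set (vars 1 i)))"
      unfolding wL_def cuts_def b by (rule sum.cong) (use False in \<open>auto simp: length_vars take_vars drop_vars\<close>)
    also have "\<dots> = (\<Sum>i\<in>{..<m - 1}. divdiff (\<lambda>t. N (sh t (vars (i + 1) (m - 1))))
        ({0, vX m} \<union> fst ` set (vars 1 i)))"
      by (simp add: lessThan_Suc_atMost [symmetric] vars_empty N)
    also have "\<dots> = (\<Sum>r=1..m - 1. Lterm m r B)"
      by (rule sum.reindex_bij_witness [where i = "\<lambda>r. r - 1" and j = "\<lambda>i. i + 1"])
        (auto simp: L)
    finally have wL: "wL N (vars 1 m) = (\<Sum>r=1..m - 1. Lterm m r B)" .
    have "wR N (vars 1 m) = (\<Sum>i\<le>m - 1. divdiff (\<lambda>t. N (sh t (vars (i + 2) m)))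
        ({0, vX 1} \<union> fst ` set (vars 2 (i + 1))))"
      unfolding wR_def cuts_def h by (rule sum.cong) (use False in \<open>auto simp: length_vars take_vars drop_vars\<close>)
    also have "\<dots> = (\<Sum>i\<in>{..<m - 1}. divdiff (\<lambda>t. N (sh t (vars (i + 2) m)))
        ({0, vX 1} \<union> fst ` set (vars 2 (i + 1))))"
      using False by (cases m) (simp_all add: lessThan_Suc_atMost [symmetric] vars_empty N)
    also have "\<dots> = (\<Sum>r=1..m - 1. Rterm m r B)"
      by (rule sum.reindex_bij_witness [where i = "\<lambda>r. r - 1" and j = "\<lambda>i. i + 1"])
        (auto simp: R)
    finally show ?thesis using False wL by (simp add: Cbim_def wC_def sum_subtractf)
  qed
qed

section \<open>Polynomial bimoulds\<close>

lemma var_power: "var n ^ k = Fract (Poly_Mapping.single (Poly_Mapping.single n k) 1) 1"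
proof (induction k)
  case 0
  then show ?case using const_1 by (simp add: const_def)
next
  case (Suc k)
  then show ?case by (simp add: var_def mult_single flip: single_add)
qed

lemma monom_subst_var: "monom_subst var m = Fract (Poly_Mapping.single m 1) 1"
proof (induction m rule: update_induct)
  case const
  then show ?case using const_1 by (simp add: const_def monom_subst_def)
next
  case (update f a b)
  have "Poly_Mapping.update a b f = Poly_Mapping.single a b + f"
    using update by (intro poly_mapping_eqI)
      (auto simp: lookup_update lookup_add lookup_single in_keys_iff when_def)
  moreover have "monom_subst var (Poly_Mapping.single a b) = var a ^ b"
    using update by (simp add: monom_subst_def)
  ultimately show ?case
    using update by (simp add: monom_subst_add var_power mult_single)
qed

text \<open>
  Every polynomial is its own value at the variables.
\<close>

lemma poly_subst_var: "poly_subst var p = Fract p 1"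
proof (induction p rule: qpoly_induct)
  case zero
  then show ?case by (simp add: poly_subst_0 Zero_fract_def)
next
  case (single_add m c p)
  then show ?case
    by (simp add: poly_subst_add poly_subst_single monom_subst_var const_def mult_single)
qed

definition depth_vars :: "nat \<Rightarrow> nat set" where
  "depth_vars r = (\<Union>i\<in>{1..r}. {2 * i, 2 * i + 1})"

definition wpoly :: "(nat \<Rightarrow> qpoly) \<Rightarrow> ratfun wmould" where
  "wpoly p w = poly_subst (args (map fst w) (map snd w)) (p (length w))"

lemma args_eq:
  assumes "i \<in> {1..length w}"
  shows "args (map fst w) (map snd w) (2 * i) = fst (w ! (i - 1))"
    "args (map fst w) (map snd w) (2 * i + 1) = snd (w ! (i - 1))"
  using assms by (auto simp: args_def)

lemma natural_wpoly: "natural (wpoly p)"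
  unfolding natural_def
proof (intro allI impI)
  fix \<sigma> w w'
  assume w: "wspec \<sigma> w w'"
  have "spec \<sigma> (args (map fst w) (map snd w) n) (args (map fst w') (map snd w') n)" for n
  proof -
    have "rel_prod (spec \<sigma>) (spec \<sigma>) (w ! i) (w' ! i)" if "i < length w" for i
      using w that unfolding wspec_def by (rule list_all2_nthD)
    then show ?thesis
      by (auto simp: args_def Let_def wspec_length [OF w] spec_0 rel_prod_sel)
  qed
  then show "spec \<sigma> (wpoly p w) (wpoly p w')"
    unfolding wpoly_def wspec_length [OF w] by (rule spec_poly_subst)
qed

lemma represents_wpoly:
  assumes "\<And>r. A r = Fract (p r) 1"
    and "\<And>r m. m \<in> Poly_Mapping.keys (p r) \<Longrightarrow> Poly_Mapping.keys m \<subseteq> depth_vars r"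
  shows "represents A (wpoly p)"
  unfolding represents_def
proof (intro conjI allI natural_wpoly)
  fix r
  have "args (map fst (vars 1 r)) (map snd (vars 1 r)) v = var v" if v: "v \<in> depth_vars r" for v
  proof -
    obtain i where i: "i \<in> {1..r}" "v = 2 * i \<or> v = 2 * i + 1"
      using v unfolding depth_vars_def by blast
    then have "i - 1 < length [1..<Suc r]" "[1..<Suc r] ! (i - 1) = i"
      by (auto simp del: upt_Suc)
    then have "vars 1 r ! (i - 1) = (vX i, vY i)"
      unfolding vars_def by (simp only: nth_map)
    then show ?thesis
      using i args_eq [of i "vars 1 r"] by (auto simp: length_vars vX_def vY_def)
  qed
  then have "monom_subst (args (map fst (vars 1 r)) (map snd (vars 1 r))) m = monom_subst var m"
    if "m \<in> Poly_Mapping.keys (p r)" for m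
    using assms(2) [OF that] unfolding monom_subst_def by (intro prod.cong) auto
  then have "wpoly p (vars 1 r) = poly_subst var (p r)"
    by (simp add: wpoly_def length_vars poly_subst_def cong: sum.cong)
  then show "A r = wpoly p (vars 1 r)" by (simp add: poly_subst_var assms(1))
qed

lemma mu_generated_sum:
  "finite I \<Longrightarrow> (\<And>i. i \<in> I \<Longrightarrow> mu_generated (F i)) \<Longrightarrow> mu_generated (\<lambda>w. \<Sum>i\<in>I. F i w)"
proof (induction I rule: finite_induct)
  case empty
  have "headed (\<lambda>x y. 0) unit = (\<lambda>w. 0 :: 'b)"
  proof
    fix w show "headed (\<lambda>x y. 0) unit w = (0 :: 'b)" by (cases w) simp_all
  qed
  then show ?case using mu_generated.letter [of "\<lambda>x y. 0 :: 'b"] by simp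
next
  case (insert i I)
  then show ?case by (simp add: mu_generated.add)
qed

text \<open>
  A product of functions of the single letters is the mu-product of bimoulds of depth 1.
\<close>

lemma mu_generated_product:
  "mu_generated (\<lambda>w. if length w = Suc n then \<Prod>i<Suc n. f i (fst (w ! i)) (snd (w ! i)) else 0)"
proof (induction n arbitrary: f)
  case 0
  have "(\<lambda>w. if length w = Suc 0 then \<Prod>i<Suc 0. f i (fst (w ! i)) (snd (w ! i)) else 0) =
      headed (f 0) unit"
  proof
    fix w :: "'a word"
    show "(if length w = Suc 0 then \<Prod>i<Suc 0. f i (fst (w ! i)) (snd (w ! i)) else 0) =
      headed (f 0) unit w"
      by (cases w) (auto simp: unit_def)
  qed
  then show ?case by (simp only: mu_generated.letter)
next
  case (Suc n)
  let ?N = "\<lambda>w. if length w = Suc n then \<Prod>i<Suc n. f (Suc i) (fst (w ! i)) (snd (w ! i)) else 0"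
  have "(\<lambda>w. if length w = Suc (Suc n) then \<Prod>i<Suc (Suc n). f i (fst (w ! i)) (snd (w ! i)) else 0) =
      wmu (headed (f 0) unit) ?N"
  proof
    fix w :: "'a word"
    show "(if length w = Suc (Suc n) then \<Prod>i<Suc (Suc n). f i (fst (w ! i)) (snd (w ! i)) else 0) =
      wmu (headed (f 0) unit) ?N w"
    proof (cases w)
      case Nil
      then show ?thesis by (simp add: wmu_def)
    next
      case (Cons l v)
      then show ?thesis
        unfolding Cons wmu_letter_left by (simp add: prod.lessThan_Suc_shift del: prod.lessThan_Suc)
    qed
  qed
  then show ?case using mu_generated.mu [OF mu_generated.letter Suc.IH] by (simp only:)
qed

lemma mu_generated_wpoly:
  assumes "\<And>r. A r = Fract (p r) 1"
    and vars: "\<And>r m. m \<in> Poly_Mapping.keys (p r) \<Longrightarrow> Poly_Mapping.keys m \<subseteq> depth_vars r"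
    and "A 0 = 0" "finite {r. A r \<noteq> 0}"
  shows "mu_generated (wpoly p)"
proof -
  define T where "T = (\<lambda>n m w. if length w = n then const (Poly_Mapping.lookup (p n) m) *
      (\<Prod>i<n. fst (w ! i) ^ Poly_Mapping.lookup m (2 * (i + 1)) *
        snd (w ! i) ^ Poly_Mapping.lookup m (2 * (i + 1) + 1)) else 0)"
  have "mu_generated (T n m)" if "A n \<noteq> 0" for n m
  proof -
    have "n \<noteq> 0" using that assms(3) by (cases n) auto
    then obtain k where k: "n = Suc k" by (cases n) auto
    define g where "g = (\<lambda>i x y. (if i = 0 then const (Poly_Mapping.lookup (p n) m) else 1) *
        (x ^ Poly_Mapping.lookup m (2 * (i + 1)) * y ^ Poly_Mapping.lookup m (2 * (i + 1) + 1)))"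
    have "T n m = (\<lambda>w. if length w = Suc k then \<Prod>i<Suc k. g i (fst (w ! i)) (snd (w ! i)) else 0)"
      by (simp add: T_def g_def k fun_eq_iff prod.lessThan_Suc_shift mult.assoc del: prod.lessThan_Suc)
    then show ?thesis by (simp only: mu_generated_product)
  qed
  then have "mu_generated (\<lambda>w. \<Sum>n\<in>{r. A r \<noteq> 0}. \<Sum>m\<in>Poly_Mapping.keys (p n). T n m w)"
    by (intro mu_generated_sum assms finite_keys) auto
  also have "(\<lambda>w. \<Sum>n\<in>{r. A r \<noteq> 0}. \<Sum>m\<in>Poly_Mapping.keys (p n). T n m w) = wpoly p"
  proof
    fix w :: "ratfun word"
    let ?n = "length w" and ?\<sigma> = "args (map fst w) (map snd w)"
    have "monom_subst ?\<sigma> m = (\<Prod>i<?n. fst (w ! i) ^ Poly_Mapping.lookup m (2 * (i + 1)) *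
        snd (w ! i) ^ Poly_Mapping.lookup m (2 * (i + 1) + 1))"
      if "m \<in> Poly_Mapping.keys (p ?n)" for m
    proof -
      have "monom_subst ?\<sigma> m = (\<Prod>v\<in>depth_vars ?n. ?\<sigma> v ^ Poly_Mapping.lookup m v)"
        using vars [OF that] by (intro monom_subst_superset) (auto simp: depth_vars_def)
      also have "\<dots> = (\<Prod>i\<in>{1..?n}. \<Prod>v\<in>{2 * i, 2 * i + 1}. ?\<sigma> v ^ Poly_Mapping.lookup m v)"
        unfolding depth_vars_def by (rule prod.UNION_disjoint) auto
      also have "\<dots> = (\<Prod>i\<in>{1..?n}. fst (w ! (i - 1)) ^ Poly_Mapping.lookup m (2 * i) *
          snd (w ! (i - 1)) ^ Poly_Mapping.lookup m (2 * i + 1))"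
        by (rule prod.cong) (simp_all add: args_eq [simplified])
      also have "\<dots> = (\<Prod>i<?n. fst (w ! i) ^ Poly_Mapping.lookup m (2 * (i + 1)) *
          snd (w ! i) ^ Poly_Mapping.lookup m (2 * (i + 1) + 1))"
        by (rule prod.reindex_bij_witness [where i = "\<lambda>i. i + 1" and j = "\<lambda>i. i - 1"]) auto
      finally show ?thesis .
    qed
    then have wp: "wpoly p w = (\<Sum>m\<in>Poly_Mapping.keys (p ?n). T ?n m w)"
      unfolding wpoly_def poly_subst_def by (intro sum.cong) (simp_all add: T_def)
    show "(\<Sum>n\<in>{r. A r \<noteq> 0}. \<Sum>m\<in>Poly_Mapping.keys (p n). T n m w) = wpoly p w"
    proof (cases "A ?n = 0")
      case True
      then have "p ?n = 0" using assms(1) [of ?n] by (simp add: eq_fract Zero_fract_def)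
      then have "wpoly p w = 0" by (simp add: wpoly_def poly_subst_0)
      moreover have "T n m w = 0" if "A n \<noteq> 0" for n m
        using that True by (auto simp: T_def)
      ultimately show ?thesis by simp
    next
      case False
      have "(\<Sum>n\<in>{r. A r \<noteq> 0}. \<Sum>m\<in>Poly_Mapping.keys (p n). T n m w) =
          (\<Sum>n\<in>{?n}. \<Sum>m\<in>Poly_Mapping.keys (p n). T n m w)"
        by (rule sum.mono_neutral_right) (use assms False in \<open>auto simp: T_def\<close>)
      then show ?thesis by (simp add: wp)
    qed
  qed
  finally show ?thesis .
qed

section \<open>The operator delta BvI\<close>

text \<open>
  These keep track of the letter that remains after a merger; they serve to iterate \<open>phi_plus\<close> and
  \<open>phi_minus\<close>.
\<close>

definition wphi_plus :: "nat \<Rightarrow> 'k::field wmould \<Rightarrow> 'k wmould" where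
  "wphi_plus i M w = (if 1 \<le> i \<and> i < length w
     then M (take (i - 1) w @ (fst (w ! i), snd (w ! (i - 1)) + snd (w ! i)) # drop (i + 1) w)
     else if 1 \<le> i \<and> i = length w then M (butlast w) else 0)"

definition wphi_minus :: "nat \<Rightarrow> 'k::field wmould \<Rightarrow> 'k wmould" where
  "wphi_minus i M w = (if 2 \<le> i \<and> i \<le> length w
     then M (take (i - 2) w @ (fst (w ! (i - 2)), snd (w ! (i - 2)) + snd (w ! (i - 1))) # drop i w)
     else 0)"

lemma wphi_plus_append: "i = Suc (length u) \<Longrightarrow>
    wphi_plus i M (u @ k # l # v) = M (u @ (fst l, snd k + snd l) # v)"
  "i = Suc (length u) \<Longrightarrow> wphi_plus i M (u @ [k]) = M u"
  by (simp_all add: wphi_plus_def nth_append)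

lemma wphi_minus_append: "i = Suc (Suc (length u)) \<Longrightarrow>
    wphi_minus i M (u @ k # l # v) = M (u @ (fst k, snd k + snd l) # v)"
  by (simp add: wphi_minus_def nth_append)

lemma wspec_take: "wspec \<sigma> w w' \<Longrightarrow> wspec \<sigma> (take i w) (take i w')"
  and wspec_drop: "wspec \<sigma> w w' \<Longrightarrow> wspec \<sigma> (drop i w) (drop i w')"
  by (simp_all add: wspec_def list_all2_takeI list_all2_dropI)

lemma wspec_nth: "wspec \<sigma> w w' \<Longrightarrow> i < length w \<Longrightarrow>
    spec \<sigma> (fst (w ! i)) (fst (w' ! i)) \<and> spec \<sigma> (snd (w ! i)) (snd (w' ! i))"
  unfolding wspec_def by (auto dest: list_all2_nthD simp: rel_prod_sel)

lemma split_two: "Suc i < length w \<Longrightarrow> w = take i w @ w ! i # w ! Suc i # drop (Suc (Suc i)) w"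
  by (simp add: Cons_nth_drop_Suc)

lemma natural_wphi_plus:
  assumes "natural M"
  shows "natural (wphi_plus i M)"
  unfolding natural_def
proof (intro allI impI)
  fix \<sigma> w w'
  assume w: "wspec \<sigma> w w'" "generic w'"
  note len = wspec_length [OF w(1)]
  have "generic (take (i - 1) w' @ (fst (w' ! i), s) # drop (i + 1) w')" if "1 \<le> i" "i < length w'" for s
    using split_two [of "i - 1" w'] w(2) that
      generic_flexion(1) [of "take (i - 1) w'" "[w' ! (i - 1)]" "w' ! i" "drop (i + 1) w'"] by simp
  moreover have "generic (butlast w')"
    using w(2) by (simp add: generic_def distinct_butlast map_butlast) (auto dest: in_set_butlastD)
  ultimately show "spec \<sigma> (wphi_plus i M w) (wphi_plus i M w')"
    unfolding wphi_plus_def len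
    using w wspec_nth [OF w(1)] len
    by (auto intro!: naturalD [OF assms] wspec_append spec_add wspec_butlast spec_0 wspec_take
        wspec_drop)
qed

lemma natural_wphi_minus:
  assumes "natural M"
  shows "natural (wphi_minus i M)"
  unfolding natural_def
proof (intro allI impI)
  fix \<sigma> w w'
  assume w: "wspec \<sigma> w w'" "generic w'"
  note len = wspec_length [OF w(1)]
  have "generic (take (i - 2) w' @ (fst (w' ! (i - 2)), s) # drop i w')" if "2 \<le> i" "i \<le> length w'" for s
    using split_two [of "i - 2" w'] w(2) that
      generic_flexion(2) [of "take (i - 2) w'" "w' ! (i - 2)" "[w' ! (i - 1)]" "drop i w'"]
    by (simp add: numeral_2_eq_2 Suc_diff_Suc)
  then show "spec \<sigma> (wphi_minus i M w) (wphi_minus i M w')"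
    unfolding wphi_minus_def len
    using w wspec_nth [OF w(1)] len
    by (auto intro!: naturalD [OF assms] wspec_append spec_add spec_0 wspec_take wspec_drop)
qed

lemma represents_phi_plus:
  assumes A: "represents A M"
  shows "represents (phi_plus i A) (wphi_plus i M)"
  unfolding represents_def
proof (intro conjI allI natural_wphi_plus representsD [OF A])
  fix r
  consider "i < 1 \<or> r < i" | "1 \<le> i" "i < r" | "1 \<le> i" "i = r" by linarith
  then show "phi_plus i A r = wphi_plus i M (vars 1 r)"
  proof cases
    case 1
    then show ?thesis by (auto simp: phi_plus_def wphi_plus_def length_vars)
  next
    case 2
    let ?w = "vars 1 (i - 1) @ (vX (i + 1), vY i + vY (i + 1)) # vars (i + 2) r"
    have split: "vars 1 r = vars 1 (i - 1) @ (vX i, vY i) # (vX (i + 1), vY (i + 1)) # vars (i + 2) r"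
      using 2 vars_append [of i 1 r] vars_Cons [of i r] vars_Cons [of "i + 1" r] by simp
    have "generic (vars 1 (i - 1) @ [(vX i, vY i)] @ (vX (i + 1), vY (i + 1)) # vars (i + 2) r)"
      using generic_vars [of 1 r] split by simp
    then have "generic ?w"
      using generic_flexion(1) [of "vars 1 (i - 1)" "[(vX i, vY i)]" "(vX (i + 1), vY (i + 1))"] by simp
    moreover have "Xs (i + 1) r = vX (i + 1) # Xs (i + 2) r"
      using 2 vars_Cons [of "i + 1" r] by (simp flip: map_fst_vars)
    ultimately have "phi_plus i A r = M ?w"
      using 2 unfolding phi_plus_def
      by (simp, intro represents_subst [OF A])
        (simp_all add: pX_def cY_def length_vars map_fst_vars map_snd_vars)
    then show ?thesis unfolding split using 2 by (subst wphi_plus_append) (simp_all add: length_vars)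
  next
    case 3
    then have split: "vars 1 r = vars 1 (r - 1) @ [(vX r, vY r)]"
      using vars_append [of r 1 r] vars_Cons [of r r] by (simp add: vars_empty)
    have "Xs (r + 1) r = []" by (simp add: Xs_def)
    then have "phi_plus i A r = M (vars 1 (r - 1))"
      using 3 unfolding phi_plus_def
      by (simp, intro represents_subst [OF A])
        (simp_all add: pX_def cY_def length_vars map_fst_vars map_snd_vars generic_vars)
    then show ?thesis unfolding split using 3 by (subst wphi_plus_append) (simp_all add: length_vars)
  qed
qed

lemma represents_phi_minus:
  assumes A: "represents A M"
  shows "represents (phi_minus i A) (wphi_minus i M)"
  unfolding represents_def
proof (intro conjI allI natural_wphi_minus representsD [OF A])
  fix r
  show "phi_minus i A r = wphi_minus i M (vars 1 r)"
  proof (cases "2 \<le> i \<and> i \<le> r")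
    case False
    then show ?thesis by (auto simp: phi_minus_def wphi_minus_def length_vars)
  next
    case True
    then obtain a where a: "i = Suc a" "1 \<le> a" "a < r" by (cases i) auto
    let ?w = "vars 1 (a - 1) @ (vX a, vY a + vY (a + 1)) # vars (a + 2) r"
    have split: "vars 1 r = vars 1 (a - 1) @ (vX a, vY a) # (vX (a + 1), vY (a + 1)) # vars (a + 2) r"
      using a vars_append [of a 1 r] vars_Cons [of a r] vars_Cons [of "a + 1" r] by simp
    have "generic (vars 1 (a - 1) @ (vX a, vY a) # [(vX (a + 1), vY (a + 1))] @ vars (a + 2) r)"
      using generic_vars [of 1 r] split by simp
    then have "generic ?w"
      using generic_flexion(2) [of "vars 1 (a - 1)" "(vX a, vY a)" "[(vX (a + 1), vY (a + 1))]"] by simp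
    moreover have "Xs 1 a = Xs 1 (a - 1) @ [vX a]"
      using a by (simp add: Xs_def upt_Suc_append)
    ultimately have "phi_minus i A r = M ?w"
      using a unfolding phi_minus_def
      by (simp, intro represents_subst [OF A])
        (simp_all add: pX_def cY_def length_vars map_fst_vars map_snd_vars)
    then show ?thesis unfolding split using a by (subst wphi_minus_append) (simp_all add: length_vars)
  qed
qed

lemma zero_subst [simp]: "0 \<langle>xs | ys\<rangle> = 0"
  unfolding subst_def by (rule spec_rat_subst [OF spec_0])

text \<open>
  For bimoulds such as E, which vanish outside depth 1 and 2, the sums in amit and anit reduce to
  neighbours at distance one and two.
\<close>

lemma sum_near_pairs:
  fixes f :: "nat \<times> nat \<Rightarrow> 'b::comm_monoid_add"
  assumes "\<And>a b. 1 \<le> a \<Longrightarrow> a < b \<Longrightarrow> b \<le> r \<Longrightarrow> b - a \<noteq> 1 \<Longrightarrow> b - a \<noteq> 2 \<Longrightarrow> f (a, b) = 0"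
  shows "sum f {(a, b). 1 \<le> a \<and> a < b \<and> b \<le> r} =
    (\<Sum>a=1..r - 1. f (a, a + 1)) + (\<Sum>a=1..r - 2. f (a, a + 2))"
proof -
  let ?S = "{(a, b). 1 \<le> a \<and> a < b \<and> b \<le> r}"
  let ?P = "(\<lambda>a. (a, a + 1)) ` {1..r - 1}" and ?Q = "(\<lambda>a. (a, a + 2)) ` {1..r - 2}"
  have "finite ?S" by (rule finite_subset [of _ "{1..r} \<times> {1..r}"]) auto
  moreover have "?P \<union> ?Q \<subseteq> ?S" by auto
  moreover have "\<forall>p\<in>?S - (?P \<union> ?Q). f p = 0"
  proof
    fix p assume p: "p \<in> ?S - (?P \<union> ?Q)"
    obtain a b where ab: "p = (a, b)" by (cases p)
    have "b - a \<noteq> 1"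
    proof
      assume "b - a = 1"
      then have "p = (a, a + 1)" "a \<in> {1..r - 1}" using p ab by auto
      then show False using p by blast
    qed
    moreover have "b - a \<noteq> 2"
    proof
      assume "b - a = 2"
      then have "p = (a, a + 2)" "a \<in> {1..r - 2}" using p ab by auto
      then show False using p by blast
    qed
    ultimately show "f p = 0" using p assms [of a b] ab by auto
  qed
  ultimately have "sum f ?S = sum f (?P \<union> ?Q)" by (rule sum.mono_neutral_right)
  also have "\<dots> = sum f ?P + sum f ?Q" by (rule sum.union_disjoint) auto
  finally show ?thesis by (simp add: sum.reindex inj_on_def)
qed

lemma Ebim_subst1: "x \<noteq> 0 \<Longrightarrow> (Ebim 1) \<langle>[x] | [y]\<rangle> = - (x + y) / 2"
  by (subst represents_subst [OF represents_Ebim, of "[(x, y)]"]) (simp_all add: generic_def)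

lemma Ebim_subst2: "x \<noteq> 0 \<Longrightarrow> x' \<noteq> 0 \<Longrightarrow> x \<noteq> x' \<Longrightarrow> (Ebim 2) \<langle>[x, x'] | [y, y']\<rangle> = 1 / 4"
  by (subst represents_subst [OF represents_Ebim, of "[(x, y), (x', y')]"]) (auto simp: generic_def)

lemma phi_plus_square:
  assumes A: "represents A M" and a: "1 \<le> a" "a + 2 \<le> r"
  shows "(A (r - 2)) \<langle>Xs 1 (a - 1) @ Xs (a + 2) r | Ys 1 (a - 1) @ Ysum a (a + 2) # Ys (a + 3) r\<rangle>
    = (phi_plus a ^^ 2) A r"
proof -
  let ?u = "vars 1 (a - 1)" and ?v = "vars (a + 3) r"
  have split: "vars 1 r = ?u @ (vX a, vY a) # (vX (a + 1), vY (a + 1)) # (vX (a + 2), vY (a + 2)) # ?v"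
    using a vars_append [of a 1 r] vars_Cons [of a r] vars_Cons [of "a + 1" r] vars_Cons [of "a + 2" r]
    by (simp add: numeral_3_eq_3)
  have Y: "Ysum a (a + 2) = vY a + vY (a + 1) + vY (a + 2)"
    by (simp add: Ysum_def numeral_2_eq_2)
  have X: "Xs (a + 2) r = vX (a + 2) # Xs (a + 3) r"
    using a vars_Cons [of "a + 2" r] by (simp add: numeral_3_eq_3 flip: map_fst_vars)
  have "generic (?u @ [(vX a, vY a), (vX (a + 1), vY (a + 1))] @ (vX (a + 2), vY (a + 2)) # ?v)"
    using generic_vars [of 1 r] split by simp
  then have "generic (?u @ (vX (a + 2), Ysum a (a + 2)) # ?v)"
    by (rule generic_flexion(1) [where l = "(vX (a + 2), vY (a + 2))", simplified fst_conv])
  then have "(A (r - 2)) \<langle>Xs 1 (a - 1) @ Xs (a + 2) r | Ys 1 (a - 1) @ Ysum a (a + 2) # Ys (a + 3) r\<rangle>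
      = M (?u @ (vX (a + 2), Ysum a (a + 2)) # ?v)"
    using a by (intro represents_subst [OF A]) (simp_all add: length_vars map_fst_vars map_snd_vars X [simplified])
  moreover have "(phi_plus a ^^ 2) A r = wphi_plus a (wphi_plus a M) (vars 1 r)"
    using representsD(2) [OF represents_phi_plus [OF represents_phi_plus [OF A]]]
    by (simp add: numeral_2_eq_2)
  moreover have "wphi_plus a (wphi_plus a M) (vars 1 r) = M (?u @ (vX (a + 2), Ysum a (a + 2)) # ?v)"
    unfolding split using a
    by (subst wphi_plus_append, simp add: length_vars, subst wphi_plus_append)
      (simp_all add: length_vars Y [simplified])
  ultimately show ?thesis by simp
qed

lemma phi_plus_square_last:
  assumes A: "represents A M" and r: "2 \<le> r"
  shows "(A (r - 2)) \<langle>Xs 1 (r - 2) | Ys 1 (r - 2)\<rangle> = (phi_plus (r - 1) ^^ 2) A r"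
proof -
  obtain k where k: "r = k + 2" using r by (metis add.commute le_Suc_ex)
  have split: "vars 1 r = vars 1 k @ [(vX (k + 1), vY (k + 1)), (vX (k + 2), vY (k + 2))]"
    using vars_append [of "k + 1" 1 r] vars_Cons [of "k + 1" r] vars_Cons [of "k + 2" r]
    by (simp add: k vars_empty)
  have "(phi_plus (r - 1) ^^ 2) A r = wphi_plus (r - 1) (wphi_plus (r - 1) M) (vars 1 r)"
    using representsD(2) [OF represents_phi_plus [OF represents_phi_plus [OF A]]]
    by (simp add: numeral_2_eq_2)
  also have "\<dots> = M (vars 1 k)"
    unfolding split
    by (subst wphi_plus_append, simp add: k length_vars, subst wphi_plus_append(2))
      (simp_all add: length_vars k)
  also have "\<dots> = (A (r - 2)) \<langle>Xs 1 (r - 2) | Ys 1 (r - 2)\<rangle>"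
    by (rule represents_subst [OF A, symmetric])
      (simp_all add: k generic_vars length_vars map_fst_vars map_snd_vars)
  finally show ?thesis by simp
qed

lemma phi_minus_square:
  assumes A: "represents A M" and a: "1 \<le> a" "a + 2 \<le> r"
  shows "(A (r - 2)) \<langle>Xs 1 a @ Xs (a + 3) r | Ys 1 (a - 1) @ Ysum a (a + 2) # Ys (a + 3) r\<rangle>
    = (phi_minus (a + 1) ^^ 2) A r"
proof -
  let ?u = "vars 1 (a - 1)" and ?v = "vars (a + 3) r"
  have split: "vars 1 r = ?u @ (vX a, vY a) # (vX (a + 1), vY (a + 1)) # (vX (a + 2), vY (a + 2)) # ?v"
    using a vars_append [of a 1 r] vars_Cons [of a r] vars_Cons [of "a + 1" r] vars_Cons [of "a + 2" r]
    by (simp add: numeral_3_eq_3)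
  have Y: "Ysum a (a + 2) = vY a + vY (a + 1) + vY (a + 2)"
    by (simp add: Ysum_def numeral_2_eq_2)
  have X: "Xs 1 a = Xs 1 (a - 1) @ [vX a]"
    using a by (simp add: Xs_def upt_Suc_append)
  have "generic (?u @ (vX a, vY a) # [(vX (a + 1), vY (a + 1)), (vX (a + 2), vY (a + 2))] @ ?v)"
    using generic_vars [of 1 r] split by simp
  then have "generic (?u @ (vX a, Ysum a (a + 2)) # ?v)"
    by (rule generic_flexion(2) [where l = "(vX a, vY a)", simplified fst_conv])
  then have "(A (r - 2)) \<langle>Xs 1 a @ Xs (a + 3) r | Ys 1 (a - 1) @ Ysum a (a + 2) # Ys (a + 3) r\<rangle>
      = M (?u @ (vX a, Ysum a (a + 2)) # ?v)"
    using a by (intro represents_subst [OF A])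
      (simp_all add: length_vars map_fst_vars map_snd_vars X [unfolded One_nat_def])
  moreover have "(phi_minus (a + 1) ^^ 2) A r = wphi_minus (a + 1) (wphi_minus (a + 1) M) (vars 1 r)"
    using representsD(2) [OF represents_phi_minus [OF represents_phi_minus [OF A]]]
    by (simp add: numeral_2_eq_2)
  moreover have "wphi_minus (a + 1) (wphi_minus (a + 1) M) (vars 1 r) = M (?u @ (vX a, Ysum a (a + 2)) # ?v)"
    unfolding split using a
    by (subst wphi_minus_append, simp add: length_vars, subst wphi_minus_append)
      (simp_all add: length_vars Y [simplified])
  ultimately show ?thesis by simp
qed

lemma amit_Ebim:
  assumes A: "represents A M"
  shows "amit Ebim A r = (\<Sum>a=1..r - 1. phi_plus a A r * (- (vX a - vX (a + 1) + vY a) / 2))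
    + (\<Sum>a=1..r - 2. (phi_plus a ^^ 2) A r * (1 / 4))"
  unfolding amit_def
proof (subst sum_near_pairs)
  fix a b assume "1 \<le> a" "a < b" "b \<le> r" "b - a \<noteq> 1" "b - a \<noteq> 2"
  then have "Ebim (b - a) = 0" by (simp add: Ebim_def)
  then show "(case (a, b) of (a, b) \<Rightarrow>
      (A (r - (b - a))) \<langle>Xs 1 (a - 1) @ Xs b r | Ys 1 (a - 1) @ Ysum a b # Ys (b + 1) r\<rangle> *
      (Ebim (b - a)) \<langle>map (\<lambda>j. vX j - vX b) [a..<b] | Ys a (b - 1)\<rangle>) = 0"
    by simp
next
  show "(\<Sum>a=1..r - 1. case (a, a + 1) of (a, b) \<Rightarrow>
      (A (r - (b - a))) \<langle>Xs 1 (a - 1) @ Xs b r | Ys 1 (a - 1) @ Ysum a b # Ys (b + 1) r\<rangle> *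
      (Ebim (b - a)) \<langle>map (\<lambda>j. vX j - vX b) [a..<b] | Ys a (b - 1)\<rangle>) +
    (\<Sum>a=1..r - 2. case (a, a + 2) of (a, b) \<Rightarrow>
      (A (r - (b - a))) \<langle>Xs 1 (a - 1) @ Xs b r | Ys 1 (a - 1) @ Ysum a b # Ys (b + 1) r\<rangle> *
      (Ebim (b - a)) \<langle>map (\<lambda>j. vX j - vX b) [a..<b] | Ys a (b - 1)\<rangle>) =
    (\<Sum>a=1..r - 1. phi_plus a A r * (- (vX a - vX (a + 1) + vY a) / 2))
    + (\<Sum>a=1..r - 2. (phi_plus a ^^ 2) A r * (1 / 4))"
  proof (intro arg_cong2 [where f = "(+)"] sum.cong refl)
    fix a assume a: "a \<in> {1..r - 1}"
    have "(Ebim 1) \<langle>[vX a - vX (a + 1)] | [vY a]\<rangle> = - (vX a - vX (a + 1) + vY a) / 2"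
      by (rule Ebim_subst1) (simp add: vX_eq_iff)
    moreover have "(A (r - 1)) \<langle>Xs 1 (a - 1) @ Xs (a + 1) r | Ys 1 (a - 1) @ Ysum a (a + 1) # Ys (a + 2) r\<rangle>
        = phi_plus a A r"
      using a by (auto simp: phi_plus_def pX_def cY_def Ysum_def)
    ultimately show "(case (a, a + 1) of (a, b) \<Rightarrow>
      (A (r - (b - a))) \<langle>Xs 1 (a - 1) @ Xs b r | Ys 1 (a - 1) @ Ysum a b # Ys (b + 1) r\<rangle> *
      (Ebim (b - a)) \<langle>map (\<lambda>j. vX j - vX b) [a..<b] | Ys a (b - 1)\<rangle>) =
      phi_plus a A r * (- (vX a - vX (a + 1) + vY a) / 2)"
      by (simp add: Ys_def)
  next
    fix a assume a: "a \<in> {1..r - 2}"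
    have "(Ebim 2) \<langle>[vX a - vX (a + 2), vX (a + 1) - vX (a + 2)] | [vY a, vY (a + 1)]\<rangle> = 1 / 4"
      by (rule Ebim_subst2) (simp_all add: vX_eq_iff)
    moreover have "(A (r - 2)) \<langle>Xs 1 (a - 1) @ Xs (a + 2) r | Ys 1 (a - 1) @ Ysum a (a + 2) # Ys (a + 3) r\<rangle>
        = (phi_plus a ^^ 2) A r"
      using a by (intro phi_plus_square [OF A]) auto
    ultimately show "(case (a, a + 2) of (a, b) \<Rightarrow>
      (A (r - (b - a))) \<langle>Xs 1 (a - 1) @ Xs b r | Ys 1 (a - 1) @ Ysum a b # Ys (b + 1) r\<rangle> *
      (Ebim (b - a)) \<langle>map (\<lambda>j. vX j - vX b) [a..<b] | Ys a (b - 1)\<rangle>) =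
      (phi_plus a ^^ 2) A r * (1 / 4)"
      by (simp add: Ys_def numeral_2_eq_2 numeral_3_eq_3)
  qed
qed

lemma anit_near:
  assumes A: "represents A M" and B: "\<And>n. n \<noteq> 1 \<Longrightarrow> n \<noteq> 2 \<Longrightarrow> B n = 0"
  shows "anit B A r = (\<Sum>a=1..r - 1. phi_minus (a + 1) A r *
        (B 1) \<langle>[vX (a + 1) - vX a] | [vY (a + 1)]\<rangle>)
    + (\<Sum>a=1..r - 2. (phi_minus (a + 1) ^^ 2) A r *
        (B 2) \<langle>[vX (a + 1) - vX a, vX (a + 2) - vX a] | [vY (a + 1), vY (a + 2)]\<rangle>)"
  unfolding anit_def
proof (subst sum_near_pairs)
  fix a b assume "1 \<le> a" "a < b" "b \<le> r" "b - a \<noteq> 1" "b - a \<noteq> 2"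
  then have "B (b - a) = 0" by (intro B)
  then show "(case (a, b) of (a, b) \<Rightarrow>
      (A (r - (b - a))) \<langle>Xs 1 a @ Xs (b + 1) r | Ys 1 (a - 1) @ Ysum a b # Ys (b + 1) r\<rangle> *
      (B (b - a)) \<langle>map (\<lambda>j. vX j - vX a) [a + 1..<b + 1] | Ys (a + 1) b\<rangle>) = 0"
    by simp
next
  show "(\<Sum>a=1..r - 1. case (a, a + 1) of (a, b) \<Rightarrow>
      (A (r - (b - a))) \<langle>Xs 1 a @ Xs (b + 1) r | Ys 1 (a - 1) @ Ysum a b # Ys (b + 1) r\<rangle> *
      (B (b - a)) \<langle>map (\<lambda>j. vX j - vX a) [a + 1..<b + 1] | Ys (a + 1) b\<rangle>) +
    (\<Sum>a=1..r - 2. case (a, a + 2) of (a, b) \<Rightarrow>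
      (A (r - (b - a))) \<langle>Xs 1 a @ Xs (b + 1) r | Ys 1 (a - 1) @ Ysum a b # Ys (b + 1) r\<rangle> *
      (B (b - a)) \<langle>map (\<lambda>j. vX j - vX a) [a + 1..<b + 1] | Ys (a + 1) b\<rangle>) =
    (\<Sum>a=1..r - 1. phi_minus (a + 1) A r *
        (B 1) \<langle>[vX (a + 1) - vX a] | [vY (a + 1)]\<rangle>)
    + (\<Sum>a=1..r - 2. (phi_minus (a + 1) ^^ 2) A r *
        (B 2) \<langle>[vX (a + 1) - vX a, vX (a + 2) - vX a] | [vY (a + 1), vY (a + 2)]\<rangle>)"
  proof (intro arg_cong2 [where f = "(+)"] sum.cong refl)
    fix a assume a: "a \<in> {1..r - 1}"
    have "(A (r - 1)) \<langle>Xs 1 a @ Xs (a + 2) r | Ys 1 (a - 1) @ Ysum a (a + 1) # Ys (a + 2) r\<rangle>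
        = phi_minus (a + 1) A r"
      using a by (auto simp: phi_minus_def pX_def cY_def Ysum_def)
    then show "(case (a, a + 1) of (a, b) \<Rightarrow>
      (A (r - (b - a))) \<langle>Xs 1 a @ Xs (b + 1) r | Ys 1 (a - 1) @ Ysum a b # Ys (b + 1) r\<rangle> *
      (B (b - a)) \<langle>map (\<lambda>j. vX j - vX a) [a + 1..<b + 1] | Ys (a + 1) b\<rangle>) =
      phi_minus (a + 1) A r * (B 1) \<langle>[vX (a + 1) - vX a] | [vY (a + 1)]\<rangle>"
      by (simp add: Ys_def)
  next
    fix a assume a: "a \<in> {1..r - 2}"
    have "(A (r - 2)) \<langle>Xs 1 a @ Xs (a + 3) r | Ys 1 (a - 1) @ Ysum a (a + 2) # Ys (a + 3) r\<rangle>
        = (phi_minus (a + 1) ^^ 2) A r"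
      using a by (intro phi_minus_square [OF A]) auto
    then show "(case (a, a + 2) of (a, b) \<Rightarrow>
      (A (r - (b - a))) \<langle>Xs 1 a @ Xs (b + 1) r | Ys 1 (a - 1) @ Ysum a b # Ys (b + 1) r\<rangle> *
      (B (b - a)) \<langle>map (\<lambda>j. vX j - vX a) [a + 1..<b + 1] | Ys (a + 1) b\<rangle>) =
      (phi_minus (a + 1) ^^ 2) A r *
        (B 2) \<langle>[vX (a + 1) - vX a, vX (a + 2) - vX a] | [vY (a + 1), vY (a + 2)]\<rangle>"
      by (simp add: Ys_def numeral_2_eq_2 numeral_3_eq_3)
  qed
qed

lemma mu_Ebim:
  assumes A: "represents A M" and "1 \<le> r"
  shows "mu A Ebim r = phi_plus r A r * (- (vX r + vY r) / 2)
    + (if 2 \<le> r then (phi_plus (r - 1) ^^ 2) A r * (1 / 4) else 0)"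
proof -
  let ?f = "\<lambda>i. (A i) \<langle>Xs 1 i | Ys 1 i\<rangle> * (Ebim (r - i)) \<langle>Xs (i + 1) r | Ys (i + 1) r\<rangle>"
  have "mu A Ebim r = sum ?f ({r - 1} \<union> (if 2 \<le> r then {r - 2} else {}))"
    unfolding mu_def
  proof (rule sum.mono_neutral_right)
    show "\<forall>i\<in>{0..r} - ({r - 1} \<union> (if 2 \<le> r then {r - 2} else {})). ?f i = 0"
    proof
      fix i assume "i \<in> {0..r} - ({r - 1} \<union> (if 2 \<le> r then {r - 2} else {}))"
      then have "Ebim (r - i) = 0" by (auto simp: Ebim_def split: if_splits)
      then show "?f i = 0" by simp
    qed
  qed (use \<open>1 \<le> r\<close> in auto)
  also have "\<dots> = ?f (r - 1) + (if 2 \<le> r then ?f (r - 2) else 0)"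
    by auto
  also have "?f (r - 1) = phi_plus r A r * (- (vX r + vY r) / 2)"
  proof -
    have "(Ebim 1) \<langle>[vX r] | [vY r]\<rangle> = - (vX r + vY r) / 2"
      by (rule Ebim_subst1) (rule vX_nonzero)
    moreover have "Xs r r = [vX r]" "Ys r r = [vY r]" "Xs (r + 1) r = []"
      by (simp_all add: Xs_def Ys_def)
    ultimately show ?thesis using \<open>1 \<le> r\<close> by (simp add: phi_plus_def pX_def cY_def)
  qed
  also have "(if 2 \<le> r then ?f (r - 2) else 0) =
      (if 2 \<le> r then (phi_plus (r - 1) ^^ 2) A r * (1 / 4) else 0)"
  proof (cases "2 \<le> r")
    case True
    then obtain k where k: "r = k + 2" by (metis add.commute le_Suc_ex)
    have "(Ebim 2) \<langle>[vX (k + 1), vX (k + 2)] | [vY (k + 1), vY (k + 2)]\<rangle> = 1 / 4"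
      by (rule Ebim_subst2) (simp_all add: vX_nonzero vX_eq_iff)
    moreover have "Xs (k + 1) (k + 2) = [vX (k + 1), vX (k + 2)]"
      "Ys (k + 1) (k + 2) = [vY (k + 1), vY (k + 2)]"
      by (simp_all add: Xs_def Ys_def)
    ultimately show ?thesis using phi_plus_square_last [OF A True] by (simp add: k)
  qed simp
  finally show ?thesis .
qed

text \<open>
  The bimould \<open>Y_1\<close> of depth 1; it measures how Q fails to commute with ganit poc.
\<close>

definition Ybim :: bimould where
  "Ybim r = (if r = 1 then vY 1 else 0)"

lemma represents_Ybim: "represents Ybim ymould"
  unfolding represents_def
proof (intro conjI allI)
  show "natural ymould"
    unfolding natural_def
  proof (intro allI impI)
    fix \<sigma> and w w' :: "ratfun word"
    assume "wspec \<sigma> w w'"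
    then show "spec \<sigma> (ymould w) (ymould w')"
    proof (cases w)
      case (Cons l v)
      then show ?thesis using \<open>wspec \<sigma> w w'\<close>
        by (cases v) (auto simp: wspec_Cons unit_def spec_0)
    qed (simp add: spec_0)
  qed
  fix r
  show "Ybim r = ymould (vars 1 r)"
  proof (cases "r = 0")
    case False
    then show ?thesis
      using vars_Cons [of 1 r] vars_Cons [of 2 r]
      by (cases "r = 1") (auto simp: Ybim_def unit_def vars_empty numeral_2_eq_2)
  qed (simp add: Ybim_def vars_empty)
qed

text \<open>
  The operators amit(E) and mu(A, E) account for all terms with \<open>\<phi>\<^sup>+\<close>; mu supplies the
  ones that involve the convention \<open>X_{r+1} = 0\<close>. The coefficients of \<open>\<phi>\<^sup>-\<close> in - anit(E) have
  the same dependence on X but the opposite sign of Y; the defect is anit of \<open>Y_1\<close>.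
\<close>

lemma delta_BvI_eq:
  assumes A: "represents A M" and "A 0 = 0"
  shows "delta_BvI A r = Qop A r - anit Ybim A r + (amit Ebim A r - anit Ebim A r + mu A Ebim r)"
proof (cases "r = 0")
  case True
  have "{(a, b). 1 \<le> a \<and> a < b \<and> b \<le> (0::nat)} = {}" by auto
  then have "amit Ebim A 0 = 0" "anit Ebim A 0 = 0" "anit Ybim A 0 = 0"
    unfolding amit_def anit_def by (simp_all only: sum.empty)
  moreover have "mu A Ebim 0 = 0"
    by (simp add: mu_def \<open>A 0 = 0\<close>)
  ultimately show ?thesis by (simp add: True delta_BvI_def Qop_def)
next
  case False
  then have "1 \<le> r" by simp
  let ?p = "\<lambda>i. phi_plus i A r" and ?m = "\<lambda>i. phi_minus i A r"
  let ?pp = "\<lambda>i. (phi_plus i ^^ 2) A r" and ?mm = "\<lambda>i. (phi_minus i ^^ 2) A r"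
  have shift1: "(\<Sum>a=1..r - 1. F (a + 1)) = (\<Sum>i=2..r. F i)" for F :: "nat \<Rightarrow> ratfun"
    by (rule sum.reindex_bij_witness [where i = "\<lambda>i. i - 1" and j = "\<lambda>a. a + 1"]) auto
  have shift2: "(\<Sum>a=1..r - 2. F (a + 1)) = (\<Sum>i=2..r - 1. F i)" for F :: "nat \<Rightarrow> ratfun"
    by (rule sum.reindex_bij_witness [where i = "\<lambda>i. i - 1" and j = "\<lambda>a. a + 1"]) auto
  have Y1: "(Ybim 1) \<langle>[x] | [y]\<rangle> = y" if "x \<noteq> 0" for x y
    using that by (subst represents_subst [OF represents_Ybim, of "[(x, y)]"]) (simp_all add: generic_def unit_def)
  have "anit Ybim A r = (\<Sum>a=1..r - 1. ?m (a + 1) * vY (a + 1))"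
    by (subst anit_near [OF A])
      (simp_all add: Ybim_def [of 2] Y1 [unfolded One_nat_def] vX_eq_iff, simp add: Ybim_def)
  then have anitY: "anit Ybim A r = (\<Sum>i=2..r. ?m i * vY i)"
    using shift1 [of "\<lambda>i. ?m i * vY i"] by simp
  have "anit Ebim A r = (\<Sum>a=1..r - 1. ?m (a + 1) * (- (vX (a + 1) - vX a + vY (a + 1)) / 2)) +
      (\<Sum>a=1..r - 2. ?mm (a + 1) * (1 / 4))"
    by (subst anit_near [OF A])
      (simp_all add: Ebim_subst1 [unfolded One_nat_def] Ebim_subst2 vX_eq_iff, simp_all add: Ebim_def)
  then have anitE: "anit Ebim A r = (\<Sum>i=2..r. ?m i * (- (vX i - vX (i - 1) + vY i) / 2)) +
      (\<Sum>i=2..r - 1. ?mm i * (1 / 4))"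
    using shift1 [of "\<lambda>i. ?m i * (- (vX i - vX (i - 1) + vY i) / 2)"] shift2 [of "\<lambda>i. ?mm i * (1 / 4)"]
    by simp
  have pp: "(\<Sum>i=1..r - 2. ?pp i * (1 / 4)) + (if 2 \<le> r then ?pp (r - 1) * (1 / 4) else 0) =
      1 / 4 * (\<Sum>i=1..r - 1. ?pp i)"
  proof (cases "2 \<le> r")
    case True
    then obtain k where k: "r = k + 2" by (metis add.commute le_Suc_ex)
    have "(\<Sum>i=1..r - 1. ?pp i) = (\<Sum>i=1..r - 2. ?pp i) + ?pp (r - 1)"
      by (simp add: k)
    then show ?thesis using True by (simp add: sum_distrib_left distrib_left mult.commute)
  qed simp
  \<comment> \<open>the summand i = r, where the convention for the last X applies, comes from mu\<close>
  have p: "(\<Sum>i=1..r - 1. ?p i * (- (vX i - vX (i + 1) + vY i) / 2)) + ?p r * (- (vX r + vY r) / 2) =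
      - (1 / 2 * (\<Sum>i=1..r. ((if i = r + 1 then 0 else vX i) -
          (if i + 1 = r + 1 then 0 else vX (i + 1)) + vY i) * ?p i))"
  proof -
    obtain k where k: "r = Suc k" using False by (cases r) auto
    have "(\<Sum>i=1..r. ((if i = r + 1 then 0 else vX i) -
          (if i + 1 = r + 1 then 0 else vX (i + 1)) + vY i) * ?p i) =
        (\<Sum>i=1..r - 1. (vX i - vX (i + 1) + vY i) * ?p i) + (vX r + vY r) * ?p r"
      by (simp add: k)
    moreover have "?p i * (- c / 2) = - (1 / 2 * (c * ?p i))" for c i
      by simp
    ultimately show ?thesis
      by (simp only: sum_negf distrib_left sum_distrib_left minus_add_distrib [symmetric])
  qed
  \<comment> \<open>the defect: y - (x - x' + y) / 2 equals (x' - x + y) / 2\<close>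
  have m: "(\<Sum>i=2..r. ?m i * vY i) + (\<Sum>i=2..r. ?m i * (- (vX i - vX (i - 1) + vY i) / 2)) =
      1 / 2 * (\<Sum>i=2..r. (vX (i - 1) - vX i + vY i) * ?m i)"
    unfolding sum.distrib [symmetric] sum_distrib_left
  proof (rule sum.cong)
    fix i
    show "?m i * vY i + ?m i * (- (vX i - vX (i - 1) + vY i) / 2) =
        1 / 2 * ((vX (i - 1) - vX i + vY i) * ?m i)"
      by (simp add: field_simps numeral_ratfun_nonzero)
  qed simp
  have m': "(\<Sum>i=2..r. ((if i - 1 = r + 1 then 0 else vX (i - 1)) - (if i = r + 1 then 0 else vX i) + vY i) * ?m i)
      = (\<Sum>i=2..r. (vX (i - 1) - vX i + vY i) * ?m i)"
    by (rule sum.cong) auto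
  define S1 where "S1 = (\<Sum>i=1..r - 1. ?p i * (- (vX i - vX (i + 1) + vY i) / 2))"
  define S2 where "S2 = (\<Sum>i=1..r - 2. ?pp i * (1 / 4))"
  define P1 where "P1 = ?p r * (- (vX r + vY r) / 2)"
  define P2 where "P2 = (if 2 \<le> r then ?pp (r - 1) * (1 / 4) else 0)"
  define T0 where "T0 = (\<Sum>i=2..r. ?m i * vY i)"
  define T1 where "T1 = (\<Sum>i=2..r. ?m i * (- (vX i - vX (i - 1) + vY i) / 2))"
  define T2 where "T2 = (\<Sum>i=2..r - 1. ?mm i * (1 / 4))"
  have "delta_BvI A r = Qop A r
        - 1 / 2 * (\<Sum>i=1..r. ((if i = r + 1 then 0 else vX i) -
          (if i + 1 = r + 1 then 0 else vX (i + 1)) + vY i) * ?p i)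
        - 1 / 2 * (\<Sum>i=2..r. ((if i - 1 = r + 1 then 0 else vX (i - 1)) -
          (if i = r + 1 then 0 else vX i) + vY i) * ?m i)
        + 1 / 4 * (\<Sum>i=1..r - 1. ?pp i) - 1 / 4 * (\<Sum>i=2..r - 1. ?mm i)"
    unfolding delta_BvI_def Let_def by (simp only: False if_False)
  also have "1 / 2 * (\<Sum>i=1..r. ((if i = r + 1 then 0 else vX i) -
          (if i + 1 = r + 1 then 0 else vX (i + 1)) + vY i) * ?p i) = - (S1 + P1)"
    unfolding S1_def P1_def p by (rule minus_minus [symmetric])
  also have "1 / 2 * (\<Sum>i=2..r. ((if i - 1 = r + 1 then 0 else vX (i - 1)) -
          (if i = r + 1 then 0 else vX i) + vY i) * ?m i) = T0 + T1"
    unfolding m' T0_def T1_def m ..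
  also have "1 / 4 * (\<Sum>i=1..r - 1. ?pp i) = S2 + P2"
    unfolding S2_def P2_def by (rule pp [symmetric])
  also have "1 / 4 * (\<Sum>i=2..r - 1. ?mm i) = T2"
    unfolding T2_def by (simp only: sum_distrib_left mult.commute)
  also have "Qop A r - - (S1 + P1) - (T0 + T1) + (S2 + P2) - T2 =
      Qop A r - T0 + ((S1 + S2) - (T1 + T2) + (P1 + P2))"
    by (simp add: algebra_simps)
  also have "T0 = anit Ybim A r"
    unfolding T0_def by (rule anitY [symmetric])
  also have "T1 + T2 = anit Ebim A r"
    unfolding T1_def T2_def by (rule anitE [symmetric])
  also have "S1 + S2 = amit Ebim A r"
    unfolding S1_def S2_def by (rule amit_Ebim [OF A, symmetric])
  also have "P1 + P2 = mu A Ebim r"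
    unfolding P1_def P2_def by (rule mu_Ebim [OF A \<open>1 \<le> r\<close>, symmetric])
  finally show ?thesis .
qed

section \<open>The two identities\<close>

lemma preuri_eq:
  assumes A: "represents A M" "M [] = 0" and B: "represents B N" "N [] = 0"
  shows "represents (preuri A B)
    (\<lambda>w. (wamit N M w - wanit N M w) + wanit (wC N) M w + wmu M N w)"
  unfolding preuri_def urit_def arit_def
  by (intro represents_add represents_diff represents_amit represents_anit represents_mu
      represents_Cbim A B wC_Nil)

text \<open>
  The conjugation formula holds for all generated arguments, and ganit commutes with mu; so inside
  ganit pic stands ganit poc of the commutator of preuri.
\<close>

lemma uri_eq:
  assumes A: "represents A M" "M [] = 0" "mu_generated M"
    and B: "represents B N" "N [] = 0" "mu_generated N"
  shows "uri A B r = preuri A B r - preuri B A r"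
proof -
  let ?G = "wganit wpoc"
  let ?X = "\<lambda>M N w. (wamit N M w - wanit N M w) + wmu M N w"
  let ?U = "\<lambda>M N w. (wamit N M w - wanit N M w) + wanit (wC N) M w + wmu M N w"
  have a: "represents (ganit poc A) (?G M)" "?G M [] = 0"
    and b: "represents (ganit poc B) (?G N)" "?G N [] = 0"
    using A B by (simp_all add: represents_ganit represents_poc)
  have "represents (uri A B) (wganit wpic (\<lambda>w. ?X (?G M) (?G N) w - ?X (?G N) (?G M) w))"
    unfolding uri_def ari_def preari_def arit_def
    by (intro represents_ganit represents_pic represents_diff represents_add represents_amit
        represents_anit represents_mu a b)
  then have "uri A B r = wganit wpic (\<lambda>w. ?X (?G M) (?G N) w - ?X (?G N) (?G M) w) (vars 1 r)"
    by (rule representsD)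
  also have "\<dots> = wganit wpic (?G (\<lambda>w. ?U M N w - ?U N M w)) (vars 1 r)"
  proof (rule wganit_cong_generic [OF _ generic_vars])
    fix w :: "ratfun word"
    assume w: "generic w"
    show "?X (?G M) (?G N) w - ?X (?G N) (?G M) w = ?G (\<lambda>w. ?U M N w - ?U N M w) w"
      unfolding wurit_wganit_wpoc_wC [where B = N, OF B(2) A(3) w]
        wurit_wganit_wpoc_wC [where B = M, OF A(2) B(3) w]
      by (simp only: wganit_add wganit_diff wganit_mu)
  qed
  also have "\<dots> = ?U M N (vars 1 r) - ?U N M (vars 1 r)"
    by (rule wganit_wpic_wpoc [OF generic_vars])
  also have "\<dots> = preuri A B r - preuri B A r"
    using representsD(2) [OF preuri_eq [OF A(1,2) B(1,2)]]
      representsD(2) [OF preuri_eq [OF B(1,2) A(1,2)]] by (simp only:)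
  finally show ?thesis .
qed

lemma Cbim_Ebim_zero: "anit (Cbim Ebim) A r = 0"
proof -
  have "Cbim Ebim n = 0" for n
    using representsD(2) [OF represents_Cbim [OF represents_Ebim wE_simps(1)], of n]
    by (simp only: wC_wE [OF generic_vars])
  then show ?thesis by (simp add: anit_def)
qed

lemma delta_0_eq:
  assumes A: "represents A M" "mu_generated M"
  shows "(ganit pic \<circ> Qop \<circ> ganit poc) A r = Qop A r - anit Ybim A r"
proof -
  have "represents ((ganit pic \<circ> Qop \<circ> ganit poc) A) (wganit wpic (wQ (wganit wpoc M)))"
    unfolding o_def by (intro represents_ganit represents_Qop represents_pic represents_poc A)
  then have "(ganit pic \<circ> Qop \<circ> ganit poc) A r = wganit wpic (wQ (wganit wpoc M)) (vars 1 r)"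
    by (rule representsD)
  also have "\<dots> = wganit wpic (wganit wpoc (\<lambda>z. wQ M z - wanit ymould M z)) (vars 1 r)"
    by (rule wganit_cong_generic [OF wQ_wganit_wpoc [OF A(2)] generic_vars])
  also have "\<dots> = wQ M (vars 1 r) - wanit ymould M (vars 1 r)"
    by (rule wganit_wpic_wpoc [OF generic_vars])
  also have "\<dots> = Qop A r - anit Ybim A r"
    using representsD(2) [OF represents_Qop [OF A(1)]]
      representsD(2) [OF represents_anit [OF A(1) represents_Ybim]] by simp
  finally show ?thesis .
qed

theorem proposition3p2:
  fixes A :: bimould
  assumes "A \<in> BARI_pol"
  shows "(ganit pic \<circ> Qop \<circ> ganit poc) A = delta_BvI A - preuri A Ebim
       \<and> delta_check A = delta_BvI A - preuri Ebim A"
proof -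
  have "\<forall>r. \<exists>p. A r = Fract p 1 \<and> (\<forall>m\<in>Poly_Mapping.keys p. Poly_Mapping.keys m \<subseteq> depth_vars r)"
    using assms by (auto simp: BARI_pol_def polynomials_of_depth_def depth_vars_def)
  then obtain p where p: "\<And>r. A r = Fract (p r) 1"
      "\<And>r m. m \<in> Poly_Mapping.keys (p r) \<Longrightarrow> Poly_Mapping.keys m \<subseteq> depth_vars r"
    by metis
  have A0: "A 0 = 0" and fin: "finite {r. A r \<noteq> 0}" using assms by (auto simp: BARI_pol_def)
  define M where "M = wpoly p"
  have M: "represents A M" "mu_generated M"
    unfolding M_def using represents_wpoly [of A p] mu_generated_wpoly [of A p] p A0 fin by blast+
  have M0: "M [] = 0" using representsD(2) [OF M(1), of 0] A0 by (simp add: vars_empty)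
  have E: "represents Ebim wE" "wE [] = (0 :: ratfun)" "mu_generated (wE :: ratfun wmould)"
    by (simp_all add: represents_Ebim mu_generated_wE)
  have first: "(ganit pic \<circ> Qop \<circ> ganit poc) A r = delta_BvI A r - preuri A Ebim r" for r
    unfolding delta_0_eq [OF M] delta_BvI_eq [OF M(1) A0]
    by (simp add: preuri_def urit_def arit_def Cbim_Ebim_zero)
  moreover have "delta_check A r = delta_BvI A r - preuri Ebim A r" for r
    using first [of r] uri_eq [OF M(1) M0 M(2) E] by (simp add: delta_check_def)
  ultimately show ?thesis by (intro conjI ext) simp_all
qed

end
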